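(* Let $\pi:P\to M$ be a principal bundle with structure group $G$, let $H$ be a Lie group containing $G$ as a Lie subgroup, with Lie algebras $\mathfrak g\subset\mathfrak h$, and let $P[H]=P\times_GH\to M$ be the associated principal $H$-bundle. Then the generalized Cartan connections in the space $\Omega^1(P;\mathfrak h)^G$ correspond canonically and bijectively to the $H$-principal connections in $\Omega^1(P[H];\mathfrak h)^H$.
   Context: $G$ acts on $H$ by left translation; $P[H]=P\times_GH$ is the quotient of $P\times H$ in which $(u.g,h)$ and $(u,gh)$ are identified for $g\in G$, with quotient projection $q:P\times H\to P[H]$. It is a principal $H$-bundle over $M$ with right action $\tilde r(q(u,h),h')=q(u,hh')$. $\Omega^1(P;\mathfrak h)^G$ is the space of $\kappa\in\Omega^1(P;\mathfrak h)$ with $(r^g)^*\kappa=\mathrm{Ad}(g^{-1})\circ\kappa$ for all $g\in G$, where $r^g(u)=u.g$; similarly $\Omega^1(P[H];\mathfrak h)^H$ is the space of $\mathfrak h$-valued 1-forms on $P[H]$ that are equivariant in the same sense under the right action of $H$. A generalized (principal $\mathfrak h/\mathfrak g$-)Cartan connection on $P$ (where $\dim\mathfrak h=\dim P$) is a $\kappa\in\Omega^1(P;\mathfrak h)^G$ with $\kappa(\zeta_X)=X$ for all $X\in\mathfrak g$, where $\zeta_X(u)=\frac{d}{dt}|_0\,u.\exp(tX)$; no non-degeneracy of $\kappa$ is required. An $H$-principal connection on $P[H]$ is an $\omega\in\Omega^1(P[H];\mathfrak h)^H$ with $\omega(\zeta^{P[H]}_Y)=Y$ for all $Y\in\mathfrak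 h$, where $\zeta^{P[H]}_Y$ is the fundamental vector field of $Y$ for the right $H$-action. *)

theory Defs
  imports "HOL-Analysis.Analysis" "HOL-Algebra.Group"
begin

text \<open>
  Manifolds are modelled on arbitrary finite-dimensional real inner product spaces. The class
  \<^emph>\<open>euclidean_space\<close> is not used since it excludes dimension 0 (discrete groups \<open>G\<close>, or \<open>M\<close> a
  discrete set of points).
\<close>

class model_space = real_inner +
  assumes finite_dimensional: "\<exists>B. finite B \<and> (\<forall>x. \<exists>r. x = (\<Sum>b\<in>B. r b *\<^sub>R b))"

lemma finite_spanning: "\<exists>B::'a::model_space set. finite B \<and> span B = UNIV"
proof -
  obtain B :: "'a set" where B: "finite B" "\<And>x. \<exists>r. x = (\<Sum>b\<in>B. r b *\<^sub>R b)"
    using finite_dimensional by blast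
  have "x \<in> span B" for x
    using B(2)[of x] span_finite[OF B(1)] by auto
  then show ?thesis using B(1) by auto
qed

instance euclidean_space \<subseteq> model_space
proof
  have "\<exists>r. x = (\<Sum>b\<in>Basis. r b *\<^sub>R b)" for x :: 'a
    using euclidean_representation[of x] by (intro exI[of _ "\<lambda>b. x \<bullet> b"]) simp
  then show "\<exists>B::'a set. finite B \<and> (\<forall>x. \<exists>r. x = (\<Sum>b\<in>B. r b *\<^sub>R b))"
    using finite_Basis by blast
qed

instance prod :: (model_space, model_space) model_space
proof
  obtain B :: "'a set" where B: "finite B" "span B = UNIV" using finite_spanning by blast
  obtain C :: "'b set" where C: "finite C" "span C = UNIV" using finite_spanning by blast
  let ?D = "(\<lambda>x. (x, 0::'b)) ` B \<union> (\<lambda>y. (0::'a, y)) ` C"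
  have l1: "linear (\<lambda>x::'a. (x, 0::'b))" and l2: "linear (\<lambda>y::'b. (0::'a, y))"
    by (auto intro!: linearI)
  have "(x, y) \<in> span ?D" for x y
  proof -
    have "(x, 0) \<in> span ?D"
      using span_mono[of "(\<lambda>x. (x, 0)) ` B" ?D] linear_span_image[OF l1, of B] B(2) by auto
    moreover have "(0, y) \<in> span ?D"
      using span_mono[of "(\<lambda>y. (0, y)) ` C" ?D] linear_span_image[OF l2, of C] C(2) by auto
    ultimately have "(x, 0) + (0, y) \<in> span ?D" by (rule span_add)
    then show ?thesis by simp
  qed
  then have "span ?D = UNIV" by auto
  moreover have "finite ?D" using B(1) C(1) by simp
  ultimately have "\<exists>r. x = (\<Sum>b\<in>?D. r b *\<^sub>R b)" for x
    using span_finite[of ?D] by blast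
  then show "\<exists>D::('a \<times> 'b) set. finite D \<and> (\<forall>x. \<exists>r. x = (\<Sum>b\<in>D. r b *\<^sub>R b))"
    using \<open>finite ?D\<close> by blast
qed

text \<open>\<open>Ck_on k S f\<close>, for open \<open>S\<close>: all iterated directional derivatives of order at most \<open>k\<close> exist
  and are continuous, with total differentiability at each stage.\<close>

fun Ck_on :: "nat \<Rightarrow> 'e::real_normed_vector set \<Rightarrow> ('e \<Rightarrow> 'f::real_normed_vector) \<Rightarrow> bool" where
  "Ck_on 0 S f \<longleftrightarrow> continuous_on S f"
| "Ck_on (Suc k) S f \<longleftrightarrow> (\<forall>x\<in>S. f differentiable (at x)) \<and>
     (\<forall>v. Ck_on k S (\<lambda>x. frechet_derivative f (at x) v))"

definition smooth_on :: "'e::real_normed_vector set \<Rightarrow> ('e \<Rightarrow> 'f::real_normed_vector) \<Rightarrow> bool" where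
  "smooth_on S f \<longleftrightarrow> (\<forall>k. Ck_on k S f)"


section \<open>Smooth manifolds\<close>

text \<open>A chart is a pair (domain, coordinate map); the values of the coordinate map outside the
  domain are irrelevant. A manifold is given by a (not necessarily maximal) atlas, which determines
  the underlying set and its topology.\<close>

type_synonym ('a, 'e) chart = "'a set \<times> ('a \<Rightarrow> 'e)"
type_synonym ('a, 'e) atlas = "('a, 'e) chart set"

definition pts :: "('a, 'e) atlas \<Rightarrow> 'a set" where
  "pts A = \<Union> (fst ` A)"

definition mopen :: "('a, 'e::model_space) atlas \<Rightarrow> 'a set \<Rightarrow> bool" where
  "mopen A U \<longleftrightarrow> U \<subseteq> pts A \<and> (\<forall>(D, \<phi>)\<in>A. open (\<phi> ` (D \<inter> U)))"

definition mtopology :: "('a, 'e::model_space) atlas \<Rightarrow> 'a topology" where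
  "mtopology A = topology (mopen A)"

definition smooth_manifold :: "('a, 'e::model_space) atlas \<Rightarrow> bool" where
  "smooth_manifold A \<longleftrightarrow>
     (\<forall>(D, \<phi>)\<in>A. inj_on \<phi> D \<and> open (\<phi> ` D)) \<and>
     (\<forall>(D, \<phi>)\<in>A. \<forall>(D', \<phi>')\<in>A.
        open (\<phi> ` (D \<inter> D')) \<and> smooth_on (\<phi> ` (D \<inter> D')) (\<phi>' \<circ> inv_into D \<phi>)) \<and>
     Hausdorff_space (mtopology A) \<and> second_countable (mtopology A)"

text \<open>Openness of the domains of the local representatives expresses continuity of \<open>f\<close>.\<close>

definition smooth_map ::
    "('a, 'e::model_space) atlas \<Rightarrow> ('b, 'f::model_space) atlas \<Rightarrow> ('a \<Rightarrow> 'b) \<Rightarrow> bool" where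
  "smooth_map A B f \<longleftrightarrow> f ` pts A \<subseteq> pts B \<and>
     (\<forall>(D, \<phi>)\<in>A. \<forall>(E, \<psi>)\<in>B.
        open (\<phi> ` (D \<inter> f -` E)) \<and> smooth_on (\<phi> ` (D \<inter> f -` E)) (\<psi> \<circ> f \<circ> inv_into D \<phi>))"

definition diffeomorphism ::
    "('a, 'e::model_space) atlas \<Rightarrow> ('b, 'f::model_space) atlas \<Rightarrow> ('a \<Rightarrow> 'b) \<Rightarrow> bool" where
  "diffeomorphism A B f \<longleftrightarrow> bij_betw f (pts A) (pts B) \<and>
     smooth_map A B f \<and> smooth_map B A (inv_into (pts A) f)"

definition prod_atlas :: "('a, 'e) atlas \<Rightarrow> ('b, 'f) atlas \<Rightarrow> ('a \<times> 'b, 'e \<times> 'f) atlas" where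
  "prod_atlas A B = {(D \<times> E, map_prod \<phi> \<psi>) | D \<phi> E \<psi>. (D, \<phi>) \<in> A \<and> (E, \<psi>) \<in> B}"

definition restrict_atlas :: "('a, 'e) atlas \<Rightarrow> 'a set \<Rightarrow> ('a, 'e) atlas" where
  "restrict_atlas A U = (\<lambda>(D, \<phi>). (D \<inter> U, \<phi>)) ` A"

definition real_atlas :: "(real, real) atlas" where
  "real_atlas = {(UNIV, id)}"


section \<open>Tangent vectors\<close>

text \<open>A tangent vector at \<open>p\<close> is the family of its coordinate vectors in all charts around \<open>p\<close>,
  related by the derivatives of the transition maps. Charts not around \<open>p\<close> are assigned 0. The
  vector space operations are pointwise.\<close>

type_synonym ('a, 'e) tvec = "('a, 'e) chart \<Rightarrow> 'e"

definition charts_at :: "('a, 'e) atlas \<Rightarrow> 'a \<Rightarrow> ('a, 'e) chart set" where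
  "charts_at A p = {c \<in> A. p \<in> fst c}"

definition tangent_space :: "('a, 'e::model_space) atlas \<Rightarrow> 'a \<Rightarrow> ('a, 'e) tvec set" where
  "tangent_space A p = {v.
     (\<forall>c\<in>charts_at A p. \<forall>c'\<in>charts_at A p.
        v c' = frechet_derivative (snd c' \<circ> inv_into (fst c) (snd c)) (at (snd c p)) (v c)) \<and>
     (\<forall>c. c \<notin> charts_at A p \<longrightarrow> v c = 0)}"

text \<open>The tangent vector at \<open>p\<close> with coordinate vector \<open>w\<close> in the chart \<open>c\<close>.\<close>

definition tangent_of ::
    "('a, 'e::model_space) atlas \<Rightarrow> ('a, 'e) chart \<Rightarrow> 'a \<Rightarrow> 'e \<Rightarrow> ('a, 'e) tvec" where
  "tangent_of A c p w = (\<lambda>c'. if c' \<in> charts_at A p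
     then frechet_derivative (snd c' \<circ> inv_into (fst c) (snd c)) (at (snd c p)) w else 0)"

text \<open>The tangent map \<open>T\<^sub>p f\<close>; the result does not depend on the chart \<open>c\<close> chosen around \<open>p\<close>.\<close>

definition tangent_map :: "('a, 'e::model_space) atlas \<Rightarrow> ('b, 'f::model_space) atlas \<Rightarrow>
    ('a \<Rightarrow> 'b) \<Rightarrow> 'a \<Rightarrow> ('a, 'e) tvec \<Rightarrow> ('b, 'f) tvec" where
  "tangent_map A B f p v = (let c = (SOME c. c \<in> charts_at A p) in
     (\<lambda>d. if d \<in> charts_at B (f p)
       then frechet_derivative (snd d \<circ> f \<circ> inv_into (fst c) (snd c)) (at (snd c p)) (v c) else 0))"

definition velocity :: "('a, 'e::model_space) atlas \<Rightarrow> (real \<Rightarrow> 'a) \<Rightarrow> real \<Rightarrow> ('a, 'e) tvec" where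
  "velocity A \<gamma> t = (\<lambda>c. if c \<in> charts_at A (\<gamma> t) then vector_derivative (snd c \<circ> \<gamma>) (at t) else 0)"


section \<open>Lie groups\<close>

record ('g, 'e) lie_group_data = "'g monoid" +
  atlas :: "('g, 'e) atlas"

definition lie_group :: "('g, 'e::model_space) lie_group_data \<Rightarrow> bool" where
  "lie_group G \<longleftrightarrow> group G \<and> smooth_manifold (atlas G) \<and> pts (atlas G) = carrier G \<and>
     smooth_map (prod_atlas (atlas G) (atlas G)) (atlas G) (\<lambda>(x, y). x \<otimes>\<^bsub>G\<^esub> y) \<and>
     smooth_map (atlas G) (atlas G) (\<lambda>x. inv\<^bsub>G\<^esub> x)"

definition lie_algebra :: "('g, 'e::model_space) lie_group_data \<Rightarrow> ('g, 'e) tvec set" where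
  "lie_algebra G = tangent_space (atlas G) \<one>\<^bsub>G\<^esub>"

definition one_parameter_subgroup ::
    "('g, 'e::model_space) lie_group_data \<Rightarrow> (real \<Rightarrow> 'g) \<Rightarrow> bool" where
  "one_parameter_subgroup G \<gamma> \<longleftrightarrow>
     smooth_map real_atlas (atlas G) \<gamma> \<and> (\<forall>s t. \<gamma> (s + t) = \<gamma> s \<otimes>\<^bsub>G\<^esub> \<gamma> t)"

definition lie_exp :: "('g, 'e::model_space) lie_group_data \<Rightarrow> ('g, 'e) tvec \<Rightarrow> 'g" where
  "lie_exp G X = (THE \<gamma>. one_parameter_subgroup G \<gamma> \<and> velocity (atlas G) \<gamma> 0 = X) 1"

definition Ad :: "('g, 'e::model_space) lie_group_data \<Rightarrow> 'g \<Rightarrow> ('g, 'e) tvec \<Rightarrow> ('g, 'e) tvec" where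
  "Ad H a = tangent_map (atlas H) (atlas H) (\<lambda>x. a \<otimes>\<^bsub>H\<^esub> x \<otimes>\<^bsub>H\<^esub> inv\<^bsub>H\<^esub> a) \<one>\<^bsub>H\<^esub>"

text \<open>Lie subgroups carry their own manifold structure, for which the inclusion is an immersion; it
  need not induce the subspace topology.\<close>

definition lie_subgroup ::
    "('h, 'eg::model_space) lie_group_data \<Rightarrow> ('h, 'eh::model_space) lie_group_data \<Rightarrow> bool" where
  "lie_subgroup G H \<longleftrightarrow> lie_group G \<and> lie_group H \<and> subgroup (carrier G) H \<and>
     (\<forall>x\<in>carrier G. \<forall>y\<in>carrier G. x \<otimes>\<^bsub>G\<^esub> y = x \<otimes>\<^bsub>H\<^esub> y) \<and>
     smooth_map (atlas G) (atlas H) (\<lambda>x. x) \<and>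
     (\<forall>x\<in>carrier G. inj_on (tangent_map (atlas G) (atlas H) (\<lambda>x. x) x) (tangent_space (atlas G) x))"

text \<open>The inclusion of Lie algebras \<open>\<gg> \<subset> \<hh>\<close>.\<close>

definition lie_algebra_incl :: "('h, 'eg::model_space) lie_group_data \<Rightarrow>
    ('h, 'eh::model_space) lie_group_data \<Rightarrow> ('h, 'eg) tvec \<Rightarrow> ('h, 'eh) tvec" where
  "lie_algebra_incl G H = tangent_map (atlas G) (atlas H) (\<lambda>x. x) \<one>\<^bsub>G\<^esub>"


section \<open>Principal bundles\<close>

record ('p, 'ep, 'm, 'em, 'g) bundle_data =
  total :: "('p, 'ep) atlas"
  base :: "('m, 'em) atlas"
  proj :: "'p \<Rightarrow> 'm"
  act :: "'p \<Rightarrow> 'g \<Rightarrow> 'p"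

text \<open>\<open>(U, \<tau>)\<close> stands for the equivariant local trivialization \<open>u \<mapsto> (proj u, \<tau> u)\<close> over \<open>U\<close>.\<close>

definition local_trivializations :: "('g, 'eg::model_space) lie_group_data \<Rightarrow>
    ('p, 'ep::model_space, 'm, 'em::model_space, 'g) bundle_data \<Rightarrow> ('m set \<times> ('p \<Rightarrow> 'g)) set" where
  "local_trivializations G P = {(U, \<tau>). mopen (base P) U \<and>
     diffeomorphism (restrict_atlas (total P) (proj P -` U))
       (prod_atlas (restrict_atlas (base P) U) (atlas G)) (\<lambda>u. (proj P u, \<tau> u)) \<and>
     (\<forall>u\<in>pts (total P). proj P u \<in> U \<longrightarrow> (\<forall>g\<in>carrier G.
        proj P (act P u g) = proj P u \<and> \<tau> (act P u g) = \<tau> u \<otimes>\<^bsub>G\<^esub> g))}"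

definition principal_bundle :: "('g, 'eg::model_space) lie_group_data \<Rightarrow>
    ('p, 'ep::model_space, 'm, 'em::model_space, 'g) bundle_data \<Rightarrow> bool" where
  "principal_bundle G P \<longleftrightarrow> lie_group G \<and> smooth_manifold (total P) \<and> smooth_manifold (base P) \<and>
     smooth_map (total P) (base P) (proj P) \<and>
     smooth_map (prod_atlas (total P) (atlas G)) (total P) (\<lambda>(u, g). act P u g) \<and>
     (\<forall>u\<in>pts (total P). act P u \<one>\<^bsub>G\<^esub> = u \<and>
        (\<forall>a\<in>carrier G. \<forall>b\<in>carrier G. act P (act P u a) b = act P u (a \<otimes>\<^bsub>G\<^esub> b))) \<and>
     (\<forall>x\<in>pts (base P). \<exists>(U, \<tau>)\<in>local_trivializations G P. x \<in> U)"

definition fundamental_field :: "('g, 'eg::model_space) lie_group_data \<Rightarrow>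
    ('p, 'ep::model_space, 'm, 'em::model_space, 'g) bundle_data \<Rightarrow>
    ('g, 'eg) tvec \<Rightarrow> 'p \<Rightarrow> ('p, 'ep) tvec" where
  "fundamental_field G P X u =
     velocity (total P) (\<lambda>t. act P u (lie_exp G (\<lambda>c. t *\<^sub>R X c))) 0"


section \<open>The associated bundle \<open>P[H]\<close>\<close>

definition assoc_rel :: "('h, 'eg::model_space) lie_group_data \<Rightarrow> ('h, 'eh::model_space) lie_group_data \<Rightarrow>
    ('p, 'ep::model_space, 'm, 'em::model_space, 'h) bundle_data \<Rightarrow> (('p \<times> 'h) \<times> ('p \<times> 'h)) set" where
  "assoc_rel G H P = {((act P u g, h), (u, g \<otimes>\<^bsub>H\<^esub> h)) | u g h.
     u \<in> pts (total P) \<and> g \<in> carrier G \<and> h \<in> carrier H}"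

definition assoc_proj :: "('h, 'eg::model_space) lie_group_data \<Rightarrow> ('h, 'eh::model_space) lie_group_data \<Rightarrow>
    ('p, 'ep::model_space, 'm, 'em::model_space, 'h) bundle_data \<Rightarrow> 'p \<times> 'h \<Rightarrow> ('p \<times> 'h) set" where
  "assoc_proj G H P x = assoc_rel G H P `` {x}"

definition assoc_space :: "('h, 'eg::model_space) lie_group_data \<Rightarrow> ('h, 'eh::model_space) lie_group_data \<Rightarrow>
    ('p, 'ep::model_space, 'm, 'em::model_space, 'h) bundle_data \<Rightarrow> ('p \<times> 'h) set set" where
  "assoc_space G H P = (pts (total P) \<times> carrier H) // assoc_rel G H P"

text \<open>A local trivialization \<open>(U, \<tau>)\<close> of \<open>P\<close> induces the bijection
  \<open>q(u, h) \<mapsto> (proj u, \<tau> u \<cdot> h)\<close> from the part of \<open>P[H]\<close> over \<open>U\<close> onto \<open>U \<times> H\<close>. The smooth structure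
  of \<open>P[H]\<close> is the one that turns these bijections into diffeomorphisms. All the functions whose
  images of a class are taken below are constant on the classes in question.\<close>

definition assoc_base_point :: "('p, 'ep, 'm, 'em, 'h) bundle_data \<Rightarrow> ('p \<times> 'h) set \<Rightarrow> 'm" where
  "assoc_base_point P z = the_elem ((\<lambda>(u, h). proj P u) ` z)"

definition assoc_triv :: "('h, 'eh) lie_group_data \<Rightarrow>
    ('p, 'ep, 'm, 'em, 'h) bundle_data \<Rightarrow> ('p \<Rightarrow> 'h) \<Rightarrow> ('p \<times> 'h) set \<Rightarrow> 'm \<times> 'h" where
  "assoc_triv H P \<tau> z = the_elem ((\<lambda>(u, h). (proj P u, \<tau> u \<otimes>\<^bsub>H\<^esub> h)) ` z)"

definition assoc_atlas :: "('h, 'eg::model_space) lie_group_data \<Rightarrow> ('h, 'eh::model_space) lie_group_data \<Rightarrow>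
    ('p, 'ep::model_space, 'm, 'em::model_space, 'h) bundle_data \<Rightarrow>
    (('p \<times> 'h) set, 'em \<times> 'eh) atlas" where
  "assoc_atlas G H P =
     {({z \<in> assoc_space G H P. assoc_base_point P z \<in> U \<and> assoc_triv H P \<tau> z \<in> D},
       \<phi> \<circ> assoc_triv H P \<tau>) | U \<tau> D \<phi>.
      (U, \<tau>) \<in> local_trivializations G P \<and>
      (D, \<phi>) \<in> prod_atlas (restrict_atlas (base P) U) (atlas H)}"

definition assoc_bundle :: "('h, 'eg::model_space) lie_group_data \<Rightarrow> ('h, 'eh::model_space) lie_group_data \<Rightarrow>
    ('p, 'ep::model_space, 'm, 'em::model_space, 'h) bundle_data \<Rightarrow>
    (('p \<times> 'h) set, 'em \<times> 'eh, 'm, 'em, 'h) bundle_data" where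
  "assoc_bundle G H P = \<lparr>total = assoc_atlas G H P, base = base P, proj = assoc_base_point P,
     act = (\<lambda>z h'. \<Union>(u, h)\<in>z. assoc_proj G H P (u, h \<otimes>\<^bsub>H\<^esub> h'))\<rparr>"


section \<open>Equivariant forms and connections\<close>

text \<open>\<open>\<hh>\<close>-valued smooth 1-forms. Smoothness means that the coefficients with respect to a chart \<open>c\<close>
  of the manifold and the coordinates on \<open>\<hh>\<close> given by a chart \<open>d\<close> of \<open>H\<close> at the unit are smooth.
  Forms are set to 0 outside the tangent bundle, so that equality of forms is equality of
  functions.\<close>

definition one_forms :: "('a, 'e::model_space) atlas \<Rightarrow> ('h, 'eh::model_space) lie_group_data \<Rightarrow>
    ('a \<Rightarrow> ('a, 'e) tvec \<Rightarrow> ('h, 'eh) tvec) set" where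
  "one_forms A H = {\<kappa>.
     (\<forall>p\<in>pts A. \<forall>v\<in>tangent_space A p. \<kappa> p v \<in> lie_algebra H) \<and>
     (\<forall>p\<in>pts A. \<forall>v\<in>tangent_space A p. \<forall>w\<in>tangent_space A p. \<forall>a b.
        \<kappa> p (\<lambda>c. a *\<^sub>R v c + b *\<^sub>R w c) = (\<lambda>d. a *\<^sub>R \<kappa> p v d + b *\<^sub>R \<kappa> p w d)) \<and>
     (\<forall>c\<in>A. \<forall>d\<in>charts_at (atlas H) \<one>\<^bsub>H\<^esub>. \<forall>w.
        smooth_on (snd c ` fst c)
          (\<lambda>x. let p = inv_into (fst c) (snd c) x in \<kappa> p (tangent_of A c p w) d)) \<and>
     (\<forall>p v. \<not> (p \<in> pts A \<and> v \<in> tangent_space A p) \<longrightarrow> \<kappa> p v = (\<lambda>_. 0))}"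

text \<open>\<open>\<Omega>\<^sup>1(P; \<hh>)\<^sup>K\<close> for a subgroup \<open>K\<close> of \<open>H\<close> acting on \<open>P\<close>.\<close>

definition equivariant_forms :: "('h, 'ek::model_space) lie_group_data \<Rightarrow>
    ('h, 'eh::model_space) lie_group_data \<Rightarrow>
    ('p, 'ep::model_space, 'm, 'em::model_space, 'h) bundle_data \<Rightarrow>
    ('p \<Rightarrow> ('p, 'ep) tvec \<Rightarrow> ('h, 'eh) tvec) set" where
  "equivariant_forms K H P = {\<kappa> \<in> one_forms (total P) H.
     \<forall>g\<in>carrier K. \<forall>u\<in>pts (total P). \<forall>v\<in>tangent_space (total P) u.
       \<kappa> (act P u g) (tangent_map (total P) (total P) (\<lambda>u. act P u g) u v)
         = Ad H (inv\<^bsub>H\<^esub> g) (\<kappa> u v)}"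

definition generalized_cartan_connections :: "('h, 'eg::model_space) lie_group_data \<Rightarrow>
    ('h, 'eh::model_space) lie_group_data \<Rightarrow>
    ('p, 'ep::model_space, 'm, 'em::model_space, 'h) bundle_data \<Rightarrow>
    ('p \<Rightarrow> ('p, 'ep) tvec \<Rightarrow> ('h, 'eh) tvec) set" where
  "generalized_cartan_connections G H P = {\<kappa> \<in> equivariant_forms G H P.
     \<forall>X\<in>lie_algebra G. \<forall>u\<in>pts (total P).
       \<kappa> u (fundamental_field G P X u) = lie_algebra_incl G H X}"

definition principal_connections :: "('h, 'eh::model_space) lie_group_data \<Rightarrow>
    ('p, 'ep::model_space, 'm, 'em::model_space, 'h) bundle_data \<Rightarrow>
    ('p \<Rightarrow> ('p, 'ep) tvec \<Rightarrow> ('h, 'eh) tvec) set" where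
  "principal_connections H P = {\<omega> \<in> equivariant_forms H H P.
     \<forall>Y\<in>lie_algebra H. \<forall>u\<in>pts (total P). \<omega> u (fundamental_field H P Y u) = Y}"

definition pullback_form :: "('a, 'e::model_space) atlas \<Rightarrow> ('b, 'f::model_space) atlas \<Rightarrow> ('a \<Rightarrow> 'b) \<Rightarrow>
    ('b \<Rightarrow> ('b, 'f) tvec \<Rightarrow> ('h, 'eh::model_space) tvec) \<Rightarrow> 'a \<Rightarrow> ('a, 'e) tvec \<Rightarrow> ('h, 'eh) tvec" where
  "pullback_form A B f \<omega> = (\<lambda>p v. if p \<in> pts A \<and> v \<in> tangent_space A p
     then \<omega> (f p) (tangent_map A B f p v) else (\<lambda>_. 0))"

text \<open>The canonical map \<open>P \<rightarrow> P[H]\<close>, \<open>u \<mapsto> q(u, e)\<close>.\<close>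

definition assoc_incl :: "('h, 'eg::model_space) lie_group_data \<Rightarrow> ('h, 'eh::model_space) lie_group_data \<Rightarrow>
    ('p, 'ep::model_space, 'm, 'em::model_space, 'h) bundle_data \<Rightarrow> 'p \<Rightarrow> ('p \<times> 'h) set" where
  "assoc_incl G H P u = assoc_proj G H P (u, \<one>\<^bsub>H\<^esub>)"

end

theory Submission
  imports Defs
begin

text \<open>
  Write \<open>\<iota> u = q(u, e)\<close> for the canonical map \<open>P \<rightarrow> P[H]\<close>. Every tangent vector of \<open>P[H]\<close> at \<open>q(u, h)\<close>
  is the sum of the image of some \<open>\<xi> \<in> T\<^sub>u P\<close> under \<open>T(r\<^sup>h \<circ> \<iota>)\<close> and of a fundamental vector \<open>\<zeta>\<^sub>Y\<close>. On such a
  sum a principal connection \<open>\<omega>\<close> must take the value \<open>Ad(h\<^sup>-\<^sup>1) ((\<iota>\<^sup>* \<omega>)(\<xi>)) + Y\<close>, so \<open>\<omega>\<close> is determined by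
  \<open>\<iota>\<^sup>* \<omega>\<close>. Conversely, given a Cartan connection \<open>\<kappa>\<close> and a local section \<open>s\<close> of \<open>P\<close>, which identifies
  \<open>P[H]\<close> locally with \<open>U \<times> H\<close>, the smooth form \<open>Ad(h\<^sup>-\<^sup>1) (s\<^sup>* \<kappa>) + \<theta>\<close> with the Maurer-Cartan form \<open>\<theta>\<close> of \<open>H\<close>
  takes the value \<open>Ad(h\<^sup>-\<^sup>1) (\<kappa>(\<xi>)) + Y\<close> on these sums. Hence it does not depend on \<open>s\<close>, and these
  local forms fit together to a principal connection with pullback \<open>\<kappa>\<close>.

  Fundamental fields are defined through the exponential map, so the existence and uniqueness of
  one-parameter subgroups enters: it rests on the local solvability of ordinary differential equations.
\<close>

section \<open>Finite-dimensional calculus\<close>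

text \<open>The decomposition of a tangent vector of P[H] is in general not unique: the directions
  of the G-orbits occur in both summands. A definition of the extension through the summands would
  call for an argument of well-definedness and would leave smoothness open. Hence the local forms,
  whose smoothness is visible, come before any use of the decomposition and are merely evaluated on
  it. The condition \<kappa>(\<zeta>_X) = X enters when a point u is compared with the value of the
  section in the same fibre: together with G-equivariance it makes the contribution of the section
  cancel. A technical obstacle is that group operations, trivializations and sections are total
  functions with a meaning on part of their types only. Smoothness is therefore treated at single
  points (\<open>smooth_at\<close>), and maps are compared on neighbourhoods (\<open>nhd\<close>).
  Since models of dimension 0 are allowed, coordinate expansions run over
  \<open>mbasis\<close>.\<close>

lemma orthonormal_expansion_exists:
  "\<exists>B::'a::model_space set. finite B \<and> (\<forall>x. (\<Sum>b\<in>B. (x \<bullet> b) *\<^sub>R b) = x)"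
proof -
  obtain S :: "'a set" where S: "finite S" "span S = UNIV" using finite_spanning by blast
  obtain C :: "'a set" where C: "finite C" "span C = UNIV" "pairwise orthogonal C"
    using basis_orthogonal[OF S(1)] S(2) by metis
  \<comment> \<open>The zero vector, which \<open>basis_orthogonal\<close> does not exclude, is
    dropped so that the rest can be normalized.\<close>
  define C' where "C' = C - {0}"
  define D where "D = (\<lambda>c. c /\<^sub>R norm c) ` C'"
  have C'o: "finite C'" "pairwise orthogonal C'" "0 \<notin> C'"
    using C by (auto simp: C'_def pairwise_def)
  have inj: "inj_on (\<lambda>c. c /\<^sub>R norm c) C'"
  proof (rule inj_onI)
    fix a b assume ab: "a \<in> C'" "b \<in> C'" and eq: "a /\<^sub>R norm a = b /\<^sub>R norm b"
    show "a = b"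
    proof (rule ccontr)
      assume "a \<noteq> b"
      then have "a \<bullet> b = 0" using C'o ab by (auto simp: pairwise_def orthogonal_def)
      moreover have "a \<noteq> 0" "b \<noteq> 0" using ab C'o by auto
      moreover have "(a /\<^sub>R norm a) \<bullet> (b /\<^sub>R norm b) = (b /\<^sub>R norm b) \<bullet> (b /\<^sub>R norm b)" using eq by simp
      ultimately show False by simp
    qed
  qed
  have "(\<Sum>b\<in>D. (x \<bullet> b) *\<^sub>R b) = x" for x
  proof -
    \<comment> \<open>The remainder is orthogonal to all of \<open>C\<close>, hence to its span,
      which is the whole space, hence to itself.\<close>
    define y where "y = x - (\<Sum>b\<in>D. (x \<bullet> b) *\<^sub>R b)"
    have s: "(\<Sum>b\<in>D. (x \<bullet> b) *\<^sub>R b) = (\<Sum>c\<in>C'. ((x \<bullet> c) / (c \<bullet> c)) *\<^sub>R c)"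
      unfolding D_def by (subst sum.reindex[OF inj])
        (auto intro!: sum.cong simp: dot_square_norm power2_eq_square divide_inverse mult_ac)
    have "y \<bullet> c = 0" if "c \<in> C'" for c
    proof -
      have "(\<Sum>d\<in>C'. ((x \<bullet> d) / (d \<bullet> d)) * (d \<bullet> c)) = (\<Sum>d\<in>C'. if d = c then x \<bullet> c else 0)"
        using that C'o by (intro sum.cong) (auto simp: pairwise_def orthogonal_def)
      also have "\<dots> = x \<bullet> c" using that C'o(1) by simp
      finally show ?thesis unfolding y_def s by (simp add: inner_diff_left inner_sum_left)
    qed
    then have "orthogonal y c" if "c \<in> C" for c
      using that by (cases "c = 0") (auto simp: C'_def orthogonal_def)
    then have "orthogonal y y"
      using C(2) orthogonal_to_span[of y C y] by (metis UNIV_I orthogonal_commute)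
    then show ?thesis by (simp add: y_def orthogonal_self)
  qed
  moreover have "finite D" using C'o by (simp add: D_def)
  ultimately show ?thesis by blast
qed

text \<open>Only the expansion is recorded, so this is a Parseval frame and not necessarily a basis;
  the expansion of linear maps along it rests on this property alone.\<close>

definition mbasis :: "'a::model_space set" where
  "mbasis = (SOME B. finite B \<and> (\<forall>x. (\<Sum>b\<in>B. (x \<bullet> b) *\<^sub>R b) = x))"

lemma finite_mbasis [simp]: "finite (mbasis :: 'a::model_space set)"
  and mbasis_expand: "(\<Sum>b\<in>mbasis. (x \<bullet> b) *\<^sub>R b) = (x::'a)"
proof -
  have "finite (mbasis::'a set) \<and> (\<forall>x::'a. (\<Sum>b\<in>mbasis. (x \<bullet> b) *\<^sub>R b) = x)"
    unfolding mbasis_def by (rule someI_ex[OF orthonormal_expansion_exists])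
  then show "finite (mbasis :: 'a set)" "(\<Sum>b\<in>mbasis. (x \<bullet> b) *\<^sub>R b) = x" by auto
qed

lemma linear_mbasis:
  assumes "linear f"
  shows "f (x::'a::model_space) = (\<Sum>b\<in>mbasis. (x \<bullet> b) *\<^sub>R f b)"
proof -
  have "f x = f (\<Sum>b\<in>mbasis. (x \<bullet> b) *\<^sub>R b)" by (simp add: mbasis_expand)
  also have "\<dots> = (\<Sum>b\<in>mbasis. (x \<bullet> b) *\<^sub>R f b)"
    by (simp add: linear_sum[OF assms] linear_scale[OF assms])
  finally show ?thesis .
qed

text \<open>The coordinates of a Cauchy sequence converge. Completeness is what integrals and the
  contraction principle require when differential equations are solved.\<close>

instance model_space \<subseteq> banach
proof
  fix X :: "nat \<Rightarrow> 'a" assume X: "Cauchy X"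
  have "convergent (\<lambda>n. X n \<bullet> b)" for b
    using bounded_linear.Cauchy[OF bounded_linear_inner_left X] Cauchy_convergent by blast
  then obtain l where l: "\<And>b. (\<lambda>n. X n \<bullet> b) \<longlonglongrightarrow> l b"
    unfolding convergent_def by metis
  have "(\<lambda>n. \<Sum>b\<in>mbasis. (X n \<bullet> b) *\<^sub>R b) \<longlonglongrightarrow> (\<Sum>b\<in>mbasis. l b *\<^sub>R b)"
    by (intro tendsto_sum tendsto_scaleR l tendsto_const)
  then show "convergent X" unfolding mbasis_expand convergent_def by blast
qed

section \<open>Derivatives and maps of class C^k\<close>

lemma frechet_derivative_has:
  "f differentiable (at x) \<Longrightarrow> (f has_derivative frechet_derivative f (at x)) (at x)"
  by (simp add: frechet_derivative_works)

lemma frechet_linear: "f differentiable (at x) \<Longrightarrow> linear (frechet_derivative f (at x))"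
  by (rule linear_frechet_derivative)

lemma frechet_derivative_eq: "(f has_derivative D) (at x) \<Longrightarrow> frechet_derivative f (at x) = D"
  by (rule frechet_derivative_at[symmetric])

lemma has_derivative_cong_open:
  assumes "open S" "x \<in> S" "\<And>y. y \<in> S \<Longrightarrow> f y = g y"
  shows "(f has_derivative D) (at x) \<longleftrightarrow> (g has_derivative D) (at x)"
  using assms has_derivative_transform_within_open[of f D x UNIV S g]
    has_derivative_transform_within_open[of g D x UNIV S f] by metis

lemma frechet_derivative_cong_open:
  assumes "open S" "x \<in> S" "\<And>y. y \<in> S \<Longrightarrow> f y = g y"
  shows "frechet_derivative f (at x) = frechet_derivative g (at x)"
  unfolding frechet_derivative_def by (simp add: has_derivative_cong_open[OF assms])

lemma differentiable_cong_open:
  assumes "open S" "x \<in> S" "\<And>y. y \<in> S \<Longrightarrow> f y = g y"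
  shows "f differentiable (at x) \<longleftrightarrow> g differentiable (at x)"
  unfolding differentiable_def by (simp add: has_derivative_cong_open[OF assms])

lemma Ck_on_cong:
  assumes "open S" "\<And>x. x \<in> S \<Longrightarrow> f x = g x" "Ck_on k S f"
  shows "Ck_on k S g"
  using assms(2,3)
proof (induction k arbitrary: f g)
  case 0
  then show ?case by (simp cong: continuous_on_cong)
next
  case (Suc k)
  have "g differentiable (at x)" if "x \<in> S" for x
    using Suc.prems(2) that differentiable_cong_open[OF assms(1) that, of f g] Suc.prems(1) by auto
  moreover have "Ck_on k S (\<lambda>x. frechet_derivative g (at x) v)" for v
    by (rule Suc.IH[where f="\<lambda>x. frechet_derivative f (at x) v"])
      (use Suc.prems frechet_derivative_cong_open[OF assms(1), of _ f g] in auto)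
  ultimately show ?case by simp
qed

lemma Ck_on_subset: "Ck_on k S f \<Longrightarrow> T \<subseteq> S \<Longrightarrow> Ck_on k T f"
  by (induction k arbitrary: f) (auto intro: continuous_on_subset)

lemma Ck_on_SucD: "Ck_on (Suc k) S f \<Longrightarrow> Ck_on k S f"
proof (induction k arbitrary: f)
  case 0
  then show ?case
    by (auto intro!: differentiable_imp_continuous_on simp: differentiable_on_def differentiable_at_withinI)
qed auto

lemma Ck_on_local:
  assumes "open S" "\<And>x. x \<in> S \<Longrightarrow> \<exists>T. open T \<and> x \<in> T \<and> Ck_on k T f"
  shows "Ck_on k S f"
  using assms(2)
proof (induction k arbitrary: f)
  case 0
  then have "isCont f x" if "x \<in> S" for x
    using that by (metis Ck_on.simps(1) continuous_on_eq_continuous_at)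
  then show ?case by (simp add: continuous_at_imp_continuous_on)
next
  case (Suc k)
  have "\<exists>T. open T \<and> x \<in> T \<and> Ck_on k T (\<lambda>x. frechet_derivative f (at x) v)" if "x \<in> S" for x v
    using Suc.prems[OF that] by auto
  moreover have "f differentiable (at x)" if "x \<in> S" for x
    using Suc.prems[OF that] by auto
  ultimately show ?case using Suc.IH by auto
qed

lemma Ck_on_const: "Ck_on k S (\<lambda>x. c)"
proof (induction k arbitrary: c)
  case (Suc k)
  have "frechet_derivative (\<lambda>x. c) (at x) = (\<lambda>_. 0)" for x :: 'a
    by (rule frechet_derivative_eq) (auto intro: derivative_eq_intros)
  then show ?case using Suc by simp
qed simp

lemma Ck_on_linear:
  assumes "bounded_linear f"
  shows "Ck_on k S f"
proof (cases k)
  case 0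
  then show ?thesis using assms by (simp add: linear_continuous_on)
next
  case (Suc k)
  have d: "(f has_derivative f) (at x)" for x
    by (rule bounded_linear_imp_has_derivative[OF assms])
  then have "frechet_derivative f (at x) = f" for x by (rule frechet_derivative_eq)
  then show ?thesis using d Suc Ck_on_const by (auto simp: differentiable_def)
qed

lemma Ck_on_add:
  assumes "open S" "Ck_on k S f" "Ck_on k S g"
  shows "Ck_on k S (\<lambda>x. f x + g x)"
  using assms(2,3)
proof (induction k arbitrary: f g)
  case 0
  then show ?case by (simp add: continuous_on_add)
next
  case (Suc k)
  have eq: "frechet_derivative f (at x) v + frechet_derivative g (at x) v
      = frechet_derivative (\<lambda>x. f x + g x) (at x) v" if "x \<in> S" for x v
    using Suc.prems that
    by (subst frechet_derivative_eq[OF has_derivative_add[OF frechet_derivative_has frechet_derivative_has]]) auto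
  have "Ck_on k S (\<lambda>x. frechet_derivative (\<lambda>x. f x + g x) (at x) v)" for v
    by (rule Ck_on_cong[OF assms(1) eq]) (use Suc in auto)
  then show ?case using Suc.prems by auto
qed

text \<open>The product rule expresses a derivative by two terms of the same bilinear shape in which
  one factor has lost one order; the other factor is lowered by \<open>Ck_on_SucD\<close>.\<close>

lemma Ck_on_bilinear:
  assumes "bounded_bilinear m" "open S" "Ck_on k S f" "Ck_on k S g"
  shows "Ck_on k S (\<lambda>x. m (f x) (g x))"
  using assms(3,4)
proof (induction k arbitrary: f g)
  case 0
  then show ?case by (simp add: bounded_bilinear.continuous_on[OF assms(1)])
next
  case (Suc k)
  have hd: "((\<lambda>x. m (f x) (g x)) has_derivative (\<lambda>v. m (f x) (frechet_derivative g (at x) v) +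
      m (frechet_derivative f (at x) v) (g x))) (at x)" if "x \<in> S" for x
    using Suc.prems that by (intro bounded_bilinear.FDERIV[OF assms(1)] frechet_derivative_has) auto
  have eq: "m (f x) (frechet_derivative g (at x) v) + m (frechet_derivative f (at x) v) (g x)
      = frechet_derivative (\<lambda>x. m (f x) (g x)) (at x) v" if "x \<in> S" for x v
    using frechet_derivative_eq[OF hd[OF that]] by simp
  have "Ck_on k S (\<lambda>x. frechet_derivative (\<lambda>x. m (f x) (g x)) (at x) v)" for v
  proof (rule Ck_on_cong[OF assms(2) eq])
    show "Ck_on k S (\<lambda>x. m (f x) (frechet_derivative g (at x) v) + m (frechet_derivative f (at x) v) (g x))"
      using Suc.prems Ck_on_SucD[of k S f] Ck_on_SucD[of k S g]
      by (intro Ck_on_add[OF assms(2)] Suc.IH) auto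
  qed
  then show ?case using hd by (auto simp: differentiable_def)
qed

lemma Ck_on_sum:
  assumes "open S" "\<And>i. i \<in> I \<Longrightarrow> Ck_on k S (f i)"
  shows "Ck_on k S (\<lambda>x. \<Sum>i\<in>I. f i x)"
  using assms(2)
proof (induction I rule: infinite_finite_induct)
  case (insert i I)
  then show ?case using Ck_on_add[OF assms(1), of k "f i" "\<lambda>x. \<Sum>i\<in>I. f i x"] by simp
qed (auto simp: Ck_on_const)

text \<open>The direction in which \<open>f\<close> is differentiated varies with the point, whereas
  \<open>Ck_on\<close> speaks of fixed directions. Expanding it along \<open>mbasis\<close> turns
  the chain rule into a finite sum of scalar coefficients times fixed directional derivatives of
  \<open>f\<close>, to which the induction hypothesis applies.\<close>

lemma Ck_on_compose:
  fixes g :: "'e::real_normed_vector \<Rightarrow> 'f::model_space"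
  assumes "open S" "open T" "g ` S \<subseteq> T" "Ck_on k S g" "Ck_on k T f"
  shows "Ck_on k S (\<lambda>x. f (g x))"
  using assms(4,5)
proof (induction k arbitrary: f)
  case 0
  then show ?case using continuous_on_compose2[of T f S g] assms(3) by simp
next
  case (Suc k)
  have lin: "linear (frechet_derivative f (at (g x)))" if "x \<in> S" for x
    using Suc.prems that assms(3) by (intro frechet_linear) auto
  have hd: "((\<lambda>x. f (g x)) has_derivative (\<lambda>v. frechet_derivative f (at (g x)) (frechet_derivative g (at x) v))) (at x)"
    if "x \<in> S" for x
    using Suc.prems that assms(3)
    by (intro has_derivative_compose[of g _ x UNIV f] frechet_derivative_has) auto
  have eq: "(\<Sum>b\<in>mbasis. (frechet_derivative g (at x) v \<bullet> b) *\<^sub>R frechet_derivative f (at (g x)) b)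
      = frechet_derivative (\<lambda>x. f (g x)) (at x) v" if "x \<in> S" for x v
    unfolding frechet_derivative_eq[OF hd[OF that]] by (rule linear_mbasis[OF lin[OF that], symmetric])
  have gk: "Ck_on k S g" using Suc.prems Ck_on_SucD by blast
  have "Ck_on k S (\<lambda>x. frechet_derivative (\<lambda>x. f (g x)) (at x) v)" for v
  proof (rule Ck_on_cong[OF assms(1) eq])
    show "Ck_on k S (\<lambda>x. \<Sum>b\<in>mbasis. (frechet_derivative g (at x) v \<bullet> b) *\<^sub>R frechet_derivative f (at (g x)) b)"
    proof (intro Ck_on_sum Ck_on_bilinear[OF bounded_bilinear_scaleR] assms(1))
      fix b :: 'f
      have "Ck_on k S (\<lambda>x. frechet_derivative g (at x) v)" using Suc.prems by auto
      then show "Ck_on k S (\<lambda>x. frechet_derivative g (at x) v \<bullet> b)"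
        by (intro Ck_on_bilinear[OF bounded_bilinear_inner] assms(1) Ck_on_const)
      show "Ck_on k S (\<lambda>x. frechet_derivative f (at (g x)) b)"
        using Suc.prems by (intro Suc.IH[OF gk, of "\<lambda>y. frechet_derivative f (at y) b"]) auto
    qed
  qed
  then show ?case using hd by (auto simp: differentiable_def)
qed

section \<open>Smooth maps between vector spaces\<close>

lemma smooth_on_cong:
  "open S \<Longrightarrow> (\<And>x. x \<in> S \<Longrightarrow> f x = g x) \<Longrightarrow> smooth_on S f \<Longrightarrow> smooth_on S g"
  unfolding smooth_on_def using Ck_on_cong by blast

lemma smooth_on_subset: "smooth_on S f \<Longrightarrow> T \<subseteq> S \<Longrightarrow> smooth_on T f"
  unfolding smooth_on_def using Ck_on_subset by blast

lemma smooth_on_local: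
  assumes "open S" "\<And>x. x \<in> S \<Longrightarrow> \<exists>T. open T \<and> x \<in> T \<and> smooth_on T f"
  shows "smooth_on S f"
  using assms Ck_on_local unfolding smooth_on_def by metis

lemma smooth_on_differentiable: "smooth_on S f \<Longrightarrow> x \<in> S \<Longrightarrow> f differentiable (at x)"
  unfolding smooth_on_def by (metis Ck_on.simps(2))

lemma smooth_on_has_derivative:
  "smooth_on S f \<Longrightarrow> x \<in> S \<Longrightarrow> (f has_derivative frechet_derivative f (at x)) (at x)"
  using smooth_on_differentiable frechet_derivative_has by blast

lemma smooth_on_continuous: "smooth_on S f \<Longrightarrow> continuous_on S f"
  unfolding smooth_on_def by (metis Ck_on.simps(1))

lemma smooth_on_frechet: "smooth_on S f \<Longrightarrow> smooth_on S (\<lambda>x. frechet_derivative f (at x) v)"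
  unfolding smooth_on_def by (metis Ck_on.simps(2))

lemma smooth_on_const: "smooth_on S (\<lambda>x. c)"
  by (simp add: smooth_on_def Ck_on_const)

lemma smooth_on_linear: "bounded_linear f \<Longrightarrow> smooth_on S f"
  by (simp add: smooth_on_def Ck_on_linear)

lemma smooth_on_id: "smooth_on S (\<lambda>x. x)"
  by (simp add: smooth_on_linear bounded_linear_ident)

lemma smooth_on_add:
  "open S \<Longrightarrow> smooth_on S f \<Longrightarrow> smooth_on S g \<Longrightarrow> smooth_on S (\<lambda>x. f x + g x)"
  by (simp add: smooth_on_def Ck_on_add)

lemma smooth_on_bilinear:
  "bounded_bilinear m \<Longrightarrow> open S \<Longrightarrow> smooth_on S f \<Longrightarrow> smooth_on S g \<Longrightarrow> smooth_on S (\<lambda>x. m (f x) (g x))"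
  by (simp add: smooth_on_def Ck_on_bilinear)

lemma smooth_on_sum:
  "open S \<Longrightarrow> (\<And>i. i \<in> I \<Longrightarrow> smooth_on S (f i)) \<Longrightarrow> smooth_on S (\<lambda>x. \<Sum>i\<in>I. f i x)"
  by (simp add: smooth_on_def Ck_on_sum)

lemma smooth_on_compose:
  fixes g :: "'e::real_normed_vector \<Rightarrow> 'f::model_space"
  assumes "open S" "open T" "g ` S \<subseteq> T" "smooth_on S g" "smooth_on T f"
  shows "smooth_on S (\<lambda>x. f (g x))"
  using assms Ck_on_compose unfolding smooth_on_def by blast

lemma smooth_on_Pair:
  fixes f :: "'e::real_normed_vector \<Rightarrow> 'f::real_normed_vector"
    and g :: "'e::real_normed_vector \<Rightarrow> 'g::real_normed_vector"
  assumes "open S" "smooth_on S f" "smooth_on S g"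
  shows "smooth_on S (\<lambda>x. (f x, g x))"
proof -
  \<comment> \<open>\<open>smooth_on_compose\<close> asks the intermediate space to be a
    \<open>model_space\<close>. For a linear outer map the bilinear map
    \<open>\<lambda>r x. r *\<^sub>R L x\<close> with the constant factor 1 does instead.\<close>
  have lin: "smooth_on S (\<lambda>x. L (h x))"
    if L: "bounded_linear L" and h: "smooth_on S h" for L :: "'p::real_normed_vector \<Rightarrow> 'q::real_normed_vector" and h
  proof -
    have "bounded_bilinear (\<lambda>(r::real) x. r *\<^sub>R L x)"
      by (rule bounded_bilinear.comp[OF bounded_bilinear_scaleR bounded_linear_ident L])
    from smooth_on_bilinear[OF this assms(1) smooth_on_const h, of 1] show ?thesis by simp
  qed
  have "smooth_on S (\<lambda>x. (f x, 0) + (0, g x))"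
    by (rule smooth_on_add[OF assms(1)]
        lin[OF bounded_linear_Pair[OF bounded_linear_ident bounded_linear_zero] assms(2)]
        lin[OF bounded_linear_Pair[OF bounded_linear_zero bounded_linear_ident] assms(3)])+
  then show ?thesis by simp
qed

text \<open>Tangent maps applied to vectors that vary with the base point have this form in
  coordinates.\<close>

lemma smooth_on_directional:
  fixes f :: "'f::model_space \<Rightarrow> 'g::real_normed_vector" and g :: "'e::real_normed_vector \<Rightarrow> 'f"
  assumes "open S" "open T" "g ` S \<subseteq> T" "smooth_on S g" "smooth_on S w" "smooth_on T f"
  shows "smooth_on S (\<lambda>x. frechet_derivative f (at (g x)) (w x))"
proof (rule smooth_on_cong[OF assms(1)])
  show "smooth_on S (\<lambda>x. \<Sum>b\<in>mbasis. (w x \<bullet> b) *\<^sub>R frechet_derivative f (at (g x)) b)"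
    by (intro smooth_on_sum assms smooth_on_bilinear[OF bounded_bilinear_scaleR]
        smooth_on_bilinear[OF bounded_bilinear_inner] smooth_on_const
        smooth_on_compose[of S T g "\<lambda>y. frechet_derivative f (at y) _"] smooth_on_frechet)
  show "(\<Sum>b\<in>mbasis. (w x \<bullet> b) *\<^sub>R frechet_derivative f (at (g x)) b) = frechet_derivative f (at (g x)) (w x)"
    if "x \<in> S" for x
    using assms that smooth_on_differentiable
    by (intro linear_mbasis[symmetric] frechet_linear) blast
qed


section \<open>Autonomous ordinary differential equations\<close>

text \<open>The sum \<open>g\<close> dominates the operator norm of the derivative and is
  continuous, hence bounded near the centre; the mean value inequality on the convex ball then gives
  the Lipschitz constant.\<close>

lemma smooth_on_lipschitz_cball:
  fixes F :: "'e::model_space \<Rightarrow> 'f::real_normed_vector"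
  assumes V: "open V" "x0 \<in> V" and F: "smooth_on V F"
  obtains r L where "r > 0" "L \<ge> 0" "cball x0 r \<subseteq> V"
    "\<And>x y. x \<in> cball x0 r \<Longrightarrow> y \<in> cball x0 r \<Longrightarrow> norm (F x - F y) \<le> L * norm (x - y)"
proof -
  define g where "g = (\<lambda>x. \<Sum>b\<in>mbasis. norm b * norm (frechet_derivative F (at x) b))"
  have "continuous_on V g"
    unfolding g_def by (intro continuous_intros smooth_on_continuous[OF smooth_on_frechet[OF F]])
  then have "isCont g x0" using V continuous_on_eq_continuous_at by blast
  then obtain d where d: "d > 0" "\<And>x. dist x x0 < d \<Longrightarrow> dist (g x) (g x0) < 1"
    unfolding continuous_at_eps_delta by (metis zero_less_one)
  obtain e where e: "e > 0" "cball x0 e \<subseteq> V" using V open_contains_cball by blast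
  \<comment> \<open>\<open>d/2\<close> keeps the closed ball inside the open ball where
    \<open>g\<close> is within 1 of its central value.\<close>
  define r where "r = min (d/2) e"
  have r: "r > 0" "cball x0 r \<subseteq> V" using d e by (auto simp: r_def)
  have gb: "g x \<le> \<bar>g x0\<bar> + 1" if "x \<in> cball x0 r" for x
    using that d(2)[of x] d(1) by (auto simp: r_def dist_commute dist_real_def)
  have on: "onorm (frechet_derivative F (at x)) \<le> \<bar>g x0\<bar> + 1" if "x \<in> cball x0 r" for x
  proof (rule order_trans[OF onorm_bound gb[OF that]])
    show "0 \<le> g x" by (simp add: g_def sum_nonneg)
    fix v
    have lin: "linear (frechet_derivative F (at x))"
      using that r(2) by (intro frechet_linear smooth_on_differentiable[OF F]) auto
    have "norm (frechet_derivative F (at x) v) \<le> (\<Sum>b\<in>mbasis. norm ((v \<bullet> b) *\<^sub>R frechet_derivative F (at x) b))"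
      by (subst linear_mbasis[OF lin, of v]) (rule norm_sum)
    also have "\<dots> \<le> (\<Sum>b\<in>mbasis. (norm b * norm (frechet_derivative F (at x) b)) * norm v)"
    proof (rule sum_mono)
      fix b :: 'e
      have "\<bar>v \<bullet> b\<bar> * norm (frechet_derivative F (at x) b) \<le> (norm v * norm b) * norm (frechet_derivative F (at x) b)"
        by (intro mult_right_mono Cauchy_Schwarz_ineq2) auto
      then show "norm ((v \<bullet> b) *\<^sub>R frechet_derivative F (at x) b) \<le> (norm b * norm (frechet_derivative F (at x) b)) * norm v"
        by (simp add: mult_ac)
    qed
    also have "\<dots> = g x * norm v" by (simp add: g_def sum_distrib_right)
    finally show "norm (frechet_derivative F (at x) v) \<le> g x * norm v" .
  qed
  have "norm (F x - F y) \<le> (\<bar>g x0\<bar> + 1) * norm (x - y)" if "x \<in> cball x0 r" "y \<in> cball x0 r" for x y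
    by (rule differentiable_bound[OF convex_cball _ on that])
      (use r(2) in \<open>blast intro: has_derivative_at_withinI smooth_on_has_derivative[OF F]\<close>)
  then show thesis using that[of r "\<bar>g x0\<bar> + 1"] r by auto
qed

text \<open>The mean value inequality for curves; it yields both the invariance of the ball and the
  contraction estimate for the integral operator below.\<close>

lemma vector_derivative_bound:
  fixes f :: "real \<Rightarrow> 'a::real_normed_vector"
  assumes "convex S" "\<And>x. x \<in> S \<Longrightarrow> (f has_vector_derivative v x) (at x within S)"
    and "\<And>x. x \<in> S \<Longrightarrow> norm (v x) \<le> B" "s \<in> S" "t \<in> S"
  shows "norm (f s - f t) \<le> B * \<bar>s - t\<bar>"
proof -
  have "onorm (\<lambda>h. h *\<^sub>R v x) \<le> B" if "x \<in> S" for x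
  proof (rule onorm_le)
    show "norm (h *\<^sub>R v x) \<le> B * norm h" for h :: real
      using mult_right_mono[OF assms(3)[OF that], of "\<bar>h\<bar>"] by (simp add: mult.commute)
  qed
  then have "norm (f s - f t) \<le> B * norm (s - t)"
    using assms(2,4,5) by (intro differentiable_bound[OF assms(1), of f "\<lambda>x h. h *\<^sub>R v x"])
      (auto simp: has_vector_derivative_def)
  then show ?thesis by simp
qed

text \<open>Picard's iteration, as a contraction on curves with values in a ball around
  \<open>x0\<close> on which \<open>F\<close> is Lipschitz.\<close>

lemma ode_solution_exists:
  fixes F :: "'e::model_space \<Rightarrow> 'e"
  assumes V: "open V" "x0 \<in> V" and F: "smooth_on V F"
  shows "\<exists>d>0. \<exists>y. y 0 = x0 \<and> (\<forall>t. \<bar>t\<bar> < d \<longrightarrow> y t \<in> V \<and> (y has_vector_derivative F (y t)) (at t))"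
proof -
  obtain r L where r: "r > 0" "L \<ge> 0" "cball x0 r \<subseteq> V"
    and lip: "\<And>x y. x \<in> cball x0 r \<Longrightarrow> y \<in> cball x0 r \<Longrightarrow> norm (F x - F y) \<le> L * norm (x - y)"
    using smooth_on_lipschitz_cball[OF assms] by metis
  \<comment> \<open>A bound for \<open>F\<close> on the ball; the summand 1 makes it positive, so
    that dividing by it is possible.\<close>
  define B where "B = norm (F x0) + L * r + 1"
  have B: "B > 0" using r by (simp add: B_def add_nonneg_pos)
  have FB: "norm (F x) \<le> B" if "x \<in> cball x0 r" for x
  proof -
    have "norm (F x - F x0) \<le> L * norm (x - x0)" using lip[OF that, of x0] r by simp
    also have "\<dots> \<le> L * r" using that r by (intro mult_left_mono) (auto simp: dist_norm norm_minus_commute)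
    finally show ?thesis unfolding B_def using norm_triangle_sub[of "F x" "F x0"] by linarith
  qed
  \<comment> \<open>\<open>r / B\<close> keeps the iterates in the ball;
    \<open>1 / (2 * L + 2)\<close> makes the contraction factor at most 1/2, also for
    \<open>L = 0\<close>.\<close>
  define d where "d = min (r / B) (1 / (2 * L + 2))"
  have d: "d > 0" "B * d \<le> r" "L * d \<le> 1/2"
  proof -
    show "d > 0" using r B by (simp add: d_def)
    have "B * d \<le> B * (r / B)" using B by (intro mult_left_mono) (auto simp: d_def)
    then show "B * d \<le> r" using B by simp
    have "L * d \<le> L * (1 / (2 * L + 2))" using r by (intro mult_left_mono) (auto simp: d_def)
    also have "\<dots> \<le> 1/2" using r by (simp add: field_simps)
    finally show "L * d \<le> 1/2" .
  qed
  \<comment> \<open>Clamping the time to [-d, d] extends curves to the whole line, so that the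
    complete space of bounded continuous functions is available.\<close>
  define cl :: "real \<Rightarrow> real" where "cl t = max (-d) (min d t)" for t
  have cl: "cl t \<in> {-d..d}" "\<bar>cl t\<bar> \<le> d" for t using d by (auto simp: cl_def)
  have clc: "continuous_on UNIV cl" unfolding cl_def by (intro continuous_intros)
  \<comment> \<open>The integral from 0 to t for either sign of t, written with integrals that start
    at \<open>-d\<close>.\<close>
  define J where "J y t = integral {-d..t} (\<lambda>s. F (y s)) - integral {-d..0} (\<lambda>s. F (y s))" for y t
  define S :: "(real \<Rightarrow>\<^sub>C 'e) set" where "S = PiC UNIV (\<lambda>_. cball x0 r)"
  have inS: "y \<in> S \<longleftrightarrow> (\<forall>t. y t \<in> cball x0 r)" for y by (auto simp: S_def mem_PiC_iff)
  have FV: "continuous_on (cball x0 r) F"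
    using r smooth_on_continuous[OF F] continuous_on_subset by blast
  have Jd: "(J y has_vector_derivative F (y t)) (at t within {-d..d})"
    if "y \<in> S" "t \<in> {-d..d}" for y :: "real \<Rightarrow>\<^sub>C 'e" and t
  proof -
    have "continuous_on {-d..d} (\<lambda>s. F (y s))"
      using that inS by (intro continuous_on_compose2[OF FV]) auto
    from integral_has_vector_derivative[OF this that(2)] show ?thesis
      unfolding J_def using has_vector_derivative_diff[OF _ has_vector_derivative_const[where c="integral {-d..0} (\<lambda>s. F (y s))"]]
      by fastforce
  qed
  have J0: "J y 0 = 0" for y by (simp add: J_def)
  have Jb: "norm (J y t) \<le> r" if "y \<in> S" "t \<in> {-d..d}" for y :: "real \<Rightarrow>\<^sub>C 'e" and t
  proof -
    have "norm (J y t - J y 0) \<le> B * \<bar>t - 0\<bar>"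
      using that d inS by (intro vector_derivative_bound[OF _ Jd[OF that(1)]] FB) auto
    also have "\<dots> \<le> B * d" using that B by (intro mult_left_mono) auto
    finally show ?thesis using d J0 by simp
  qed
  define \<Phi> :: "(real \<Rightarrow>\<^sub>C 'e) \<Rightarrow> (real \<Rightarrow>\<^sub>C 'e)" where "\<Phi> y = Bcontfun (\<lambda>t. x0 + J y (cl t))" for y
  have \<Phi>: "apply_bcontfun (\<Phi> y) t = x0 + J y (cl t)" if "y \<in> S" for y t
  proof -
    have "continuous_on {-d..d} (J y)"
      using Jd[OF that] by (metis continuous_on_eq_continuous_within has_vector_derivative_continuous)
    then have "continuous_on UNIV (\<lambda>t. J y (cl t))"
      using cl(1) by (intro continuous_on_compose2[OF _ clc]) auto
    then have c: "continuous_on UNIV (\<lambda>t. x0 + J y (cl t))" by (intro continuous_intros)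
    have "norm (x0 + J y (cl t)) \<le> norm x0 + r" for t
      using Jb[OF that cl(1)[of t]] norm_triangle_ineq[of x0 "J y (cl t)"] by linarith
    from bcontfun_normI[OF c this] show ?thesis unfolding \<Phi>_def by (simp add: Bcontfun_inverse)
  qed
  have "\<exists>!y\<in>S. \<Phi> y = y"
  proof (rule Banach_fix)
    show "complete S" unfolding S_def using closed_PiC[of UNIV "\<lambda>_. cball x0 r"] by (simp add: complete_eq_closed)
    have "const_bcontfun x0 \<in> S" using r by (simp add: inS const_bcontfun.rep_eq)
    then show "S \<noteq> {}" by auto
    show "\<Phi> ` S \<subseteq> S" using \<Phi> Jb[OF _ cl(1)] by (auto simp: inS dist_norm)
    fix y z assume yz: "y \<in> S" "z \<in> S"
    have "dist (\<Phi> y t) (\<Phi> z t) \<le> 1/2 * dist y z" for t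
    proof -
      have "norm ((J y (cl t) - J z (cl t)) - (J y 0 - J z 0)) \<le> (L * dist y z) * \<bar>cl t - 0\<bar>"
      proof (rule vector_derivative_bound[of "{-d..d}" "\<lambda>t. J y t - J z t" "\<lambda>t. F (y t) - F (z t)"])
        fix s assume s: "s \<in> {-d..d}"
        show "((\<lambda>t. J y t - J z t) has_vector_derivative F (y s) - F (z s)) (at s within {-d..d})"
          by (intro has_vector_derivative_diff Jd yz s)
        have "norm (F (y s) - F (z s)) \<le> L * norm (y s - z s)" using yz inS by (intro lip) auto
        also have "\<dots> \<le> L * dist y z"
          using r dist_bounded[of y s z] by (intro mult_left_mono) (auto simp: dist_norm)
        finally show "norm (F (y s) - F (z s)) \<le> L * dist y z" .
      qed (use cl d in auto)
      also have "\<dots> \<le> (L * dist y z) * d" using cl r by (intro mult_left_mono) auto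
      also have "\<dots> = (L * d) * dist y z" by simp
      also have "\<dots> \<le> 1/2 * dist y z" using d by (intro mult_right_mono) auto
      finally show ?thesis using yz by (simp add: \<Phi> J0 dist_norm)
    qed
    then show "dist (\<Phi> y) (\<Phi> z) \<le> 1/2 * dist y z" by (rule dist_bound)
  qed auto
  then obtain y where y: "y \<in> S" "\<Phi> y = y" by blast
  have eq: "y t = x0 + J y t" if "t \<in> {-d..d}" for t
    using \<Phi>[OF y(1), of t] y(2) that by (simp add: cl_def)
  show ?thesis
  proof (intro exI[of _ d] exI[of _ "apply_bcontfun y"] conjI allI impI)
    show "d > 0" by fact
    show "y 0 = x0" using eq[of 0] J0 d by simp
    fix t :: real assume t: "\<bar>t\<bar> < d"
    show "y t \<in> V" using y inS r by blast
    \<comment> \<open>The derivative is known within the closed interval; at interior times it is a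
      two-sided derivative.\<close>
    have t': "t \<in> {-d<..<d}" "t \<in> {-d..d}" using t by auto
    have "((\<lambda>t. x0 + J y t) has_vector_derivative 0 + F (y t)) (at t within {-d..d})"
      by (intro has_vector_derivative_add has_vector_derivative_const Jd y t')
    then have "((\<lambda>t. x0 + J y t) has_vector_derivative F (y t)) (at t)"
      using at_within_interior[of t "{-d..d}"] t' by (simp add: interior_atLeastAtMost_real)
    then show "(y has_vector_derivative F (y t)) (at t)"
      by (rule has_vector_derivative_transform_within_open[of _ _ _ "{-d<..<d}"]) (use t' eq in auto)
  qed
qed

text \<open>Gronwall's argument: \<open>exp (- 2 L t) |y1 t - y2 t|\<^sup>2\<close> is nonincreasing.\<close>

lemma ode_unique_forward:
  fixes F :: "'e::real_inner \<Rightarrow> 'e"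
  assumes lip: "\<And>x y. x \<in> S \<Longrightarrow> y \<in> S \<Longrightarrow> norm (F x - F y) \<le> L * norm (x - y)"
    and y1: "\<And>t. 0 \<le> t \<Longrightarrow> t \<le> T \<Longrightarrow> y1 t \<in> S \<and> (y1 has_vector_derivative F (y1 t)) (at t)"
    and y2: "\<And>t. 0 \<le> t \<Longrightarrow> t \<le> T \<Longrightarrow> y2 t \<in> S \<and> (y2 has_vector_derivative F (y2 t)) (at t)"
    and init: "y1 0 = y2 0" and T: "0 \<le> T"
  shows "y1 T = y2 T"
proof -
  define w where "w t = y1 t - y2 t" for t
  define f where "f t = exp (- 2 * L * t) * (w t \<bullet> w t)" for t
  have "f 0 \<ge> f T"
  proof (rule DERIV_nonpos_imp_nonincreasing[OF T])
    fix t assume t: "0 \<le> t" "t \<le> T"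
    define w' where "w' = F (y1 t) - F (y2 t)"
    have dw: "(w has_derivative (\<lambda>h. h *\<^sub>R w')) (at t)"
      unfolding w_def w'_def has_vector_derivative_def[symmetric]
      using y1[OF t] y2[OF t] by (intro has_vector_derivative_diff) auto
    have "w t \<bullet> w' \<le> norm (w t) * norm w'" by (rule norm_cauchy_schwarz)
    also have "\<dots> \<le> norm (w t) * (L * norm (w t))"
      using lip y1[OF t] y2[OF t] by (intro mult_left_mono) (auto simp: w_def w'_def)
    finally have le: "w t \<bullet> w' \<le> L * (w t \<bullet> w t)" by (simp add: dot_square_norm power2_eq_square mult_ac)
    define e where "e = exp (- 2 * L * t)"
    have "((\<lambda>t. exp (- 2 * L * t)) has_derivative (\<lambda>h. e * (- 2 * L * h))) (at t)"
      unfolding e_def by (auto intro!: derivative_eq_intros)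
    from has_derivative_mult[OF this has_derivative_inner[OF dw dw]]
    have "(f has_derivative (\<lambda>h. e * (w t \<bullet> (h *\<^sub>R w') + (h *\<^sub>R w') \<bullet> w t) + (e * (- 2 * L * h)) * (w t \<bullet> w t))) (at t)"
      unfolding f_def[abs_def] e_def .
    moreover have "(\<lambda>h. e * (w t \<bullet> (h *\<^sub>R w') + (h *\<^sub>R w') \<bullet> w t) + (e * (- 2 * L * h)) * (w t \<bullet> w t))
        = (*) (2 * e * (w t \<bullet> w' - L * (w t \<bullet> w t)))"
      by (rule ext) (simp add: inner_commute algebra_simps)
    ultimately have "DERIV f t :> 2 * e * (w t \<bullet> w' - L * (w t \<bullet> w t))"
      by (simp add: has_field_derivative_def)
    moreover have "2 * e * (w t \<bullet> w' - L * (w t \<bullet> w t)) \<le> 0"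
      using le by (intro mult_nonneg_nonpos) (auto simp: e_def)
    ultimately show "\<exists>y. DERIV f t :> y \<and> y \<le> 0" by blast
  qed
  then have "exp (- 2 * L * T) * (w T \<bullet> w T) \<le> 0" by (simp add: f_def w_def init)
  then have "w T \<bullet> w T \<le> 0" using exp_gt_zero[of "- 2 * L * T"] by (simp add: mult_le_0_iff)
  then have "w T = 0" by (metis inner_eq_zero_iff inner_ge_zero order_antisym)
  then show ?thesis by (simp add: w_def)
qed

text \<open>Negative times are reduced to \<open>ode_unique_forward\<close> by reversing time, which
  replaces \<open>F\<close> by \<open>- F\<close> with the same Lipschitz constant.\<close>

lemma ode_unique:
  fixes F :: "'e::real_inner \<Rightarrow> 'e"
  assumes lip: "\<And>x y. x \<in> S \<Longrightarrow> y \<in> S \<Longrightarrow> norm (F x - F y) \<le> L * norm (x - y)"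
    and y1: "\<And>t. \<bar>t\<bar> < d \<Longrightarrow> y1 t \<in> S \<and> (y1 has_vector_derivative F (y1 t)) (at t)"
    and y2: "\<And>t. \<bar>t\<bar> < d \<Longrightarrow> y2 t \<in> S \<and> (y2 has_vector_derivative F (y2 t)) (at t)"
    and init: "y1 0 = y2 0" and t: "\<bar>t\<bar> < d"
  shows "y1 t = y2 t"
proof (cases "t \<ge> 0")
  case True
  show ?thesis
    by (rule ode_unique_forward[where S=S and F=F and L=L]) (use assms True in auto)
next
  case False
  have rev: "((\<lambda>t. y (- t)) has_vector_derivative - F (y (- s))) (at s)"
    if "(y has_vector_derivative F (y (- s))) (at (- s))" for y s
  proof -
    have "((\<lambda>t. - t) has_vector_derivative -1) (at s)"
      by (auto intro!: derivative_eq_intros)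
    from vector_diff_chain_at[OF this that] show ?thesis by (simp add: o_def)
  qed
  have "(\<lambda>t. y1 (- t)) (- t) = (\<lambda>t. y2 (- t)) (- t)"
    by (rule ode_unique_forward[where S=S and F="\<lambda>x. - F x" and L=L and T="- t"])
      (use assms False rev in \<open>auto simp: norm_minus_commute\<close>)
  then show ?thesis by simp
qed

text \<open>Bootstrapping: if \<open>y\<close> is of class C^k, then so is its derivative
  \<open>F (y t)\<close>, which raises the order of \<open>y\<close> by one.\<close>

lemma ode_solution_smooth:
  fixes F :: "'e::model_space \<Rightarrow> 'e"
  assumes V: "open V" and F: "smooth_on V F" and I: "open I" "y ` I \<subseteq> V"
    and y: "\<And>t. t \<in> I \<Longrightarrow> (y has_vector_derivative F (y t)) (at t)"
  shows "smooth_on I y"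
  unfolding smooth_on_def
proof
  fix k show "Ck_on k I y"
  proof (induction k)
    case 0
    show ?case using y
      by (auto intro!: continuous_at_imp_continuous_on has_vector_derivative_continuous)
  next
    case (Suc k)
    have eq: "v *\<^sub>R F (y t) = frechet_derivative y (at t) v" if "t \<in> I" for t v
      using frechet_derivative_eq[OF y[OF that, unfolded has_vector_derivative_def]] by simp
    have "Ck_on k I (\<lambda>t. F (y t))"
      using F by (intro Ck_on_compose[OF I(1) V I(2) Suc]) (simp add: smooth_on_def)
    then have "Ck_on k I (\<lambda>t. frechet_derivative y (at t) v)" for v
      by (intro Ck_on_cong[OF I(1) eq] Ck_on_bilinear[OF bounded_bilinear_scaleR I(1) Ck_on_const]) auto
    then show ?case using y by (auto simp: has_vector_derivative_def differentiable_def)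
  qed
qed


section \<open>Local calculus on manifolds\<close>

text \<open>Charts are pairs but are handled as single variables with \<open>fst\<close> and
  \<open>snd\<close>; these rules would split every quantifier over charts.\<close>

declare split_paired_All [simp del] split_paired_Ex [simp del]

abbreviation cinv :: "('a, 'e) chart \<Rightarrow> 'e \<Rightarrow> 'a" where
  "cinv c \<equiv> inv_into (fst c) (snd c)"

abbreviation cran :: "('a, 'e) chart \<Rightarrow> 'e set" where
  "cran c \<equiv> snd c ` fst c"

abbreviation chart_nhd :: "('a, 'e::topological_space) chart \<Rightarrow> 'a \<Rightarrow> 'e set \<Rightarrow> bool" where
  "chart_nhd c p V \<equiv> open V \<and> snd c p \<in> V \<and> V \<subseteq> cran c"

definition proper_charts :: "('a, 'e::model_space) atlas \<Rightarrow> bool" where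
  "proper_charts A \<longleftrightarrow> (\<forall>c\<in>A. inj_on (snd c) (fst c) \<and> open (cran c))"

text \<open>A pointwise form of \<open>smooth_map\<close>. The coordinate expressions are smooth on
  a whole neighbourhood of the point, and \<open>f (cinv c x) \<in> fst d\<close> records
  continuity. Maps that are meaningful over an open set only, such as trivializations and sections,
  can so be treated without restricting atlases.\<close>

definition smooth_at ::
    "('a, 'e::model_space) atlas \<Rightarrow> ('b, 'f::model_space) atlas \<Rightarrow> ('a \<Rightarrow> 'b) \<Rightarrow> 'a \<Rightarrow> bool" where
  "smooth_at A B f p \<longleftrightarrow> p \<in> pts A \<and> f p \<in> pts B \<and>
     (\<forall>c\<in>charts_at A p. \<forall>d\<in>charts_at B (f p). \<exists>V. chart_nhd c p V \<and>
        (\<forall>x\<in>V. f (cinv c x) \<in> fst d) \<and> smooth_on V (\<lambda>x. snd d (f (cinv c x))))"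

text \<open>Smoothness of the identity says that chart overlaps are open and transition maps smooth,
  so changes of charts become compositions with the identity.\<close>

definition smooth_atlas :: "('a, 'e::model_space) atlas \<Rightarrow> bool" where
  "smooth_atlas A \<longleftrightarrow> proper_charts A \<and> (\<forall>p\<in>pts A. smooth_at A A (\<lambda>x. x) p)"

text \<open>Neighbourhoods are read off in the charts around the point instead of
  \<open>mtopology\<close>; \<open>W\<close> may be any set, for instance the set where two maps
  agree.\<close>

definition nhd :: "('a, 'e::model_space) atlas \<Rightarrow> 'a \<Rightarrow> 'a set \<Rightarrow> bool" where
  "nhd A p W \<longleftrightarrow> (\<forall>c\<in>charts_at A p. \<exists>V. chart_nhd c p V \<and> (\<forall>x\<in>V. cinv c x \<in> W))"

lemma charts_at_iff: "c \<in> charts_at A p \<longleftrightarrow> c \<in> A \<and> p \<in> fst c"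
  by (simp add: charts_at_def)

lemma pts_iff: "p \<in> pts A \<longleftrightarrow> (\<exists>c. c \<in> charts_at A p)"
  by (auto simp: pts_def charts_at_def)

lemma charts_at_pts: "c \<in> charts_at A p \<Longrightarrow> p \<in> pts A"
  by (auto simp: pts_iff)

lemma some_chart: "p \<in> pts A \<Longrightarrow> (SOME c. c \<in> charts_at A p) \<in> charts_at A p"
  unfolding pts_iff by (rule someI_ex)

lemma cinv_snd [simp]: "proper_charts A \<Longrightarrow> c \<in> A \<Longrightarrow> p \<in> fst c \<Longrightarrow> cinv c (snd c p) = p"
  by (simp add: proper_charts_def)

lemma cinv_chart: "proper_charts A \<Longrightarrow> c \<in> charts_at A p \<Longrightarrow> cinv c (snd c p) = p"
  by (simp add: charts_at_iff)

lemma snd_cinv [simp]: "x \<in> cran c \<Longrightarrow> snd c (cinv c x) = x"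
  by (simp add: f_inv_into_f)

lemma cinv_mem: "x \<in> cran c \<Longrightarrow> cinv c x \<in> fst c"
  by (simp add: inv_into_into)

lemma open_cran: "proper_charts A \<Longrightarrow> c \<in> charts_at A p \<Longrightarrow> open (cran c)"
  by (simp add: proper_charts_def charts_at_iff)

lemma chart_cinv: "c \<in> A \<Longrightarrow> x \<in> cran c \<Longrightarrow> c \<in> charts_at A (cinv c x)"
  by (simp add: charts_at_iff cinv_mem)

lemma smooth_atlas_proper: "smooth_atlas A \<Longrightarrow> proper_charts A"
  by (simp add: smooth_atlas_def)

lemma smooth_at_ident: "smooth_atlas A \<Longrightarrow> p \<in> pts A \<Longrightarrow> smooth_at A A (\<lambda>x. x) p"
  by (simp add: smooth_atlas_def)

lemma smooth_atD:
  assumes "smooth_at A B f p" "c \<in> charts_at A p" "d \<in> charts_at B (f p)"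
  obtains V where "open V" "snd c p \<in> V" "V \<subseteq> cran c" "\<And>x. x \<in> V \<Longrightarrow> f (cinv c x) \<in> fst d"
    "smooth_on V (\<lambda>x. snd d (f (cinv c x)))"
  using assms unfolding smooth_at_def by metis

lemma smooth_at_pts: "smooth_at A B f p \<Longrightarrow> p \<in> pts A" "smooth_at A B f p \<Longrightarrow> f p \<in> pts B"
  by (auto simp: smooth_at_def)

lemma smooth_map_smooth_at:
  assumes "proper_charts A" "smooth_map A B f" "p \<in> pts A"
  shows "smooth_at A B f p"
  unfolding smooth_at_def
proof (intro conjI ballI)
  show "p \<in> pts A" "f p \<in> pts B" using assms by (auto simp: smooth_map_def)
  fix c d assume c: "c \<in> charts_at A p" and d: "d \<in> charts_at B (f p)"
  let ?V = "snd c ` (fst c \<inter> f -` fst d)"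
  have inj: "cinv c (snd c q) = q" if "q \<in> fst c" for q
    using that c assms(1) by (auto simp: charts_at_iff)
  have "open ?V \<and> smooth_on ?V (snd d \<circ> f \<circ> cinv c)"
    using assms(2) c d unfolding smooth_map_def charts_at_iff by (metis (mono_tags, lifting) case_prodD prod.collapse)
  moreover have "snd c p \<in> ?V" using c d by (auto simp: charts_at_iff)
  moreover have "\<forall>x\<in>?V. f (cinv c x) \<in> fst d" using inj by auto
  ultimately show "\<exists>V. chart_nhd c p V \<and>
      (\<forall>x\<in>V. f (cinv c x) \<in> fst d) \<and> smooth_on V (\<lambda>x. snd d (f (cinv c x)))"
    by (intro exI[of _ ?V]) (auto simp: o_def)
qed

lemma smooth_manifold_atlas:
  assumes "smooth_manifold A"
  shows "smooth_atlas A"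
proof -
  have p: "proper_charts A" using assms by (force simp: smooth_manifold_def proper_charts_def)
  have "smooth_map A A (\<lambda>x. x)"
    unfolding smooth_map_def
  proof (intro conjI ballI, simp, clarify)
    fix D \<phi> E \<psi> assume "(D, \<phi>) \<in> A" "(E, \<psi>) \<in> A"
    then have "open (\<phi> ` (D \<inter> E)) \<and> smooth_on (\<phi> ` (D \<inter> E)) (\<psi> \<circ> inv_into D \<phi>)"
      using assms unfolding smooth_manifold_def by fast
    then show "open (\<phi> ` (D \<inter> (\<lambda>x. x) -` E)) \<and>
        smooth_on (\<phi> ` (D \<inter> (\<lambda>x. x) -` E)) (\<psi> \<circ> (\<lambda>x. x) \<circ> inv_into D \<phi>)"
      by (simp add: o_def)
  qed
  then show ?thesis using p smooth_map_smooth_at by (auto simp: smooth_atlas_def)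
qed

lemma nhd_mono: "nhd A p W \<Longrightarrow> W \<subseteq> W' \<Longrightarrow> nhd A p W'"
  unfolding nhd_def by (meson subsetD)

lemma nhd_Int:
  assumes "nhd A p W" "nhd A p W'"
  shows "nhd A p (W \<inter> W')"
  unfolding nhd_def
proof
  fix c assume c: "c \<in> charts_at A p"
  obtain V V' where "open V" "snd c p \<in> V" "V \<subseteq> cran c" "\<forall>x\<in>V. cinv c x \<in> W"
    "open V'" "snd c p \<in> V'" "V' \<subseteq> cran c" "\<forall>x\<in>V'. cinv c x \<in> W'"
    using assms c unfolding nhd_def by metis
  then show "\<exists>V. chart_nhd c p V \<and> (\<forall>x\<in>V. cinv c x \<in> W \<inter> W')"
    by (intro exI[of _ "V \<inter> V'"]) auto
qed

lemma mopen_nhd: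
  assumes "proper_charts A" "mopen A U" "p \<in> U"
  shows "nhd A p U"
  unfolding nhd_def
proof
  fix c assume c: "c \<in> charts_at A p"
  then have "open (snd c ` (fst c \<inter> U))" using assms by (auto simp: mopen_def charts_at_iff split: prod.splits)
  moreover have "cinv c (snd c q) = q" if "q \<in> fst c" for q
    using that c assms(1) by (auto simp: charts_at_iff)
  ultimately show "\<exists>V. chart_nhd c p V \<and> (\<forall>x\<in>V. cinv c x \<in> U)"
    using c assms by (intro exI[of _ "snd c ` (fst c \<inter> U)"]) (auto simp: charts_at_iff)
qed

lemma nhd_vimage:
  assumes "proper_charts A" "proper_charts B" "smooth_at A B f p" "nhd B (f p) W"
  shows "nhd A p (f -` W)"
  unfolding nhd_def
proof
  fix c assume c: "c \<in> charts_at A p"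
  obtain d where d: "d \<in> charts_at B (f p)" using smooth_at_pts[OF assms(3)] by (auto simp: pts_iff)
  obtain V where V: "open V" "snd c p \<in> V" "V \<subseteq> cran c" "\<And>x. x \<in> V \<Longrightarrow> f (cinv c x) \<in> fst d"
    "smooth_on V (\<lambda>x. snd d (f (cinv c x)))" by (rule smooth_atD[OF assms(3) c d]) (rule that; blast)
  obtain V' where V': "open V'" "snd d (f p) \<in> V'" "\<forall>y\<in>V'. cinv d y \<in> W"
    using assms(4) d unfolding nhd_def by metis
  let ?T = "V \<inter> (\<lambda>x. snd d (f (cinv c x))) -` V'"
  have "open ?T"
    by (rule continuous_open_preimage[OF smooth_on_continuous[OF V(5)] V(1) V'(1)])
  moreover have "snd c p \<in> ?T" using V(2) V'(2) cinv_chart[OF assms(1) c] by simp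
  moreover have "f (cinv c x) \<in> W" if "x \<in> ?T" for x
  proof -
    have "cinv d (snd d (f (cinv c x))) = f (cinv c x)"
      using that V(4) assms(2) d by (auto simp: charts_at_iff)
    then show ?thesis using that V'(3) by force
  qed
  ultimately show "\<exists>V. chart_nhd c p V \<and> (\<forall>x\<in>V. cinv c x \<in> f -` W)"
    using V(3) by (intro exI[of _ ?T]) auto
qed

lemma smooth_at_cong:
  assumes "proper_charts A" "nhd A p {x. f x = g x}" "smooth_at A B f p"
  shows "smooth_at A B g p"
proof -
  have fg: "f p = g p"
  proof -
    obtain c where c: "c \<in> charts_at A p" using smooth_at_pts[OF assms(3)] by (auto simp: pts_iff)
    then show ?thesis using assms(2) cinv_chart[OF assms(1) c] unfolding nhd_def by force
  qed
  show ?thesis unfolding smooth_at_def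
  proof (intro conjI ballI)
    show "p \<in> pts A" "g p \<in> pts B" using smooth_at_pts[OF assms(3)] fg by auto
    fix c d assume c: "c \<in> charts_at A p" and d: "d \<in> charts_at B (g p)"
    obtain V where V: "open V" "snd c p \<in> V" "V \<subseteq> cran c" "\<And>x. x \<in> V \<Longrightarrow> f (cinv c x) \<in> fst d"
      "smooth_on V (\<lambda>x. snd d (f (cinv c x)))" by (rule smooth_atD[OF assms(3) c d[folded fg]]) (rule that; blast)
    obtain V' where V': "open V'" "snd c p \<in> V'" "\<forall>x\<in>V'. f (cinv c x) = g (cinv c x)"
      using assms(2) c unfolding nhd_def by auto
    have "smooth_on (V \<inter> V') (\<lambda>x. snd d (g (cinv c x)))"
      by (rule smooth_on_cong[OF _ _ smooth_on_subset[OF V(5)]]) (use V V' in auto)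
    moreover have "\<forall>x\<in>V \<inter> V'. g (cinv c x) \<in> fst d" using V(4) V'(3) by (metis IntD1 IntD2)
    ultimately show "\<exists>V. chart_nhd c p V \<and> (\<forall>x\<in>V. g (cinv c x) \<in> fst d) \<and>
        smooth_on V (\<lambda>x. snd d (g (cinv c x)))"
      using V(1-3) V'(1,2) by (intro exI[of _ "V \<inter> V'"]) auto
  qed
qed

lemma smooth_at_has_derivative:
  assumes "smooth_at A B f p" "c \<in> charts_at A p" "d \<in> charts_at B (f p)"
  shows "((\<lambda>x. snd d (f (cinv c x))) has_derivative
    frechet_derivative (\<lambda>x. snd d (f (cinv c x))) (at (snd c p))) (at (snd c p))"
  using smooth_atD[OF assms] smooth_on_has_derivative by metis

text \<open>The chain rule in coordinates, with an arbitrary chart \<open>d\<close> at the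
  intermediate point. Taking one of the maps to be the identity gives the independence of tangent
  maps from the chosen charts.\<close>

lemma smooth_at_compose_chart:
  assumes "proper_charts A" "proper_charts B" "smooth_at A B f p" "smooth_at B C g (f p)"
    and "c \<in> charts_at A p" "d \<in> charts_at B (f p)" "e \<in> charts_at C (g (f p))"
  shows "\<exists>V. chart_nhd c p V \<and> (\<forall>x\<in>V. g (f (cinv c x)) \<in> fst e) \<and>
      smooth_on V (\<lambda>x. snd e (g (f (cinv c x))))"
    and "((\<lambda>x. snd e (g (f (cinv c x)))) has_derivative
      (\<lambda>v. frechet_derivative (\<lambda>y. snd e (g (cinv d y))) (at (snd d (f p)))
        (frechet_derivative (\<lambda>x. snd d (f (cinv c x))) (at (snd c p)) v))) (at (snd c p))"
proof -
  obtain V where V: "open V" "snd c p \<in> V" "V \<subseteq> cran c" "\<And>x. x \<in> V \<Longrightarrow> f (cinv c x) \<in> fst d"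
    "smooth_on V (\<lambda>x. snd d (f (cinv c x)))" by (rule smooth_atD[OF assms(3,5,6)]) (rule that; blast)
  obtain W where W: "open W" "snd d (f p) \<in> W" "W \<subseteq> cran d" "\<And>x. x \<in> W \<Longrightarrow> g (cinv d x) \<in> fst e"
    "smooth_on W (\<lambda>x. snd e (g (cinv d x)))" by (rule smooth_atD[OF assms(4,6,7)]) (rule that; blast)
  let ?T = "V \<inter> (\<lambda>x. snd d (f (cinv c x))) -` W"
  have T: "open ?T" by (rule continuous_open_preimage[OF smooth_on_continuous[OF V(5)] V(1) W(1)])
  have cp: "cinv c (snd c p) = p" by (rule cinv_chart[OF assms(1,5)])
  have pT: "snd c p \<in> ?T" using V(2) W(2) cp by simp
  have inv: "cinv d (snd d (f (cinv c x))) = f (cinv c x)" if "x \<in> ?T" for x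
    using that V(4) assms(2,6) by (auto simp: charts_at_iff)
  have "smooth_on ?T (\<lambda>x. (\<lambda>y. snd e (g (cinv d y))) (snd d (f (cinv c x))))"
    by (rule smooth_on_compose[OF T W(1) _ _ W(5)]) (use smooth_on_subset[OF V(5)] in auto)
  from smooth_on_cong[OF T _ this, of "\<lambda>x. snd e (g (f (cinv c x)))"]
  have "smooth_on ?T (\<lambda>x. snd e (g (f (cinv c x))))" using inv by simp
  moreover have "g (f (cinv c x)) \<in> fst e" if "x \<in> ?T" for x
    using W(4)[of "snd d (f (cinv c x))"] inv[OF that] that by simp
  ultimately show "\<exists>V. chart_nhd c p V \<and> (\<forall>x\<in>V. g (f (cinv c x)) \<in> fst e) \<and>
      smooth_on V (\<lambda>x. snd e (g (f (cinv c x))))"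
    using T pT V(3) by (intro exI[of _ ?T]) auto
  let ?F = "\<lambda>x. snd d (f (cinv c x))" and ?G = "\<lambda>y. snd e (g (cinv d y))"
  have "(?G has_derivative frechet_derivative ?G (at (snd d (f p)))) (at (?F (snd c p)))"
    using smooth_at_has_derivative[OF assms(4,6,7)] cp by simp
  from has_derivative_compose[OF smooth_at_has_derivative[OF assms(3,5,6)] this]
  have "((\<lambda>x. ?G (?F x)) has_derivative (\<lambda>v. frechet_derivative ?G (at (snd d (f p)))
      (frechet_derivative ?F (at (snd c p)) v))) (at (snd c p))" .
  then show "((\<lambda>x. snd e (g (f (cinv c x)))) has_derivative
      (\<lambda>v. frechet_derivative ?G (at (snd d (f p))) (frechet_derivative ?F (at (snd c p)) v))) (at (snd c p))"
    by (rule has_derivative_transform_within_open[OF _ T pT]) (use inv in simp)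
qed

lemma smooth_at_compose:
  assumes "proper_charts A" "proper_charts B" "smooth_at B C g (f p)" "smooth_at A B f p"
  shows "smooth_at A C (\<lambda>x. g (f x)) p"
  unfolding smooth_at_def
proof (intro conjI ballI)
  show "p \<in> pts A" "g (f p) \<in> pts C" using smooth_at_pts(1)[OF assms(4)] smooth_at_pts(2)[OF assms(3)] by auto
  obtain d where "d \<in> charts_at B (f p)" using smooth_at_pts[OF assms(4)] by (auto simp: pts_iff)
  then show "\<exists>V. chart_nhd c p V \<and> (\<forall>x\<in>V. g (f (cinv c x)) \<in> fst e) \<and>
      smooth_on V (\<lambda>x. snd e (g (f (cinv c x))))"
    if "c \<in> charts_at A p" "e \<in> charts_at C (g (f p))" for c e
    using smooth_at_compose_chart(1)[OF assms(1,2,4,3)] that by blast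
qed

lemma smooth_at_const:
  assumes "proper_charts A" "p \<in> pts A" "b \<in> pts B"
  shows "smooth_at A B (\<lambda>_. b) p"
  unfolding smooth_at_def using assms open_cran[OF assms(1)]
  by (auto simp: charts_at_iff smooth_on_const intro!: exI[of _ "cran _"])


subsection \<open>Tangent maps\<close>

lemma tangent_spaceD:
  "v \<in> tangent_space A p \<Longrightarrow> c \<in> charts_at A p \<Longrightarrow> c' \<in> charts_at A p \<Longrightarrow>
    v c' = frechet_derivative (\<lambda>x. snd c' (cinv c x)) (at (snd c p)) (v c)"
  unfolding tangent_space_def mem_Collect_eq o_def by blast

lemma tangent_space_outside: "v \<in> tangent_space A p \<Longrightarrow> c \<notin> charts_at A p \<Longrightarrow> v c = 0"
  by (simp add: tangent_space_def)

lemma tangent_map_outside: "d \<notin> charts_at B (f p) \<Longrightarrow> tangent_map A B f p v d = 0"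
  by (simp add: tangent_map_def Let_def)

text \<open>\<open>tangent_map\<close> picks some chart at the point. Passing to \<open>c\<close> is
  the chain rule for the identity followed by \<open>f\<close>, because the coordinates of a tangent
  vector transform by the derivative of the transition map.\<close>

lemma tangent_map_chart:
  assumes "smooth_atlas A" "smooth_at A B f p" "v \<in> tangent_space A p"
    and c: "c \<in> charts_at A p" and d: "d \<in> charts_at B (f p)"
  shows "tangent_map A B f p v d = frechet_derivative (\<lambda>x. snd d (f (cinv c x))) (at (snd c p)) (v c)"
proof -
  let ?c = "SOME c. c \<in> charts_at A p"
  have p: "p \<in> pts A" by (rule smooth_at_pts(1)[OF assms(2)])
  have c0: "?c \<in> charts_at A p" by (rule some_chart[OF p])
  have "tangent_map A B f p v d = frechet_derivative (\<lambda>x. snd d (f (cinv ?c x))) (at (snd ?c p)) (v ?c)"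
    using d by (simp add: tangent_map_def Let_def o_def)
  also have "\<dots> = frechet_derivative (\<lambda>x. snd d (f (cinv c x))) (at (snd c p))
      (frechet_derivative (\<lambda>x. snd c (cinv ?c x)) (at (snd ?c p)) (v ?c))"
    using smooth_at_compose_chart(2)[where f="\<lambda>x. x", OF _ _ smooth_at_ident[OF assms(1) p] assms(2) c0 c d]
      smooth_atlas_proper[OF assms(1)] by (simp add: frechet_derivative_eq)
  also have "frechet_derivative (\<lambda>x. snd c (cinv ?c x)) (at (snd ?c p)) (v ?c) = v c"
    by (rule tangent_spaceD[OF assms(3) c0 c, symmetric])
  finally show ?thesis .
qed

lemma tangent_map_in:
  assumes "smooth_atlas A" "smooth_atlas B" "smooth_at A B f p" "v \<in> tangent_space A p"
  shows "tangent_map A B f p v \<in> tangent_space B (f p)"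
  unfolding tangent_space_def
proof (intro CollectI conjI ballI allI impI)
  fix d d' assume d: "d \<in> charts_at B (f p)" "d' \<in> charts_at B (f p)"
  obtain c where c: "c \<in> charts_at A p" using smooth_at_pts[OF assms(3)] by (auto simp: pts_iff)
  have fp: "f p \<in> pts B" by (rule smooth_at_pts(2)[OF assms(3)])
  show "tangent_map A B f p v d' = frechet_derivative (snd d' \<circ> cinv d) (at (snd d (f p))) (tangent_map A B f p v d)"
    using smooth_at_compose_chart(2)[OF _ _ assms(3) smooth_at_ident[OF assms(2) fp] c d]
      smooth_atlas_proper[OF assms(1)] smooth_atlas_proper[OF assms(2)]
    by (simp add: frechet_derivative_eq o_def tangent_map_chart[OF assms(1,3,4) c] d)
qed (rule tangent_map_outside)

lemma tangent_map_compose: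
  assumes "smooth_atlas A" "smooth_atlas B" "smooth_at B C g (f p)" "smooth_at A B f p" "v \<in> tangent_space A p"
  shows "tangent_map A C (\<lambda>x. g (f x)) p v = tangent_map B C g (f p) (tangent_map A B f p v)"
proof
  fix e
  note pc = smooth_atlas_proper[OF assms(1)] smooth_atlas_proper[OF assms(2)]
  obtain c where c: "c \<in> charts_at A p" using smooth_at_pts[OF assms(4)] by (auto simp: pts_iff)
  obtain d where d: "d \<in> charts_at B (f p)" using smooth_at_pts[OF assms(4)] by (auto simp: pts_iff)
  show "tangent_map A C (\<lambda>x. g (f x)) p v e = tangent_map B C g (f p) (tangent_map A B f p v) e"
  proof (cases "e \<in> charts_at C (g (f p))")
    case True
    note gf = smooth_at_compose[OF pc assms(3,4)]
    show ?thesis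
      using smooth_at_compose_chart(2)[OF pc assms(4,3) c d True]
      by (simp add: frechet_derivative_eq tangent_map_chart[OF assms(1) gf assms(5) c] True
          tangent_map_chart[OF assms(2,3) tangent_map_in[OF assms(1,2,4,5)] d True]
          tangent_map_chart[OF assms(1,4,5) c d])
  qed (simp add: tangent_map_outside)
qed

text \<open>Only the coordinates in the chart picked by \<open>tangent_map\<close> enter, so
  \<open>v\<close> and \<open>w\<close> may be arbitrary families.\<close>

lemma tangent_map_lin:
  assumes "smooth_at A B f p"
  shows "tangent_map A B f p (\<lambda>c. a *\<^sub>R v c + b *\<^sub>R w c) =
    (\<lambda>d. a *\<^sub>R tangent_map A B f p v d + b *\<^sub>R tangent_map A B f p w d)"
proof
  fix d
  let ?c = "SOME c. c \<in> charts_at A p"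
  have c: "?c \<in> charts_at A p" by (rule some_chart[OF smooth_at_pts(1)[OF assms]])
  show "tangent_map A B f p (\<lambda>c. a *\<^sub>R v c + b *\<^sub>R w c) d =
    a *\<^sub>R tangent_map A B f p v d + b *\<^sub>R tangent_map A B f p w d"
  proof (cases "d \<in> charts_at B (f p)")
    case True
    have "linear (frechet_derivative (\<lambda>x. snd d (f (cinv ?c x))) (at (snd ?c p)))"
      using has_derivative_linear smooth_at_has_derivative[OF assms c True] by blast
    then show ?thesis using True
      by (simp add: tangent_map_def Let_def o_def linear_add linear_scale)
  qed (simp add: tangent_map_outside)
qed

lemma tangent_space_lin:
  assumes "smooth_atlas A" "p \<in> pts A" "v \<in> tangent_space A p" "w \<in> tangent_space A p"
  shows "(\<lambda>c. a *\<^sub>R v c + b *\<^sub>R w c) \<in> tangent_space A p"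
  unfolding tangent_space_def
proof (intro CollectI conjI ballI allI impI)
  fix c c' assume c: "c \<in> charts_at A p" "c' \<in> charts_at A p"
  have "linear (frechet_derivative (\<lambda>x. snd c' (cinv c x)) (at (snd c p)))"
    using has_derivative_linear smooth_at_has_derivative[OF smooth_at_ident[OF assms(1,2)] c] by blast
  then show "a *\<^sub>R v c' + b *\<^sub>R w c' =
      frechet_derivative (snd c' \<circ> cinv c) (at (snd c p)) (a *\<^sub>R v c + b *\<^sub>R w c)"
    using tangent_spaceD[OF assms(3) c] tangent_spaceD[OF assms(4) c]
    by (simp add: o_def linear_add linear_scale)
qed (simp add: tangent_space_outside[OF assms(3)] tangent_space_outside[OF assms(4)])

lemma tangent_space_scale:
  assumes "smooth_atlas A" "p \<in> pts A" "v \<in> tangent_space A p"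
  shows "(\<lambda>c. a *\<^sub>R v c) \<in> tangent_space A p"
  using tangent_space_lin[OF assms assms(3), of a 0] by simp

lemma tangent_space_zero:
  assumes "smooth_atlas A" "p \<in> pts A"
  shows "(\<lambda>_. 0) \<in> tangent_space A p"
  unfolding tangent_space_def
proof (intro CollectI conjI ballI allI impI)
  fix c c' assume c: "c \<in> charts_at A p" "c' \<in> charts_at A p"
  have "linear (frechet_derivative (\<lambda>x. snd c' (cinv c x)) (at (snd c p)))"
    using has_derivative_linear smooth_at_has_derivative[OF smooth_at_ident[OF assms] c] by blast
  then show "0 = frechet_derivative (snd c' \<circ> cinv c) (at (snd c p)) 0"
    by (simp add: o_def linear_0)
qed simp

lemma tangent_map_zero: "smooth_at A B f p \<Longrightarrow> tangent_map A B f p (\<lambda>_. 0) = (\<lambda>_. 0)"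
  using tangent_map_lin[of A B f p 0 "\<lambda>_. 0" 0 "\<lambda>_. 0"] by simp

lemma tangent_map_ident:
  assumes "smooth_atlas A" "p \<in> pts A" "v \<in> tangent_space A p"
  shows "tangent_map A A (\<lambda>x. x) p v = v"
proof
  fix d
  obtain c where c: "c \<in> charts_at A p" using assms(2) by (auto simp: pts_iff)
  show "tangent_map A A (\<lambda>x. x) p v d = v d"
  proof (cases "d \<in> charts_at A p")
    case True
    then show ?thesis
      using tangent_map_chart[OF assms(1) smooth_at_ident[OF assms(1,2)] assms(3) c True]
        tangent_spaceD[OF assms(3) c True] by simp
  next
    case False
    then show ?thesis using tangent_space_outside[OF assms(3)] by (simp add: tangent_map_outside)
  qed
qed

lemma tangent_map_const: "tangent_map A B (\<lambda>_. b) p v = (\<lambda>_. 0)"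
proof -
  have "frechet_derivative (\<lambda>_::'x::real_normed_vector. k::'y::real_normed_vector) (at x) = (\<lambda>_. 0)" for k x
    by (rule frechet_derivative_eq) (rule has_derivative_const)
  then show ?thesis by (auto simp: tangent_map_def Let_def o_def)
qed

lemma nhd_memD:
  assumes "proper_charts A" "p \<in> pts A" "nhd A p W"
  shows "p \<in> W"
proof -
  obtain c where c: "c \<in> charts_at A p" using assms(2) by (auto simp: pts_iff)
  then show ?thesis using assms(3) cinv_chart[OF assms(1) c] unfolding nhd_def by force
qed

text \<open>Tangent maps see germs only. Identities between partially meaningful maps hold on
  neighbourhoods and are differentiated by this rule.\<close>

lemma tangent_map_cong:
  fixes A :: "('a, 'e::model_space) atlas" and B :: "('b, 'f::model_space) atlas"
  assumes "proper_charts A" "p \<in> pts A" "nhd A p {x. f x = g x}"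
  shows "tangent_map A B f p = tangent_map A B g p"
proof (intro ext)
  fix v and d :: "('b, 'f) chart"
  let ?c = "SOME c. c \<in> charts_at A p"
  have c: "?c \<in> charts_at A p" by (rule some_chart[OF assms(2)])
  have fg: "f p = g p" using nhd_memD[OF assms] by simp
  obtain V where V: "open V" "snd ?c p \<in> V" "\<forall>x\<in>V. f (cinv ?c x) = g (cinv ?c x)"
    using bspec[OF assms(3)[unfolded nhd_def] c] by auto
  have "frechet_derivative (snd d \<circ> f \<circ> cinv ?c) (at (snd ?c p)) =
      frechet_derivative (snd d \<circ> g \<circ> cinv ?c) (at (snd ?c p))"
    by (rule frechet_derivative_cong_open[OF V(1,2)]) (use V in auto)
  then show "tangent_map A B f p v d = tangent_map A B g p v d"
    by (simp add: tangent_map_def Let_def fg)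
qed

lemma tangent_of_chart:
  assumes "smooth_atlas A" "c \<in> charts_at A p"
  shows "tangent_of A c p w c = w"
proof -
  have "((snd c \<circ> cinv c) has_derivative (\<lambda>x. x)) (at (snd c p)) \<longleftrightarrow>
      ((\<lambda>x. x) has_derivative (\<lambda>x. x)) (at (snd c p))"
    using open_cran[OF smooth_atlas_proper[OF assms(1)] assms(2)] assms(2)
    by (intro has_derivative_cong_open[of "cran c"]) (auto simp: charts_at_iff)
  then show ?thesis using assms(2) by (simp add: tangent_of_def frechet_derivative_eq)
qed

lemma tangent_of_in:
  assumes "smooth_atlas A" "c \<in> charts_at A p"
  shows "tangent_of A c p w \<in> tangent_space A p"
  unfolding tangent_space_def
proof (intro CollectI conjI ballI allI impI)
  fix d d' assume d: "d \<in> charts_at A p" "d' \<in> charts_at A p"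
  have i: "smooth_at A A (\<lambda>x. x) p" by (rule smooth_at_ident[OF assms(1) charts_at_pts[OF assms(2)]])
  show "tangent_of A c p w d' = frechet_derivative (snd d' \<circ> cinv d) (at (snd d p)) (tangent_of A c p w d)"
    using smooth_at_compose_chart(2)[OF _ _ i i assms(2) d] smooth_atlas_proper[OF assms(1)]
    by (simp add: tangent_of_def d o_def frechet_derivative_eq)
qed (simp add: tangent_of_def)

lemma tangent_of_eq:
  assumes "v \<in> tangent_space A p" "c \<in> charts_at A p"
  shows "tangent_of A c p (v c) = v"
  using tangent_spaceD[OF assms] tangent_space_outside[OF assms(1)]
  by (auto simp: tangent_of_def o_def)

lemma tangent_eqI:
  assumes "v \<in> tangent_space A p" "w \<in> tangent_space A p" "c \<in> charts_at A p" "v c = w c"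
  shows "v = w"
  by (rule tangent_of_eq[OF assms(1,3), symmetric, unfolded assms(4), THEN trans, OF tangent_of_eq[OF assms(2,3)]])


subsection \<open>Product atlases and restrictions\<close>

abbreviation pchart :: "('a, 'e) chart \<Rightarrow> ('b, 'f) chart \<Rightarrow> ('a \<times> 'b, 'e \<times> 'f) chart" where
  "pchart c d \<equiv> (fst c \<times> fst d, map_prod (snd c) (snd d))"

lemma prod_atlas_eq: "prod_atlas A B = {pchart c d | c d. c \<in> A \<and> d \<in> B}"
  unfolding prod_atlas_def by force

lemma charts_at_prod: "charts_at (prod_atlas A B) (p, q) = {pchart c d | c d. c \<in> charts_at A p \<and> d \<in> charts_at B q}"
  unfolding prod_atlas_eq charts_at_def by force

lemma pts_prod [simp]: "pts (prod_atlas A B) = pts A \<times> pts B"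
proof -
  have "(p, q) \<in> pts (prod_atlas A B) \<longleftrightarrow> p \<in> pts A \<and> q \<in> pts B" for p q
    unfolding pts_iff charts_at_prod by blast
  then show ?thesis by auto
qed

lemma cran_pchart: "cran (pchart c d) = cran c \<times> cran d"
  by auto

lemma cinv_pchart:
  assumes "inj_on (snd c) (fst c)" "inj_on (snd d) (fst d)" "x \<in> cran c" "y \<in> cran d"
  shows "cinv (pchart c d) (x, y) = (cinv c x, cinv d y)"
proof -
  have inj: "inj_on (map_prod (snd c) (snd d)) (fst c \<times> fst d)"
    using assms(1,2) by (rule map_prod_inj_on)
  have "map_prod (snd c) (snd d) (cinv c x, cinv d y) = (x, y)" using assms(3,4) by simp
  then show ?thesis
    using inv_into_f_f[OF inj, of "(cinv c x, cinv d y)"] assms(3,4) by (simp add: cinv_mem)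
qed

lemma proper_charts_prod:
  assumes "proper_charts A" "proper_charts B"
  shows "proper_charts (prod_atlas A B)"
  unfolding proper_charts_def prod_atlas_eq
proof (clarsimp, intro conjI)
  fix D \<phi> E \<psi> assume c: "(D, \<phi>) \<in> A" and d: "(E, \<psi>) \<in> B"
  have "inj_on \<phi> D" "open (\<phi> ` D)" "inj_on \<psi> E" "open (\<psi> ` E)"
    using assms c d unfolding proper_charts_def by force+
  then show "inj_on (map_prod \<phi> \<psi>) (D \<times> E)" "open (map_prod \<phi> \<psi> ` (D \<times> E))"
    by (auto intro: map_prod_inj_on open_Times simp: map_prod_surj_on[OF refl refl])
qed

lemma smooth_at_Pair:
  assumes "smooth_at A B f p" "smooth_at A C g p"
  shows "smooth_at A (prod_atlas B C) (\<lambda>x. (f x, g x)) p"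
  unfolding smooth_at_def
proof (intro conjI ballI)
  show "p \<in> pts A" "(f p, g p) \<in> pts (prod_atlas B C)"
    using smooth_at_pts[OF assms(1)] smooth_at_pts[OF assms(2)] by auto
  fix c e assume c: "c \<in> charts_at A p" and "e \<in> charts_at (prod_atlas B C) (f p, g p)"
  then obtain d d' where e: "e = pchart d d'" and d: "d \<in> charts_at B (f p)" "d' \<in> charts_at C (g p)"
    by (auto simp: charts_at_prod)
  obtain V where V: "open V" "snd c p \<in> V" "V \<subseteq> cran c" "\<And>x. x \<in> V \<Longrightarrow> f (cinv c x) \<in> fst d"
    "smooth_on V (\<lambda>x. snd d (f (cinv c x)))" by (rule smooth_atD[OF assms(1) c d(1)]) (rule that; blast)
  obtain W where W: "open W" "snd c p \<in> W" "W \<subseteq> cran c" "\<And>x. x \<in> W \<Longrightarrow> g (cinv c x) \<in> fst d'"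
    "smooth_on W (\<lambda>x. snd d' (g (cinv c x)))" by (rule smooth_atD[OF assms(2) c d(2)]) (rule that; blast)
  have "smooth_on (V \<inter> W) (\<lambda>x. (snd d (f (cinv c x)), snd d' (g (cinv c x))))"
    using V W by (intro smooth_on_Pair smooth_on_subset[OF V(5)] smooth_on_subset[OF W(5)]) auto
  then show "\<exists>V. chart_nhd c p V \<and> (\<forall>x\<in>V. (f (cinv c x), g (cinv c x)) \<in> fst e) \<and>
      smooth_on V (\<lambda>x. snd e (f (cinv c x), g (cinv c x)))"
    using V W by (intro exI[of _ "V \<inter> W"]) (auto simp: e)
qed

text \<open>The target chart \<open>c'\<close> need not be the first factor of the product chart, so
  the transition maps of \<open>A\<close> come in.\<close>

lemma smooth_at_fst:
  assumes "smooth_atlas A" "proper_charts B" "x \<in> pts (prod_atlas A B)"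
  shows "smooth_at (prod_atlas A B) A fst x"
  unfolding smooth_at_def
proof (intro conjI ballI)
  obtain p q where x: "x = (p, q)" by fastforce
  show "x \<in> pts (prod_atlas A B)" "fst x \<in> pts A" using assms by auto
  fix e c' assume "e \<in> charts_at (prod_atlas A B) x" and "c' \<in> charts_at A (fst x)"
  then obtain c d where e: "e = pchart c d" and c: "c \<in> charts_at A p" "d \<in> charts_at B q" "c' \<in> charts_at A p"
    by (auto simp: charts_at_prod x)
  have p: "proper_charts A" using assms smooth_atlas_proper by blast
  obtain V where V: "open V" "snd c p \<in> V" "V \<subseteq> cran c" "\<And>x. x \<in> V \<Longrightarrow> cinv c x \<in> fst c'"
    "smooth_on V (\<lambda>x. snd c' (cinv c x))"
    using smooth_atD[OF smooth_at_ident[OF assms(1)] c(1,3)] charts_at_pts[OF c(1)] by metis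
  have inv: "cinv e y = (cinv c (fst y), cinv d (snd y))" if "y \<in> V \<times> cran d" for y
    using that V(3) cinv_pchart[of c d "fst y" "snd y"] p assms(2) c unfolding e
    by (auto simp: proper_charts_def charts_at_iff)
  have o: "open (V \<times> cran d)" using V(1) c open_cran[OF assms(2)] by (intro open_Times) auto
  have "smooth_on (V \<times> cran d) (\<lambda>y. (\<lambda>x. snd c' (cinv c x)) (fst y))"
    by (rule smooth_on_compose[OF o V(1) _ _ V(5)]) (auto intro: smooth_on_linear bounded_linear_fst)
  from smooth_on_cong[OF o _ this, of "\<lambda>y. snd c' (fst (cinv e y))"]
  have "smooth_on (V \<times> cran d) (\<lambda>y. snd c' (fst (cinv e y)))" using inv by simp
  moreover have "\<forall>y\<in>V \<times> cran d. fst (cinv e y) \<in> fst c'" using V(4) inv by simp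
  moreover have "snd e x \<in> V \<times> cran d" "V \<times> cran d \<subseteq> cran e"
    using V(2,3) c unfolding e cran_pchart x by (auto simp: charts_at_iff)
  ultimately show "\<exists>V. chart_nhd e x V \<and> (\<forall>y\<in>V. fst (cinv e y) \<in> fst c') \<and>
      smooth_on V (\<lambda>y. snd c' (fst (cinv e y)))"
    using o by (intro exI[of _ "V \<times> cran d"] conjI)
qed

lemma smooth_at_snd:
  assumes "proper_charts A" "smooth_atlas B" "x \<in> pts (prod_atlas A B)"
  shows "smooth_at (prod_atlas A B) B snd x"
  unfolding smooth_at_def
proof (intro conjI ballI)
  obtain p q where x: "x = (p, q)" by fastforce
  show "x \<in> pts (prod_atlas A B)" "snd x \<in> pts B" using assms by auto
  fix e c' assume "e \<in> charts_at (prod_atlas A B) x" and "c' \<in> charts_at B (snd x)"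
  then obtain c d where e: "e = pchart c d" and c: "c \<in> charts_at A p" "d \<in> charts_at B q" "c' \<in> charts_at B q"
    by (auto simp: charts_at_prod x)
  have p: "proper_charts B" using assms smooth_atlas_proper by blast
  obtain V where V: "open V" "snd d q \<in> V" "V \<subseteq> cran d" "\<And>x. x \<in> V \<Longrightarrow> cinv d x \<in> fst c'"
    "smooth_on V (\<lambda>x. snd c' (cinv d x))"
    using smooth_atD[OF smooth_at_ident[OF assms(2)] c(2,3)] charts_at_pts[OF c(2)] by metis
  have inv: "cinv e y = (cinv c (fst y), cinv d (snd y))" if "y \<in> cran c \<times> V" for y
    using that V(3) cinv_pchart[of c d "fst y" "snd y"] p assms(1) c unfolding e
    by (auto simp: proper_charts_def charts_at_iff)
  have o: "open (cran c \<times> V)" using V(1) c open_cran[OF assms(1)] by (intro open_Times) auto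
  have "smooth_on (cran c \<times> V) (\<lambda>y. (\<lambda>x. snd c' (cinv d x)) (snd y))"
    by (rule smooth_on_compose[OF o V(1) _ _ V(5)]) (auto intro: smooth_on_linear bounded_linear_snd)
  from smooth_on_cong[OF o _ this, of "\<lambda>y. snd c' (snd (cinv e y))"]
  have "smooth_on (cran c \<times> V) (\<lambda>y. snd c' (snd (cinv e y)))" using inv by simp
  moreover have "\<forall>y\<in>cran c \<times> V. snd (cinv e y) \<in> fst c'" using V(4) inv by simp
  moreover have "snd e x \<in> cran c \<times> V" "cran c \<times> V \<subseteq> cran e"
    using V(2,3) c unfolding e cran_pchart x by (auto simp: charts_at_iff)
  ultimately show "\<exists>V. chart_nhd e x V \<and> (\<forall>y\<in>V. snd (cinv e y) \<in> fst c') \<and>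
      smooth_on V (\<lambda>y. snd c' (snd (cinv e y)))"
    using o by (intro exI[of _ "cran c \<times> V"] conjI)
qed

lemma smooth_atlas_prod:
  assumes "smooth_atlas A" "smooth_atlas B"
  shows "smooth_atlas (prod_atlas A B)"
proof -
  have p: "proper_charts A" "proper_charts B" using assms smooth_atlas_proper by blast+
  have "smooth_at (prod_atlas A B) (prod_atlas A B) (\<lambda>x. (fst x, snd x)) x" if "x \<in> pts (prod_atlas A B)" for x
    by (intro smooth_at_Pair smooth_at_fst smooth_at_snd assms p that)
  then show ?thesis using p by (simp add: smooth_atlas_def proper_charts_prod)
qed

text \<open>\<open>M\<close> is the total derivative of \<open>m\<close> in product charts. Its
  values on (v, 0) and (0, w) are the partial tangent maps; with linearity this yields the Leibniz
  rule \<open>tangent_map_product\<close>.\<close>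

lemma tangent_map_slices:
  assumes A: "smooth_atlas A" and B: "smooth_atlas B" and m: "smooth_at (prod_atlas A B) C m (a, b)"
    and c: "c \<in> charts_at A a" and d: "d \<in> charts_at B b" and e: "e \<in> charts_at C (m (a, b))"
  defines "M \<equiv> frechet_derivative (\<lambda>x. snd e (m (cinv (pchart c d) x))) (at (snd c a, snd d b))"
  shows "v \<in> tangent_space A a \<Longrightarrow> tangent_map A C (\<lambda>x. m (x, b)) a v e = M (v c, 0)"
    and "w \<in> tangent_space B b \<Longrightarrow> tangent_map B C (\<lambda>y. m (a, y)) b w e = M (0, w d)"
    and "smooth_at X A f p \<Longrightarrow> smooth_at X B g p \<Longrightarrow> a = f p \<Longrightarrow> b = g p \<Longrightarrow> smooth_atlas X \<Longrightarrow>
      u \<in> tangent_space X p \<Longrightarrow> tangent_map X C (\<lambda>x. m (f x, g x)) p u e =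
      M (tangent_map X A f p u c, tangent_map X B g p u d)"
    and "linear M"
proof -
  note pA = smooth_atlas_proper[OF A] and pB = smooth_atlas_proper[OF B]
  have pts: "a \<in> pts A" "b \<in> pts B" using charts_at_pts[OF c] charts_at_pts[OF d] by auto
  have cd: "pchart c d \<in> charts_at (prod_atlas A B) (a, b)" using c d by (auto simp: charts_at_prod)
  have P: "proper_charts (prod_atlas A B)" by (rule proper_charts_prod[OF pA pB])
  \<comment> \<open>Proved for every source \<open>X\<close>: the partial tangent maps are the cases
    in which one of \<open>f\<close>, \<open>g\<close> is the identity and the other is
    constant.\<close>
  have gen: "tangent_map X C (\<lambda>x. m (f x, g x)) p u e = M (tangent_map X A f p u c, tangent_map X B g p u d)"
    if f: "smooth_at X A f p" and g: "smooth_at X B g p" and ab: "a = f p" "b = g p" and X: "smooth_atlas X"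
      and u: "u \<in> tangent_space X p" for X :: "('x, 'y::model_space) atlas" and f g p u
  proof -
    obtain k where k: "k \<in> charts_at X p" using smooth_at_pts[OF f] by (auto simp: pts_iff)
    note fg = smooth_at_Pair[OF f g]
    note mfg = smooth_at_compose[OF smooth_atlas_proper[OF X] P m[unfolded ab] fg]
    note Df = smooth_at_has_derivative[OF f k c[unfolded ab]] and Dg = smooth_at_has_derivative[OF g k d[unfolded ab]]
    have D: "frechet_derivative (\<lambda>x. snd (pchart c d) (f (cinv k x), g (cinv k x))) (at (snd k p)) =
        (\<lambda>v. (frechet_derivative (\<lambda>x. snd c (f (cinv k x))) (at (snd k p)) v,
              frechet_derivative (\<lambda>x. snd d (g (cinv k x))) (at (snd k p)) v))"
      by (rule frechet_derivative_eq) (simp add: has_derivative_Pair[OF Df Dg])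
    have "tangent_map X C (\<lambda>x. m (f x, g x)) p u e =
        frechet_derivative (\<lambda>x. snd e (m (f (cinv k x), g (cinv k x)))) (at (snd k p)) (u k)"
      by (rule tangent_map_chart[OF X mfg u k e[unfolded ab]])
    also have "\<dots> = M (frechet_derivative (\<lambda>x. snd (pchart c d) (f (cinv k x), g (cinv k x))) (at (snd k p)) (u k))"
      unfolding M_def
      using smooth_at_compose_chart(2)[OF smooth_atlas_proper[OF X] P fg m[unfolded ab] k cd[unfolded ab] e[unfolded ab]]
      by (simp add: frechet_derivative_eq ab)
    also have "\<dots> = M (tangent_map X A f p u c, tangent_map X B g p u d)"
      unfolding D using c d ab by (simp add: tangent_map_chart[OF X f u k] tangent_map_chart[OF X g u k])
    finally show ?thesis .
  qed
  show "smooth_at X A f p \<Longrightarrow> smooth_at X B g p \<Longrightarrow> a = f p \<Longrightarrow> b = g p \<Longrightarrow> smooth_atlas X \<Longrightarrow>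
      u \<in> tangent_space X p \<Longrightarrow> tangent_map X C (\<lambda>x. m (f x, g x)) p u e =
      M (tangent_map X A f p u c, tangent_map X B g p u d)" by (rule gen)
  show "tangent_map A C (\<lambda>x. m (x, b)) a v e = M (v c, 0)" if "v \<in> tangent_space A a"
    using gen[OF smooth_at_ident[OF A pts(1)] smooth_at_const[OF pA pts] refl refl A that]
    by (simp add: tangent_map_ident[OF A pts(1) that] tangent_map_const)
  show "tangent_map B C (\<lambda>y. m (a, y)) b w e = M (0, w d)" if "w \<in> tangent_space B b"
    using gen[OF smooth_at_const[OF pB pts(2,1)] smooth_at_ident[OF B pts(2)] refl refl B that]
    by (simp add: tangent_map_ident[OF B pts(2) that] tangent_map_const)
  show "linear M"
    unfolding M_def using has_derivative_linear[OF smooth_at_has_derivative[OF m cd e]] by simp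
qed

lemma tangent_map_product:
  assumes A: "smooth_atlas A" and B: "smooth_atlas B" and X: "smooth_atlas X"
    and m: "smooth_at (prod_atlas A B) C m (f p, g p)"
    and f: "smooth_at X A f p" and g: "smooth_at X B g p" and u: "u \<in> tangent_space X p"
  shows "tangent_map X C (\<lambda>x. m (f x, g x)) p u =
    (\<lambda>e. tangent_map A C (\<lambda>x. m (x, g p)) (f p) (tangent_map X A f p u) e +
         tangent_map B C (\<lambda>y. m (f p, y)) (g p) (tangent_map X B g p u) e)"
proof
  fix e
  obtain c where c: "c \<in> charts_at A (f p)" using smooth_at_pts[OF f] by (auto simp: pts_iff)
  obtain d where d: "d \<in> charts_at B (g p)" using smooth_at_pts[OF g] by (auto simp: pts_iff)
  show "tangent_map X C (\<lambda>x. m (f x, g x)) p u e =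
      tangent_map A C (\<lambda>x. m (x, g p)) (f p) (tangent_map X A f p u) e +
      tangent_map B C (\<lambda>y. m (f p, y)) (g p) (tangent_map X B g p u) e"
  proof (cases "e \<in> charts_at C (m (f p, g p))")
    case True
    note s = tangent_map_slices[OF A B m c d True]
    show ?thesis
      unfolding s(1)[OF tangent_map_in[OF X A f u]] s(2)[OF tangent_map_in[OF X B g u]]
        s(3)[OF f g refl refl X u] linear_add[OF s(4), symmetric] by simp
  qed (simp add: tangent_map_outside)
qed

lemma charts_at_restrict:
  "p \<in> W \<Longrightarrow> c \<in> charts_at A p \<Longrightarrow> (fst c \<inter> W, snd c) \<in> charts_at (restrict_atlas A W) p"
  by (force simp: charts_at_def restrict_atlas_def)

lemma pts_restrict [simp]: "pts (restrict_atlas A W) = pts A \<inter> W"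
  by (force simp: pts_def restrict_atlas_def)

lemma smooth_at_from_restrict:
  assumes A: "proper_charts A" and f: "smooth_at (restrict_atlas A W) B f p"
  shows "smooth_at A B f p"
  unfolding smooth_at_def
proof (intro conjI ballI)
  have p: "p \<in> pts A" "p \<in> W" using smooth_at_pts(1)[OF f] by auto
  show "p \<in> pts A" "f p \<in> pts B" using p smooth_at_pts[OF f] by auto
  fix c d assume c: "c \<in> charts_at A p" and d: "d \<in> charts_at B (f p)"
  let ?c = "(fst c \<inter> W, snd c)"
  obtain V where V: "open V" "snd c p \<in> V" "V \<subseteq> snd c ` (fst c \<inter> W)" "\<And>x. x \<in> V \<Longrightarrow> f (cinv ?c x) \<in> fst d"
    "smooth_on V (\<lambda>x. snd d (f (cinv ?c x)))"
    using smooth_atD[OF f charts_at_restrict[OF p(2) c] d] by (metis fst_conv snd_conv)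
  have inj: "inj_on (snd c) (fst c)" using A c by (simp add: proper_charts_def charts_at_iff)
  \<comment> \<open>\<open>inv_into\<close> depends on the domain; the two inverses agree on the
    image of the smaller domain, which contains \<open>V\<close>.\<close>
  have eq: "cinv ?c x = cinv c x" if "x \<in> V" for x
  proof -
    obtain q where "q \<in> fst c \<inter> W" "x = snd c q" using V(3) \<open>x \<in> V\<close> by blast
    then show ?thesis
      using inv_into_f_f[OF inj, of q] inv_into_f_f[OF inj_on_subset[OF inj], of "fst c \<inter> W" q] by auto
  qed
  have "smooth_on V (\<lambda>x. snd d (f (cinv c x)))"
    by (rule smooth_on_cong[OF V(1) _ V(5)]) (simp only: eq)
  then show "\<exists>V. chart_nhd c p V \<and> (\<forall>x\<in>V. f (cinv c x) \<in> fst d) \<and>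
      smooth_on V (\<lambda>x. snd d (f (cinv c x)))"
    using V eq by (intro exI[of _ V]) auto
qed

lemma smooth_at_into_restrict:
  assumes f: "smooth_at A (restrict_atlas B W) f p"
  shows "smooth_at A B f p"
  unfolding smooth_at_def
proof (intro conjI ballI)
  have p: "f p \<in> pts B" "f p \<in> W" using smooth_at_pts(2)[OF f] by auto
  show "p \<in> pts A" "f p \<in> pts B" using p smooth_at_pts[OF f] by auto
  fix c d assume c: "c \<in> charts_at A p" and d: "d \<in> charts_at B (f p)"
  obtain V where "open V" "snd c p \<in> V" "V \<subseteq> cran c" "\<And>x. x \<in> V \<Longrightarrow> f (cinv c x) \<in> fst d \<inter> W"
    "smooth_on V (\<lambda>x. snd d (f (cinv c x)))"
    using smooth_atD[OF f c charts_at_restrict[OF p(2) d]] by (metis fst_conv snd_conv)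
  then show "\<exists>V. chart_nhd c p V \<and> (\<forall>x\<in>V. f (cinv c x) \<in> fst d) \<and>
      smooth_on V (\<lambda>x. snd d (f (cinv c x)))" by blast
qed

text \<open>Makes the target of a local trivialization a restriction of the full product atlas, so
  that the preceding lemmas on \<open>restrict_atlas\<close> apply to it.\<close>

lemma prod_atlas_restrict: "prod_atlas (restrict_atlas A U) B = restrict_atlas (prod_atlas A B) (U \<times> UNIV)"
proof -
  have eq: "(D \<inter> U) \<times> E = D \<times> E \<inter> U \<times> UNIV" for D :: "'a set" and E :: "'b set" by auto
  have "c \<in> prod_atlas (restrict_atlas A U) B \<longleftrightarrow> c \<in> restrict_atlas (prod_atlas A B) (U \<times> UNIV)" for c
  proof
    assume "c \<in> prod_atlas (restrict_atlas A U) B"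
    then obtain D \<phi> E \<psi> where "c = ((D \<inter> U) \<times> E, map_prod \<phi> \<psi>)" "(D, \<phi>) \<in> A" "(E, \<psi>) \<in> B"
      unfolding prod_atlas_def restrict_atlas_def by auto
    then show "c \<in> restrict_atlas (prod_atlas A B) (U \<times> UNIV)"
      unfolding prod_atlas_def restrict_atlas_def eq
      by (intro image_eqI[of _ _ "(D \<times> E, map_prod \<phi> \<psi>)"]) auto
  next
    assume "c \<in> restrict_atlas (prod_atlas A B) (U \<times> UNIV)"
    then obtain D \<phi> E \<psi> where c: "c = ((D \<inter> U) \<times> E, map_prod \<phi> \<psi>)" "(D, \<phi>) \<in> A" "(E, \<psi>) \<in> B"
      unfolding prod_atlas_def restrict_atlas_def eq by auto
    then have "(D \<inter> U, \<phi>) \<in> restrict_atlas A U" unfolding restrict_atlas_def by force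
    with c show "c \<in> prod_atlas (restrict_atlas A U) B" unfolding prod_atlas_def by blast
  qed
  then show ?thesis by blast
qed

lemma proper_charts_restrict:
  assumes A: "proper_charts A" and W: "\<And>p. p \<in> pts A \<Longrightarrow> p \<in> W \<Longrightarrow> nhd A p W"
  shows "proper_charts (restrict_atlas A W)"
  unfolding proper_charts_def restrict_atlas_def
proof (clarsimp, intro conjI)
  fix D \<phi> assume c: "(D, \<phi>) \<in> A"
  have inj: "inj_on \<phi> D" using A c by (force simp: proper_charts_def)
  then show "inj_on \<phi> (D \<inter> W)" by (rule inj_on_subset) auto
  show "open (\<phi> ` (D \<inter> W))"
  proof (subst open_subopen, intro ballI)
    fix x assume "x \<in> \<phi> ` (D \<inter> W)"
    then obtain p where p: "p \<in> D" "p \<in> W" "x = \<phi> p" by auto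
    have cp: "(D, \<phi>) \<in> charts_at A p" using c p by (simp add: charts_at_iff)
    obtain V where V: "open V" "\<phi> p \<in> V" "V \<subseteq> \<phi> ` D" "\<forall>x\<in>V. inv_into D \<phi> x \<in> W"
      using bspec[OF W[OF charts_at_pts[OF cp] p(2), unfolded nhd_def] cp] by auto
    have "V \<subseteq> \<phi> ` (D \<inter> W)"
    proof
      fix y assume y: "y \<in> V"
      then obtain q where "q \<in> D" "y = \<phi> q" using V(3) by auto
      then show "y \<in> \<phi> ` (D \<inter> W)" using V(4) y inv_into_f_f[OF inj] by auto
    qed
    then show "\<exists>V. open V \<and> x \<in> V \<and> V \<subseteq> \<phi> ` (D \<inter> W)" using V p by blast
  qed
qed


subsection \<open>Curves\<close>

lemma charts_at_real [simp]: "charts_at real_atlas t = {(UNIV, id)}"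
  by (auto simp: charts_at_def real_atlas_def)

lemma pts_real [simp]: "pts real_atlas = UNIV"
  by (simp add: pts_def real_atlas_def)

lemma proper_charts_real: "proper_charts real_atlas"
  by (simp add: proper_charts_def real_atlas_def)

lemma smooth_at_real_iff:
  "smooth_at real_atlas real_atlas f t \<longleftrightarrow> (\<exists>V. open V \<and> t \<in> V \<and> smooth_on V f)"
  by (simp add: smooth_at_def)

lemma smooth_atlas_real: "smooth_atlas real_atlas"
  using smooth_on_id by (auto simp: smooth_atlas_def proper_charts_real smooth_at_real_iff)

text \<open>The vector d/dt, with the same coordinate at every point. Velocities become tangent maps
  applied to it and inherit the chain rule.\<close>

definition unit_tvec :: "(real, real) tvec" where
  "unit_tvec = (\<lambda>c. if c = (UNIV, id) then 1 else 0)"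

lemma unit_tvec_in: "unit_tvec \<in> tangent_space real_atlas t"
  using frechet_derivative_eq[OF has_derivative_id] by (auto simp: tangent_space_def unit_tvec_def)

lemma velocity_eq_tangent_map:
  assumes "smooth_at real_atlas A \<gamma> t"
  shows "velocity A \<gamma> t = tangent_map real_atlas A \<gamma> t unit_tvec"
proof
  fix d
  show "velocity A \<gamma> t d = tangent_map real_atlas A \<gamma> t unit_tvec d"
  proof (cases "d \<in> charts_at A (\<gamma> t)")
    case True
    have "((\<lambda>x. snd d (\<gamma> x)) has_derivative frechet_derivative (\<lambda>x. snd d (\<gamma> x)) (at t)) (at t)"
      using smooth_at_has_derivative[OF assms _ True] by simp
    then have "vector_derivative (\<lambda>x. snd d (\<gamma> x)) (at t) = frechet_derivative (\<lambda>x. snd d (\<gamma> x)) (at t) 1"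
      by (simp add: frechet_derivative_eq_vector_derivative differentiableI)
    then show ?thesis using True
      by (simp add: velocity_def tangent_map_def unit_tvec_def o_def Let_def)
  qed (simp add: velocity_def tangent_map_outside)
qed

lemma velocity_in:
  "smooth_atlas A \<Longrightarrow> smooth_at real_atlas A \<gamma> t \<Longrightarrow> velocity A \<gamma> t \<in> tangent_space A (\<gamma> t)"
  by (simp add: velocity_eq_tangent_map tangent_map_in smooth_atlas_real unit_tvec_in)

lemma velocity_compose:
  assumes "smooth_atlas A" "smooth_at A B f (\<gamma> t)" "smooth_at real_atlas A \<gamma> t"
  shows "velocity B (\<lambda>s. f (\<gamma> s)) t = tangent_map A B f (\<gamma> t) (velocity A \<gamma> t)"
proof -
  have "smooth_at real_atlas B (\<lambda>s. f (\<gamma> s)) t"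
    by (rule smooth_at_compose[OF proper_charts_real smooth_atlas_proper[OF assms(1)] assms(2,3)])
  then show ?thesis
    by (simp add: velocity_eq_tangent_map assms(3) tangent_map_compose[OF smooth_atlas_real assms(1,2,3) unit_tvec_in])
qed

lemma velocity_has_vector_derivative:
  assumes "smooth_at real_atlas A \<gamma> t" "d \<in> charts_at A (\<gamma> t)"
  shows "((\<lambda>s. snd d (\<gamma> s)) has_vector_derivative velocity A \<gamma> t d) (at t)"
proof -
  have "(\<lambda>s. snd d (\<gamma> s)) differentiable (at t)"
    using smooth_at_has_derivative[OF assms(1) _ assms(2)] by (simp add: differentiableI)
  then show ?thesis using assms(2) by (simp add: velocity_def o_def vector_derivative_works)
qed

text \<open>Serves for time shifts (\<open>a = 1\<close>) and for rescaling time
  (\<open>b = 0\<close>).\<close>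

lemma velocity_affine:
  assumes "smooth_atlas A" "smooth_at real_atlas A \<gamma> (a * t + b)"
  shows "smooth_at real_atlas A (\<lambda>s. \<gamma> (a * s + b)) t"
    and "velocity A (\<lambda>s. \<gamma> (a * s + b)) t = (\<lambda>c. a *\<^sub>R velocity A \<gamma> (a * t + b) c)"
proof -
  have "smooth_on UNIV (\<lambda>s::real. a * s + b)"
    by (intro smooth_on_add smooth_on_linear bounded_linear_mult_right smooth_on_const open_UNIV)
  then have s: "smooth_at real_atlas real_atlas (\<lambda>s. a * s + b) t"
    by (auto simp: smooth_at_real_iff)
  show g: "smooth_at real_atlas A (\<lambda>s. \<gamma> (a * s + b)) t"
    by (rule smooth_at_compose[OF proper_charts_real proper_charts_real assms(2) s])
  show "velocity A (\<lambda>s. \<gamma> (a * s + b)) t = (\<lambda>c. a *\<^sub>R velocity A \<gamma> (a * t + b) c)"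
  proof
    fix d
    show "velocity A (\<lambda>s. \<gamma> (a * s + b)) t d = a *\<^sub>R velocity A \<gamma> (a * t + b) d"
    proof (cases "d \<in> charts_at A (\<gamma> (a * t + b))")
      case True
      have "((\<lambda>s. a * s + b) has_vector_derivative a) (at t)"
        by (auto intro!: derivative_eq_intros)
      from vector_diff_chain_at[OF this velocity_has_vector_derivative[OF assms(2) True]]
      have "((\<lambda>s. snd d (\<gamma> (a * s + b))) has_vector_derivative a *\<^sub>R velocity A \<gamma> (a * t + b) d) (at t)"
        by (simp add: o_def)
      then show ?thesis using True
        by (simp add: velocity_def o_def vector_derivative_at)
    qed (simp add: velocity_def)
  qed
qed



subsection \<open>Changing charts\<close>

text \<open>Group operations and actions are unspecified outside the manifolds. Since
  \<open>pts A\<close> is a neighbourhood of each of its points, identities valid on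
  \<open>pts A\<close> suffice for smoothness and for tangent maps.\<close>

lemma nhd_pts: "proper_charts A \<Longrightarrow> nhd A p (pts A)"
proof -
  assume A: "proper_charts A"
  show ?thesis unfolding nhd_def
  proof
    fix c assume c: "c \<in> charts_at A p"
    have "\<forall>x\<in>cran c. cinv c x \<in> pts A"
      using c cinv_mem[of _ c] by (auto simp: charts_at_iff pts_iff)
    then show "\<exists>V. chart_nhd c p V \<and> (\<forall>x\<in>V. cinv c x \<in> pts A)"
      using open_cran[OF A c] c by (intro exI[of _ "cran c"]) (auto simp: charts_at_iff)
  qed
qed

lemma smooth_at_cong_pts:
  assumes "proper_charts A" "\<And>x. x \<in> pts A \<Longrightarrow> f x = g x" "smooth_at A B f p"
  shows "smooth_at A B g p"
  using smooth_at_cong[OF assms(1) nhd_mono[OF nhd_pts[OF assms(1)]] assms(3)] assms(2) by blast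

lemma tangent_map_cong_pts:
  assumes "proper_charts A" "p \<in> pts A" "\<And>x. x \<in> pts A \<Longrightarrow> f x = g x"
  shows "tangent_map A B f p = tangent_map A B g p"
  using tangent_map_cong[OF assms(1,2) nhd_mono[OF nhd_pts[OF assms(1)]]] assms(3) by blast

lemma smooth_at_subset_atlas:
  "smooth_at A B f p \<Longrightarrow> A' \<subseteq> A \<Longrightarrow> B' \<subseteq> B \<Longrightarrow> p \<in> pts A' \<Longrightarrow> f p \<in> pts B' \<Longrightarrow> smooth_at A' B' f p"
  unfolding smooth_at_def charts_at_def by blast

lemma proper_charts_subset: "proper_charts A \<Longrightarrow> A' \<subseteq> A \<Longrightarrow> proper_charts A'"
  unfolding proper_charts_def by blast

lemma charts_at_singleton: "p \<in> fst c \<Longrightarrow> charts_at {c} p = {c}"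
  by (auto simp: charts_at_def)

lemma pts_singleton [simp]: "pts {c} = fst c"
  by (auto simp: pts_def)

text \<open>A single chart is an atlas, so changes of charts become instances of composition.\<close>

lemma smooth_at_into_chart:
  assumes "smooth_atlas A" "c \<in> charts_at A p"
  shows "smooth_at A {c} (\<lambda>x. x) p" "smooth_at {c} A (\<lambda>x. x) p" "proper_charts {c}"
proof -
  have c: "c \<in> A" "p \<in> fst c" "p \<in> pts A" using assms(2) charts_at_pts[OF assms(2)] by (auto simp: charts_at_iff)
  show "smooth_at A {c} (\<lambda>x. x) p" "smooth_at {c} A (\<lambda>x. x) p" "proper_charts {c}"
    using c smooth_at_subset_atlas[OF smooth_at_ident[OF assms(1) c(3)], of A "{c}"]
      smooth_at_subset_atlas[OF smooth_at_ident[OF assms(1) c(3)], of "{c}" A]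
      proper_charts_subset[OF smooth_atlas_proper[OF assms(1)], of "{c}"] by auto
qed

lemma smooth_atI_target_chart:
  assumes A: "proper_charts A" and B: "smooth_atlas B" and d: "d \<in> charts_at B (f p)" and f: "smooth_at A {d} f p"
  shows "smooth_at A B f p"
  using smooth_at_compose[OF A smooth_at_into_chart(3)[OF B d] smooth_at_into_chart(2)[OF B d] f] .

lemma nhd_chart:
  assumes A: "smooth_atlas A" and c: "c \<in> charts_at A p" and V: "open V" "snd c p \<in> V"
  shows "nhd A p (fst c \<inter> snd c -` V)"
proof -
  have pc: "p \<in> fst c" using c by (simp add: charts_at_iff)
  have "nhd {c} p (fst c \<inter> snd c -` V)"
    unfolding nhd_def charts_at_singleton[OF pc]
  proof
    fix c' assume "c' \<in> {c}"
    then show "\<exists>W. chart_nhd c' p W \<and> (\<forall>x\<in>W. cinv c' x \<in> fst c \<inter> snd c -` V)"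
      using V pc open_cran[OF smooth_atlas_proper[OF A] c] cinv_mem[of _ c]
      by (intro exI[of _ "cran c \<inter> V"]) auto
  qed
  from nhd_vimage[OF smooth_atlas_proper[OF A] smooth_at_into_chart(3,1)[OF A c] this] show ?thesis
    by (simp add: vimage_def)
qed

lemma smooth_mapI:
  assumes A: "proper_charts A" and f: "\<And>p. p \<in> pts A \<Longrightarrow> smooth_at A B f p"
  shows "smooth_map A B f"
  unfolding smooth_map_def case_prod_beta
proof (intro conjI ballI)
  show "f ` pts A \<subseteq> pts B" using smooth_at_pts(2)[OF f] by auto
  fix c d assume cd: "c \<in> A" "d \<in> B"
  let ?U = "snd c ` (fst c \<inter> f -` fst d)"
  have loc: "\<exists>V. open V \<and> x \<in> V \<and> V \<subseteq> ?U \<and> smooth_on V (snd d \<circ> f \<circ> cinv c)" if x: "x \<in> ?U" for x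
  proof -
    obtain p where p: "p \<in> fst c" "f p \<in> fst d" "x = snd c p" using x by auto
    have c: "c \<in> charts_at A p" and d: "d \<in> charts_at B (f p)" using cd p by (auto simp: charts_at_iff)
    obtain V where V: "open V" "snd c p \<in> V" "V \<subseteq> cran c" "\<And>x. x \<in> V \<Longrightarrow> f (cinv c x) \<in> fst d"
      "smooth_on V (\<lambda>x. snd d (f (cinv c x)))"
      by (rule smooth_atD[OF f[OF charts_at_pts[OF c]] c d]) (rule that; blast)
    have "y \<in> ?U" if y: "y \<in> V" for y
    proof -
      have yc: "y \<in> cran c" using V(3) y by (rule subsetD)
      show ?thesis
        by (rule image_eqI[of _ _ "cinv c y"])
          (simp_all only: snd_cinv[OF yc] IntI cinv_mem[OF yc] vimageI2 V(4)[OF y])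
    qed
    then show ?thesis using V p by (intro exI[of _ V]) (auto simp: o_def)
  qed
  have o: "open ?U" using loc by (subst open_subopen) blast
  moreover have "smooth_on ?U (snd d \<circ> f \<circ> cinv c)"
    by (rule smooth_on_local[OF o]) (use loc in blast)
  ultimately show "open ?U" "smooth_on ?U (snd d \<circ> f \<circ> cinv c)" by auto
qed

text \<open>Smoothness of the partial tangent map of \<open>m\<close> in its second argument, where
  both arguments and the vector depend on a parameter. Left-invariant fields, the Maurer-Cartan form
  and the adjoint action are special cases. \<open>S\<close> is chosen before \<open>T\<close> and
  \<open>v\<close>, so one neighbourhood serves all vector fields.\<close>

lemma smooth_on_partial_tangent_map:
  assumes A: "smooth_atlas A" and B: "smooth_atlas B" and X: "proper_charts X"
    and m: "\<And>x y. x \<in> pts A \<Longrightarrow> y \<in> pts B \<Longrightarrow> smooth_at (prod_atlas A B) C m (x, y)"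
    and f: "smooth_at X A f p" and g: "smooth_at X B g p"
    and k: "k \<in> charts_at X p" and d: "d \<in> charts_at B (g p)" and e: "e \<in> charts_at C (m (f p, g p))"
  shows "\<exists>S. chart_nhd k p S \<and>
    (\<forall>T v. open T \<longrightarrow> T \<subseteq> S \<longrightarrow> (\<forall>x\<in>T. v x \<in> tangent_space B (g (cinv k x))) \<longrightarrow> smooth_on T (\<lambda>x. v x d) \<longrightarrow>
      smooth_on T (\<lambda>x. tangent_map B C (\<lambda>y. m (f (cinv k x), y)) (g (cinv k x)) (v x) e))"
proof -
  note pA = smooth_atlas_proper[OF A] and pB = smooth_atlas_proper[OF B]
  note P = proper_charts_prod[OF pA pB]
  obtain c where c: "c \<in> charts_at A (f p)" using smooth_at_pts[OF f] by (auto simp: pts_iff)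
  note fg = smooth_at_Pair[OF f g]
  have fp: "f p \<in> pts A" and gp: "g p \<in> pts B" using smooth_at_pts[OF f] smooth_at_pts[OF g] by auto
  have cd: "pchart c d \<in> charts_at (prod_atlas A B) (f p, g p)" using c d by (auto simp: charts_at_prod)
  obtain V where V: "open V" "snd (pchart c d) (f p, g p) \<in> V" "V \<subseteq> cran (pchart c d)"
    "\<And>z. z \<in> V \<Longrightarrow> m (cinv (pchart c d) z) \<in> fst e"
    "smooth_on V (\<lambda>z. snd e (m (cinv (pchart c d) z)))" by (rule smooth_atD[OF m[OF fp gp] cd e]) (rule that; blast)
  obtain U where U: "open U" "snd k p \<in> U" "U \<subseteq> cran k" "\<And>x. x \<in> U \<Longrightarrow> (f (cinv k x), g (cinv k x)) \<in> fst (pchart c d)"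
    "smooth_on U (\<lambda>x. snd (pchart c d) (f (cinv k x), g (cinv k x)))"
    by (rule smooth_atD[OF fg k cd]) (rule that; blast)
  let ?fg = "\<lambda>x. snd (pchart c d) (f (cinv k x), g (cinv k x))"
  let ?M = "\<lambda>z. snd e (m (cinv (pchart c d) z))"
  let ?S = "U \<inter> ?fg -` V"
  show ?thesis
  proof (intro exI[of _ ?S] conjI allI impI)
    show "open ?S" by (rule continuous_open_preimage[OF smooth_on_continuous[OF U(5)] U(1) V(1)])
    show "snd k p \<in> ?S" using U(2) V(2) unfolding cinv_chart[OF X k] vimage_def by (intro IntI CollectI) (simp_all only: cinv_chart[OF X k])
    show "?S \<subseteq> cran k" using U(3) by auto
    fix T and v :: "_ \<Rightarrow> ('c, 'd) tvec"
    assume T: "open T" "T \<subseteq> ?S" and v: "\<forall>x\<in>T. v x \<in> tangent_space B (g (cinv k x))"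
      and vd: "smooth_on T (\<lambda>x. v x d)"
    \<comment> \<open>The partial tangent map is the total derivative of \<open>m\<close> on the
      vector (0, v).\<close>
    have "smooth_on T (\<lambda>x. frechet_derivative ?M (at (?fg x)) (0, v x d))"
      using T by (intro smooth_on_directional[OF T(1) V(1) _ _ _ V(5)] smooth_on_subset[OF U(5)]
          smooth_on_Pair smooth_on_const vd) auto
    moreover have "frechet_derivative ?M (at (?fg x)) (0, v x d) =
        tangent_map B C (\<lambda>y. m (f (cinv k x), y)) (g (cinv k x)) (v x) e" if x: "x \<in> T" for x
    proof -
      have xU: "x \<in> U" "?fg x \<in> V" using x T by auto
      have c': "c \<in> charts_at A (f (cinv k x))" and d': "d \<in> charts_at B (g (cinv k x))"
        using U(4)[OF xU(1)] c d by (auto simp: charts_at_iff)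
      have "cinv (pchart c d) (?fg x) = (f (cinv k x), g (cinv k x))"
        using cinv_snd[OF P, of "pchart c d" "(f (cinv k x), g (cinv k x))"] cd U(4)[OF xU(1)]
        by (simp add: charts_at_iff)
      then have e': "e \<in> charts_at C (m (f (cinv k x), g (cinv k x)))"
        using V(4)[OF xU(2)] e by (simp add: charts_at_iff)
      show ?thesis
        using tangent_map_slices(2)[OF A B m[OF charts_at_pts[OF c'] charts_at_pts[OF d']] c' d' e' bspec[OF v x]]
        by simp
    qed
    ultimately show "smooth_on T (\<lambda>x. tangent_map B C (\<lambda>y. m (f (cinv k x), y)) (g (cinv k x)) (v x) e)"
      by (rule smooth_on_cong[OF T(1), rotated])
  qed
qed


section \<open>Lie groups\<close>

lemma (in group) pow_add_commuting:
  assumes "x \<in> carrier G" "y \<in> carrier G" "x \<otimes> y = y \<otimes> x"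
  shows "(x \<otimes> y) [^] (n::nat) = x [^] n \<otimes> y [^] n"
proof (induction n)
  case (Suc n)
  have c: "y [^] n \<otimes> x = x \<otimes> y [^] n"
  proof (induction n)
    case (Suc n)
    have "y [^] Suc n \<otimes> x = y [^] n \<otimes> (x \<otimes> y)" using assms by (simp add: m_assoc)
    also have "\<dots> = (y [^] n \<otimes> x) \<otimes> y" using assms(1,2) by (simp add: m_assoc)
    also have "\<dots> = x \<otimes> y [^] Suc n" using assms(1,2) by (simp add: Suc m_assoc)
    finally show ?case .
  qed (use assms in simp)
  have "(x \<otimes> y) [^] Suc n = x [^] n \<otimes> (y [^] n \<otimes> x) \<otimes> y" using assms Suc by (simp add: m_assoc)
  also have "\<dots> = x [^] Suc n \<otimes> y [^] Suc n" using assms by (simp add: c m_assoc)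
  finally show ?case .
qed simp

text \<open>The extension is \<open>\<Gamma> t = \<gamma> (t / n) ^ n\<close> for large \<open>n\<close>.\<close>

lemma (in group) local_one_parameter_extend:
  fixes \<gamma> :: "real \<Rightarrow> 'a"
  assumes e: "e > 0" and car: "\<And>t. \<bar>t\<bar> < e \<Longrightarrow> \<gamma> t \<in> carrier G"
    and hom: "\<And>s t. \<bar>s\<bar> < e \<Longrightarrow> \<bar>t\<bar> < e \<Longrightarrow> \<bar>s + t\<bar> < e \<Longrightarrow> \<gamma> (s + t) = \<gamma> s \<otimes> \<gamma> t"
  shows "\<exists>\<Gamma>. (\<forall>t. \<Gamma> t \<in> carrier G) \<and> (\<forall>s t. \<Gamma> (s + t) = \<Gamma> s \<otimes> \<Gamma> t) \<and> (\<forall>t. \<bar>t\<bar> < e \<longrightarrow> \<Gamma> t = \<gamma> t)"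
proof -
  have pow: "\<gamma> (real n * s) = \<gamma> s [^] n" if "\<bar>real n * s\<bar> < e" "n > 0" for n s
    using that
  proof (induction n)
    case (Suc n)
    show ?case
    proof (cases "n = 0")
      case False
      have le: "\<bar>real k * s\<bar> \<le> \<bar>real (Suc n) * s\<bar>" if "k \<le> Suc n" for k
        using that by (simp add: abs_mult mult_right_mono)
      have 1: "\<bar>real n * s\<bar> < e" "\<bar>s\<bar> < e" using le[of n] le[of 1] Suc.prems by simp_all
      have "\<gamma> (real (Suc n) * s) = \<gamma> (real n * s + s)" by (simp add: algebra_simps)
      also have "\<dots> = \<gamma> (real n * s) \<otimes> \<gamma> s"
        using 1 Suc.prems by (intro hom) (simp_all add: algebra_simps)
      also have "\<dots> = \<gamma> s [^] Suc n" using Suc.IH 1 False by simp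
      finally show ?thesis .
    qed (use Suc.prems car in \<open>simp add: l_one\<close>)
  qed simp
  have indep: "\<gamma> (t / real n) [^] n = \<gamma> (t / real m) [^] m"
    if "\<bar>t / real n\<bar> < e" "\<bar>t / real m\<bar> < e" "n > 0" "m > 0" for t and n m :: nat
  proof -
    \<comment> \<open>A common subdivision: both sides turn out to be the power of
      \<open>\<gamma> s\<close> with exponent \<open>n * m\<close>.\<close>
    define s where "s = t / (real n * real m)"
    have 1: "t / real n = real m * s" "t / real m = real n * s" using that by (simp_all add: s_def)
    have "\<bar>s\<bar> \<le> \<bar>real m * s\<bar>" using that by (simp add: abs_mult mult_le_cancel_right1)
    then have "\<gamma> s \<in> carrier G" using that 1 by (intro car) simp
    then show ?thesis
      using pow[of m s] pow[of n s] that 1 by (simp add: nat_pow_pow mult.commute)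
  qed
  \<comment> \<open>Chosen so that \<open>t / n\<close> lies in the domain of
    \<open>\<gamma>\<close> for every \<open>n \<ge> N t\<close>; the successor also excludes
    0.\<close>
  define N where "N t = Suc (nat \<lceil>\<bar>t\<bar> / e\<rceil>)" for t
  have N: "\<bar>t / real n\<bar> < e" "n > 0" if "n \<ge> N t" for t n
  proof -
    have n: "real n > \<bar>t\<bar> / e" using that unfolding N_def by linarith
    have "\<bar>t\<bar> / e \<ge> 0" using e by simp
    then have 0: "real n > 0" using n by linarith
    then show "n > 0" by simp
    show "\<bar>t / real n\<bar> < e" using n e 0 by (simp add: field_simps)
  qed
  define \<Gamma> where "\<Gamma> t = \<gamma> (t / real (N t)) [^] N t" for t
  have \<Gamma>: "\<Gamma> t = \<gamma> (t / real n) [^] n" if "\<bar>t / real n\<bar> < e" "n > 0" for t n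
    unfolding \<Gamma>_def using that N[of t "N t"] by (intro indep) auto
  show ?thesis
  proof (intro exI[of _ \<Gamma>] conjI allI impI)
    show "\<Gamma> t \<in> carrier G" for t
      unfolding \<Gamma>_def using N(1)[of t "N t"] by (intro nat_pow_closed car) simp
    show "\<Gamma> t = \<gamma> t" if "\<bar>t\<bar> < e" for t
      using \<Gamma>[of t 1] that car by simp
    show "\<Gamma> (s + t) = \<Gamma> s \<otimes> \<Gamma> t" for s t
    proof -
      define n where "n = max (N s) (max (N t) (N (s + t)))"
      have n: "\<bar>s / real n\<bar> < e" "\<bar>t / real n\<bar> < e" "\<bar>(s + t) / real n\<bar> < e" "n > 0"
        by (rule N[of s] N(1)[of t] N(1)[of "s + t"], simp add: n_def)+
      \<comment> \<open>The local homomorphism law, used in both orders, shows that the factors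
        commute, so the power of their product splits.\<close>
      then have "\<gamma> (s / n) \<otimes> \<gamma> (t / n) = \<gamma> (t / n) \<otimes> \<gamma> (s / n)"
        using hom[of "s / n" "t / n"] hom[of "t / n" "s / n"] by (simp add: add_divide_distrib add.commute)
      moreover have "\<gamma> ((s + t) / n) = \<gamma> (s / n) \<otimes> \<gamma> (t / n)"
        using n hom[of "s / n" "t / n"] by (simp add: add_divide_distrib)
      ultimately show ?thesis
        unfolding \<Gamma>[OF n(1,4)] \<Gamma>[OF n(2,4)] \<Gamma>[OF n(3,4)]
        using pow_add_commuting[OF car[OF n(1)] car[OF n(2)]] by simp
    qed
  qed
qed

text \<open>A large power of \<open>\<gamma> (t / n)\<close> reaches \<open>\<gamma> t\<close>, so
  the values near 0 determine the homomorphism.\<close>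

lemma (in group) one_parameter_eq:
  fixes \<gamma> \<delta> :: "real \<Rightarrow> 'a"
  assumes e: "e > 0" and car: "\<And>t. \<gamma> t \<in> carrier G" "\<And>t. \<delta> t \<in> carrier G"
    and hom: "\<And>s t. \<gamma> (s + t) = \<gamma> s \<otimes> \<gamma> t" "\<And>s t. \<delta> (s + t) = \<delta> s \<otimes> \<delta> t"
    and eq: "\<And>t. \<bar>t\<bar> < e \<Longrightarrow> \<gamma> t = \<delta> t"
  shows "\<gamma> = \<delta>"
proof
  fix t
  have pow: "\<phi> (real (Suc n) * s) = \<phi> s [^] Suc n"
    if "\<And>t. \<phi> t \<in> carrier G" "\<And>s t. \<phi> (s + t) = \<phi> s \<otimes> \<phi> t" for \<phi> :: "real \<Rightarrow> 'a" and n s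
  proof (induction n)
    case (Suc n)
    have "\<phi> (real (Suc (Suc n)) * s) = \<phi> (real (Suc n) * s + s)" by (simp add: algebra_simps)
    then show ?case using Suc by (simp add: that)
  qed (simp add: that)
  define n where "n = nat \<lceil>\<bar>t\<bar> / e\<rceil>"
  have "real (Suc n) > \<bar>t\<bar> / e" unfolding n_def by linarith
  then have "\<bar>t / real (Suc n)\<bar> < e" using e by (simp add: field_simps)
  from eq[OF this] show "\<gamma> t = \<delta> t"
    using pow[OF car(1) hom(1), of n "t / real (Suc n)"] pow[OF car(2) hom(2), of n "t / real (Suc n)"] by simp
qed

locale lie =
  fixes G :: "('g, 'e::model_space) lie_group_data" (structure)
  assumes lie_group: "lie_group G"
begin

sublocale group G
  using lie_group by (simp add: lie_group_def)

abbreviation "A \<equiv> atlas G"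

lemma atl: "smooth_atlas A" and ptsA [simp]: "pts A = carrier G"
  using lie_group smooth_manifold_atlas by (auto simp: lie_group_def)

lemma proper: "proper_charts A"
  using atl by (rule smooth_atlas_proper)

lemma smooth_mult2: "a \<in> carrier G \<Longrightarrow> b \<in> carrier G \<Longrightarrow> smooth_at (prod_atlas A A) A (\<lambda>x. fst x \<otimes> snd x) (a, b)"
proof -
  assume "a \<in> carrier G" "b \<in> carrier G"
  moreover have "smooth_map (prod_atlas A A) A (\<lambda>x. fst x \<otimes> snd x)"
    using lie_group by (simp add: lie_group_def split_beta')
  ultimately show ?thesis
    by (intro smooth_map_smooth_at proper_charts_prod proper) auto
qed

lemma smooth_mult:
  assumes "proper_charts X" "smooth_at X A f p" "smooth_at X A g p"
  shows "smooth_at X A (\<lambda>x. f x \<otimes> g x) p"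
proof -
  have "f p \<in> carrier G" "g p \<in> carrier G" using smooth_at_pts(2)[OF assms(2)] smooth_at_pts(2)[OF assms(3)] by auto
  from smooth_at_compose[OF assms(1) proper_charts_prod[OF proper proper] smooth_mult2[OF this]
      smooth_at_Pair[OF assms(2,3)]]
  show ?thesis by simp
qed

lemma smooth_inv:
  assumes "proper_charts X" "smooth_at X A f p"
  shows "smooth_at X A (\<lambda>x. inv (f x)) p"
proof -
  have "smooth_at A A (\<lambda>x. inv x) (f p)"
    using lie_group smooth_at_pts(2)[OF assms(2)] by (intro smooth_map_smooth_at proper) (auto simp: lie_group_def)
  from smooth_at_compose[OF assms(1) proper this assms(2)] show ?thesis .
qed

lemma smooth_ident: "a \<in> carrier G \<Longrightarrow> smooth_at A A (\<lambda>x. x) a"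
  by (intro smooth_at_ident atl) simp

lemma smooth_constant: "proper_charts X \<Longrightarrow> p \<in> pts X \<Longrightarrow> a \<in> carrier G \<Longrightarrow> smooth_at X A (\<lambda>_. a) p"
  by (intro smooth_at_const) simp_all

lemma smooth_left: "a \<in> carrier G \<Longrightarrow> b \<in> carrier G \<Longrightarrow> smooth_at A A (\<lambda>x. a \<otimes> x) b"
  by (intro smooth_mult smooth_constant smooth_ident proper) auto

section \<open>Left-invariant fields and their integral curves\<close>

definition lfield :: "('g, 'e) tvec \<Rightarrow> 'g \<Rightarrow> ('g, 'e) tvec" where
  "lfield X a = tangent_map A A (\<lambda>y. a \<otimes> y) \<one> X"

context
  fixes X assumes X: "X \<in> tangent_space A \<one>"
begin

lemma lfield_in: "a \<in> carrier G \<Longrightarrow> lfield X a \<in> tangent_space A a"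
  using tangent_map_in[OF atl atl smooth_left[of a \<one>] X] by (simp add: lfield_def)

lemma lfield_one: "lfield X \<one> = X"
proof -
  have "tangent_map A A (\<lambda>y. \<one> \<otimes> y) \<one> = tangent_map A A (\<lambda>y. y) \<one>"
    by (rule tangent_map_cong_pts[OF proper]) auto
  then show ?thesis using tangent_map_ident[OF atl _ X] by (simp add: lfield_def)
qed

lemma lfield_left:
  assumes "a \<in> carrier G" "b \<in> carrier G"
  shows "tangent_map A A (\<lambda>y. b \<otimes> y) a (lfield X a) = lfield X (b \<otimes> a)"
proof -
  have "tangent_map A A (\<lambda>y. b \<otimes> (a \<otimes> y)) \<one> X = tangent_map A A (\<lambda>y. b \<otimes> y) (a \<otimes> \<one>) (lfield X a)"
    unfolding lfield_def by (rule tangent_map_compose[OF atl atl]) (use assms X in \<open>auto intro: smooth_left\<close>)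
  moreover have "tangent_map A A (\<lambda>y. b \<otimes> (a \<otimes> y)) \<one> = tangent_map A A (\<lambda>y. (b \<otimes> a) \<otimes> y) \<one>"
    by (rule tangent_map_cong_pts[OF proper]) (use assms in \<open>auto simp: m_assoc\<close>)
  ultimately show ?thesis using assms by (simp add: lfield_def)
qed

text \<open>The integral curve condition is imposed at single times, so that curves defined only
  near 0 can be total functions.\<close>

definition icurve :: "(real \<Rightarrow> 'g) \<Rightarrow> real \<Rightarrow> bool" where
  "icurve \<gamma> t \<longleftrightarrow> smooth_at real_atlas A \<gamma> t \<and> velocity A \<gamma> t = lfield X (\<gamma> t)"

lemma icurve_carrier: "icurve \<gamma> t \<Longrightarrow> \<gamma> t \<in> carrier G"
  using smooth_at_pts(2)[of real_atlas A \<gamma> t] by (simp add: icurve_def)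

lemma icurve_left:
  assumes "icurve \<gamma> t" "b \<in> carrier G"
  shows "icurve (\<lambda>s. b \<otimes> \<gamma> s) t"
proof -
  have s: "smooth_at real_atlas A \<gamma> t" and c: "\<gamma> t \<in> carrier G"
    using assms icurve_carrier by (auto simp: icurve_def)
  show ?thesis unfolding icurve_def
  proof
    show "smooth_at real_atlas A (\<lambda>s. b \<otimes> \<gamma> s) t"
      by (rule smooth_at_compose[OF proper_charts_real proper smooth_left[OF assms(2) c] s])
    show "velocity A (\<lambda>s. b \<otimes> \<gamma> s) t = lfield X (b \<otimes> \<gamma> t)"
      using velocity_compose[OF atl smooth_left[OF assms(2) c] s] assms(1) lfield_left[OF c assms(2)]
      by (simp add: icurve_def)
  qed
qed

lemma icurve_shift: "icurve \<gamma> (t + s) \<Longrightarrow> icurve (\<lambda>r. \<gamma> (r + s)) t"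
  using velocity_affine[OF atl, of \<gamma> 1 t s] by (simp add: icurve_def)

text \<open>At \<open>a\<close> the field is the partial tangent map of the multiplication in the
  second argument at the unit, so its coordinates depend smoothly on \<open>a\<close>.\<close>

lemma chart_field_smooth:
  assumes c: "c \<in> charts_at A \<one>"
  obtains V where "open V" "snd c \<one> \<in> V" "V \<subseteq> cran c" "smooth_on V (\<lambda>x. lfield X (cinv c x) c)"
proof -
  have i: "smooth_at A A (\<lambda>x. x) \<one>" by (simp add: smooth_ident)
  have k: "smooth_at A A (\<lambda>x. \<one>) \<one>" by (simp add: smooth_constant proper)
  have sm: "smooth_at (prod_atlas A A) A (\<lambda>x. fst x \<otimes> snd x) (x, y)" if "x \<in> pts A" "y \<in> pts A" for x y
    using that by (intro smooth_mult2) auto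
  have c2: "c \<in> charts_at A (fst (\<one>, \<one>) \<otimes> snd (\<one>, \<one>))" using c by simp
  obtain S where S: "open S" "snd c \<one> \<in> S" "S \<subseteq> cran c"
    and sm: "\<forall>T v. open T \<longrightarrow> T \<subseteq> S \<longrightarrow> (\<forall>x\<in>T. v x \<in> tangent_space A \<one>) \<longrightarrow> smooth_on T (\<lambda>x. v x c) \<longrightarrow>
      smooth_on T (\<lambda>x. tangent_map A A (\<lambda>y. fst (cinv c x, y) \<otimes> snd (cinv c x, y)) \<one> (v x) c)"
    using smooth_on_partial_tangent_map[OF atl atl proper sm i k c c c2] by blast
  from sm[rule_format, of S "\<lambda>_. X"] S X have "smooth_on S (\<lambda>x. lfield X (cinv c x) c)"
    by (simp add: lfield_def smooth_on_const)
  with S show thesis by (rule that)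
qed

text \<open>The field is integrated in a chart at the unit; smoothness of its coordinates passes to
  the solution.\<close>

lemma icurve_exists:
  obtains d \<gamma> where "d > 0" "\<gamma> 0 = \<one>" "\<And>t. \<bar>t\<bar> < d \<Longrightarrow> icurve \<gamma> t"
proof -
  have "\<one> \<in> pts A" by simp
  then obtain c where c: "c \<in> charts_at A \<one>" unfolding pts_iff by blast
  obtain V where V: "open V" "snd c \<one> \<in> V" "V \<subseteq> cran c" "smooth_on V (\<lambda>x. lfield X (cinv c x) c)"
    using chart_field_smooth[OF c] by blast
  obtain d y where y: "d > 0" "y 0 = snd c \<one>" "\<And>t. \<bar>t\<bar> < d \<Longrightarrow> y t \<in> V"
    "\<And>t. \<bar>t\<bar> < d \<Longrightarrow> (y has_vector_derivative lfield X (cinv c (y t)) c) (at t)"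
    using ode_solution_exists[OF V(1,2,4)] by blast
  let ?I = "{-d<..<d}"
  have I: "t \<in> ?I \<longleftrightarrow> \<bar>t\<bar> < d" for t by auto
  have ys: "smooth_on ?I y"
    by (rule ode_solution_smooth[OF V(1,4)]) (use y I in auto)
  define \<gamma> where "\<gamma> t = cinv c (y t)" for t
  have "icurve \<gamma> t" if t: "\<bar>t\<bar> < d" for t
  proof -
    have yc: "y s \<in> cran c" if "\<bar>s\<bar> < d" for s using y(3)[OF that] V(3) by blast
    have ct: "c \<in> charts_at A (\<gamma> t)"
      unfolding \<gamma>_def by (rule chart_cinv[OF _ yc[OF t]]) (use c in \<open>simp add: charts_at_iff\<close>)
    \<comment> \<open>Smoothness is checked in the single chart that carries the equation and is
      then transferred to the whole atlas.\<close>
    have "smooth_at real_atlas {c} \<gamma> t"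
      unfolding smooth_at_def
    proof (intro conjI ballI)
      show "t \<in> pts real_atlas" by simp
      show gt: "\<gamma> t \<in> pts {c}" using ct by (simp add: charts_at_iff)
      fix k d' assume k: "k \<in> charts_at real_atlas t" and "d' \<in> charts_at {c} (\<gamma> t)"
      then have d': "d' = c" by (auto simp: charts_at_def)
      have "smooth_on ?I (\<lambda>x. snd c (\<gamma> x))"
        by (rule smooth_on_cong[OF _ _ ys]) (use yc I in \<open>auto simp: \<gamma>_def\<close>)
      moreover have "\<gamma> x \<in> fst c" if "x \<in> ?I" for x
        using cinv_mem[OF yc] that I by (simp add: \<gamma>_def)
      ultimately show "\<exists>V. chart_nhd k t V \<and> (\<forall>x\<in>V. \<gamma> (cinv k x) \<in> fst d') \<and>
          smooth_on V (\<lambda>x. snd d' (\<gamma> (cinv k x)))"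
        using k t I d' by (intro exI[of _ ?I]) auto
    qed
    then have s: "smooth_at real_atlas A \<gamma> t"
      by (rule smooth_atI_target_chart[where f=\<gamma>, OF proper_charts_real atl ct])
    moreover have "velocity A \<gamma> t = lfield X (\<gamma> t)"
    proof (rule tangent_eqI[OF velocity_in[OF atl s] lfield_in ct])
      show "\<gamma> t \<in> carrier G" using smooth_at_pts(2)[OF s] by simp
      have "((\<lambda>s. snd c (\<gamma> s)) has_vector_derivative lfield X (\<gamma> t) c) (at t)"
        unfolding \<gamma>_def
        by (rule has_vector_derivative_transform_within_open[OF y(4)[OF t], of ?I]) (use yc I t in auto)
      then show "velocity A \<gamma> t c = lfield X (\<gamma> t) c"
        using vector_derivative_at velocity_has_vector_derivative[OF s ct] by metis
    qed
    ultimately show ?thesis by (simp add: icurve_def)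
  qed
  moreover have "\<gamma> 0 = \<one>" using y c proper by (simp add: \<gamma>_def cinv_chart)
  ultimately show thesis using that y(1) by blast
qed

text \<open>\<open>W\<close> is the preimage of a ball on which the coordinate field is Lipschitz.
  Integral curves that stay in \<open>W\<close> solve the same equation in the chart, and
  \<open>ode_unique\<close> covers the whole interval.\<close>

lemma icurve_unique_near_one:
  obtains W where "nhd A \<one> W"
    "\<And>d \<gamma> \<delta> t. \<lbrakk>\<And>t. \<bar>t\<bar> < d \<Longrightarrow> icurve \<gamma> t \<and> \<gamma> t \<in> W; \<And>t. \<bar>t\<bar> < d \<Longrightarrow> icurve \<delta> t \<and> \<delta> t \<in> W; \<gamma> 0 = \<delta> 0; \<bar>t\<bar> < d\<rbrakk>
      \<Longrightarrow> \<gamma> t = \<delta> t"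
proof -
  have "\<one> \<in> pts A" by simp
  then obtain c where c: "c \<in> charts_at A \<one>" unfolding pts_iff by blast
  obtain V where V: "open V" "snd c \<one> \<in> V" "V \<subseteq> cran c" "smooth_on V (\<lambda>x. lfield X (cinv c x) c)"
    using chart_field_smooth[OF c] by blast
  let ?F = "\<lambda>x. lfield X (cinv c x) c"
  obtain r L where r: "r > 0" "cball (snd c \<one>) r \<subseteq> V"
    and lip: "\<And>x y. x \<in> cball (snd c \<one>) r \<Longrightarrow> y \<in> cball (snd c \<one>) r \<Longrightarrow> norm (?F x - ?F y) \<le> L * norm (x - y)"
    using smooth_on_lipschitz_cball[OF V(1,2,4)] by metis
  let ?W = "fst c \<inter> snd c -` ball (snd c \<one>) r"
  have coord: "snd c (\<gamma> t) \<in> cball (snd c \<one>) r \<and> ((\<lambda>s. snd c (\<gamma> s)) has_vector_derivative ?F (snd c (\<gamma> t))) (at t)"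
    if g: "icurve \<gamma> t" "\<gamma> t \<in> ?W" for \<gamma> t
  proof -
    have ct: "c \<in> charts_at A (\<gamma> t)" using g c by (simp add: charts_at_iff)
    have "((\<lambda>s. snd c (\<gamma> s)) has_vector_derivative velocity A \<gamma> t c) (at t)"
      using g by (intro velocity_has_vector_derivative ct) (simp add: icurve_def)
    moreover have "velocity A \<gamma> t c = ?F (snd c (\<gamma> t))"
      using g cinv_chart[OF proper ct] by (simp add: icurve_def)
    moreover have "snd c (\<gamma> t) \<in> cball (snd c \<one>) r" using g by auto
    ultimately show ?thesis by simp
  qed
  show thesis
  proof (rule that)
    show "nhd A \<one> ?W" by (rule nhd_chart[OF atl c]) (use r in auto)
    fix d \<gamma> \<delta> and t :: real
    assume g: "\<And>t. \<bar>t\<bar> < d \<Longrightarrow> icurve \<gamma> t \<and> \<gamma> t \<in> ?W" and dl: "\<And>t. \<bar>t\<bar> < d \<Longrightarrow> icurve \<delta> t \<and> \<delta> t \<in> ?W"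
      and 0: "\<gamma> 0 = \<delta> 0" and t: "\<bar>t\<bar> < d"
    have "snd c (\<gamma> t) = snd c (\<delta> t)"
      by (rule ode_unique[where S="cball (snd c \<one>) r" and F="?F", OF lip _ _ _ t], simp_all only: 0)
        (use coord[of \<gamma>] coord[of \<delta>] g dl 0 in blast)+
    moreover have "inj_on (snd c) (fst c)" using proper c by (simp add: proper_charts_def charts_at_iff)
    ultimately show "\<gamma> t = \<delta> t" using g[OF t] dl[OF t] by (auto dest: inj_onD)
  qed
qed

section \<open>One-parameter subgroups\<close>

lemma nhd_real_abs:
  assumes "smooth_at real_atlas A \<gamma> 0" "nhd A (\<gamma> 0) W"
  obtains d where "d > 0" "\<And>t. \<bar>t\<bar> < d \<Longrightarrow> \<gamma> t \<in> W"
proof -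
  have "nhd real_atlas 0 (\<gamma> -` W)" by (rule nhd_vimage[OF proper_charts_real proper assms])
  then obtain V where "open V" "0 \<in> V" "\<forall>x\<in>V. \<gamma> x \<in> W" by (auto simp: nhd_def)
  moreover from this obtain d where "d > 0" "\<And>t. dist t 0 < d \<Longrightarrow> t \<in> V" unfolding open_dist by blast
  ultimately show thesis using that[of d] by (auto simp: dist_real_def)
qed

text \<open>Since \<open>\<gamma> r = \<gamma> t \<otimes> \<gamma> (r - t)\<close>, left-invariance
  carries the velocity condition from time 0 to time t.\<close>

lemma one_parameter_icurve:
  assumes "one_parameter_subgroup G \<gamma>" "velocity A \<gamma> 0 = X"
  shows "icurve \<gamma> t" "\<gamma> 0 = \<one>"
proof -
  have s: "smooth_at real_atlas A \<gamma> s" for s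
    using assms(1) by (intro smooth_map_smooth_at proper_charts_real) (auto simp: one_parameter_subgroup_def)
  have car: "\<gamma> s \<in> carrier G" for s using smooth_at_pts(2)[OF s] by simp
  have hom: "\<gamma> (s + r) = \<gamma> s \<otimes> \<gamma> r" for s r using assms(1) by (simp add: one_parameter_subgroup_def)
  show 0: "\<gamma> 0 = \<one>" using hom[of 0 0] car[of 0] by simp
  have "icurve \<gamma> 0" unfolding icurve_def using s assms(2) 0 lfield_one by simp
  then have "icurve \<gamma> (t + (- t))" by simp
  then have "icurve (\<lambda>r. \<gamma> (r + - t)) t" by (rule icurve_shift)
  then have "icurve (\<lambda>r. \<gamma> t \<otimes> \<gamma> (r + - t)) t" by (rule icurve_left[OF _ car])
  then show "icurve \<gamma> t" by (simp add: hom[symmetric])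
qed

text \<open>Both curves stay in \<open>W\<close> for small times and agree there as integral curves;
  the homomorphism law does the rest.\<close>

lemma one_parameter_unique:
  assumes "one_parameter_subgroup G \<gamma>" "velocity A \<gamma> 0 = X" "one_parameter_subgroup G \<delta>" "velocity A \<delta> 0 = X"
  shows "\<gamma> = \<delta>"
proof -
  obtain W where W: "nhd A \<one> W" and un:
    "\<And>d \<gamma> \<delta> t. \<lbrakk>\<And>t. \<bar>t\<bar> < d \<Longrightarrow> icurve \<gamma> t \<and> \<gamma> t \<in> W; \<And>t. \<bar>t\<bar> < d \<Longrightarrow> icurve \<delta> t \<and> \<delta> t \<in> W; \<gamma> 0 = \<delta> 0; \<bar>t\<bar> < d\<rbrakk>
      \<Longrightarrow> \<gamma> t = \<delta> t" using icurve_unique_near_one by blast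
  note g = one_parameter_icurve[OF assms(1,2)] and d = one_parameter_icurve[OF assms(3,4)]
  obtain d1 where d1: "d1 > 0" "\<And>t. \<bar>t\<bar> < d1 \<Longrightarrow> \<gamma> t \<in> W"
    using nhd_real_abs[of \<gamma> W] g W by (auto simp: icurve_def)
  obtain d2 where d2: "d2 > 0" "\<And>t. \<bar>t\<bar> < d2 \<Longrightarrow> \<delta> t \<in> W"
    using nhd_real_abs[of \<delta> W] d W by (auto simp: icurve_def)
  show ?thesis
  proof (rule one_parameter_eq[of "min d1 d2"])
    show "min d1 d2 > 0" using d1 d2 by simp
    show "\<gamma> t \<in> carrier G" "\<delta> t \<in> carrier G" for t using g d icurve_carrier by auto
    show "\<gamma> (s + t) = \<gamma> s \<otimes> \<gamma> t" "\<delta> (s + t) = \<delta> s \<otimes> \<delta> t" for s t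
      using assms by (auto simp: one_parameter_subgroup_def)
    show "\<gamma> t = \<delta> t" if "\<bar>t\<bar> < min d1 d2" for t
      by (rule un[of "min d1 d2"]) (use g d d1 d2 that in auto)
  qed
qed

text \<open>For small s the curves \<open>r \<mapsto> \<gamma> (r + s)\<close> and
  \<open>r \<mapsto> \<gamma> s \<otimes> \<gamma> r\<close> are integral curves with the same value
  at 0. Hence a local integral curve is a local homomorphism, and it extends to the line.\<close>

lemma one_parameter_exists: "\<exists>\<gamma>. one_parameter_subgroup G \<gamma> \<and> velocity A \<gamma> 0 = X"
proof -
  obtain W where W: "nhd A \<one> W" and un:
    "\<And>d \<gamma> \<delta> t. \<lbrakk>\<And>t. \<bar>t\<bar> < d \<Longrightarrow> icurve \<gamma> t \<and> \<gamma> t \<in> W; \<And>t. \<bar>t\<bar> < d \<Longrightarrow> icurve \<delta> t \<and> \<delta> t \<in> W; \<gamma> 0 = \<delta> 0; \<bar>t\<bar> < d\<rbrakk>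
      \<Longrightarrow> \<gamma> t = \<delta> t" using icurve_unique_near_one by blast
  obtain d \<gamma> where d: "d > 0" and g: "\<gamma> 0 = \<one>" "\<And>t. \<bar>t\<bar> < d \<Longrightarrow> icurve \<gamma> t"
    using icurve_exists by blast
  have s: "smooth_at real_atlas A \<gamma> t" if "\<bar>t\<bar> < d" for t using g(2)[OF that] by (simp add: icurve_def)
  obtain d1 where d1: "d1 > 0" "\<And>t. \<bar>t\<bar> < d1 \<Longrightarrow> \<gamma> t \<in> W"
    using nhd_real_abs[OF s] g W d by auto
  let ?R2 = "prod_atlas real_atlas real_atlas" and ?o = "(0, 0) :: real \<times> real"
  note R2 = proper_charts_prod[OF proper_charts_real proper_charts_real]
  have o: "?o \<in> pts ?R2" "fst ?o = 0" "snd ?o = 0" by simp_all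
  have s0: "smooth_at real_atlas A \<gamma> (fst ?o)" "smooth_at real_atlas A \<gamma> (snd ?o)" using s[of 0] d by simp_all
  \<comment> \<open>Continuity of this product at (0, 0) keeps
    \<open>\<gamma> s \<otimes> \<gamma> t\<close> in \<open>W\<close> for small times, as the local
    uniqueness demands.\<close>
  have "smooth_at ?R2 A (\<lambda>x. \<gamma> (fst x) \<otimes> \<gamma> (snd x)) ?o"
    by (rule smooth_mult[OF R2 smooth_at_compose[where f=fst and p="?o", OF R2 proper_charts_real s0(1)]
        smooth_at_compose[where f=snd and p="?o", OF R2 proper_charts_real s0(2)]])
      (rule smooth_at_fst[OF smooth_atlas_real proper_charts_real o(1)]
        smooth_at_snd[OF proper_charts_real smooth_atlas_real o(1)])+
  from nhd_vimage[OF R2 proper this] W g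
  have "nhd (prod_atlas real_atlas real_atlas) (0, 0) ((\<lambda>x. \<gamma> (fst x) \<otimes> \<gamma> (snd x)) -` W)" by simp
  then obtain V where V: "open V" "(0, 0) \<in> V" "\<forall>x\<in>V. cinv (pchart (UNIV, id) (UNIV, id)) x \<in> (\<lambda>x. \<gamma> (fst x) \<otimes> \<gamma> (snd x)) -` W"
    unfolding nhd_def charts_at_prod by auto
  have ci: "cinv (pchart (UNIV, id) (UNIV, id)) x = x" for x :: "real \<times> real"
    using cinv_pchart[of "(UNIV, id)" "(UNIV, id)" "fst x" "snd x"] by simp
  obtain P Q where PQ: "open P" "open Q" "0 \<in> P" "0 \<in> Q" "P \<times> Q \<subseteq> V"
    using open_prod_elim[OF V(1,2)] by (metis mem_Sigma_iff)
  then have "open (P \<inter> Q)" "0 \<in> P \<inter> Q" by auto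
  then obtain d2 where d2: "d2 > 0" "\<And>t. dist t 0 < d2 \<Longrightarrow> t \<in> P \<inter> Q" unfolding open_dist by blast
  have VW: "\<gamma> s \<otimes> \<gamma> t \<in> W" if "\<bar>s\<bar> < d2" "\<bar>t\<bar> < d2" for s t
  proof -
    have "(s, t) \<in> V" using that d2(2)[of s] d2(2)[of t] PQ(5) by (auto simp: dist_real_def)
    with V(3) ci show ?thesis by force
  qed
  \<comment> \<open>The factor 1/2 keeps \<open>s + t\<close> within the domain when both times are
    below \<open>e\<close>.\<close>
  define e where "e = min (min d d1) d2 / 2"
  have e: "e > 0" "2 * e \<le> d" "2 * e \<le> d1" "2 * e \<le> d2" using d d1 d2 by (auto simp: e_def)
  have car: "\<gamma> t \<in> carrier G" if "\<bar>t\<bar> < e" for t using that e by (intro icurve_carrier g) auto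
  have hom: "\<gamma> (s + t) = \<gamma> s \<otimes> \<gamma> t" if st: "\<bar>s\<bar> < e" "\<bar>t\<bar> < e" "\<bar>s + t\<bar> < e" for s t
  proof -
    have "(\<lambda>r. \<gamma> (r + s)) t = (\<lambda>r. \<gamma> s \<otimes> \<gamma> r) t"
    proof (rule un[of e])
      show "icurve (\<lambda>r. \<gamma> (r + s)) t \<and> \<gamma> (t + s) \<in> W" if "\<bar>t\<bar> < e" for t
        using that st e by (auto intro!: icurve_shift g d1(2))
      show "icurve (\<lambda>r. \<gamma> s \<otimes> \<gamma> r) t \<and> \<gamma> s \<otimes> \<gamma> t \<in> W" if "\<bar>t\<bar> < e" for t
        using that st e by (auto intro!: icurve_left g car VW)
      show "\<gamma> (0 + s) = \<gamma> s \<otimes> \<gamma> 0" using g car st by simp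
    qed (use st in auto)
    then show ?thesis by (simp add: add.commute)
  qed
  obtain \<Gamma> where "(\<forall>t. \<Gamma> t \<in> carrier G) \<and> (\<forall>s t. \<Gamma> (s + t) = \<Gamma> s \<otimes> \<Gamma> t) \<and> (\<forall>t. \<bar>t\<bar> < e \<longrightarrow> \<Gamma> t = \<gamma> t)"
    by (rule exE[OF local_one_parameter_extend[OF e(1) car hom]])
  then have G: "\<And>t. \<Gamma> t \<in> carrier G" "\<And>s t. \<Gamma> (s + t) = \<Gamma> s \<otimes> \<Gamma> t" "\<And>t. \<bar>t\<bar> < e \<Longrightarrow> \<Gamma> t = \<gamma> t"
    by auto
  have near: "nhd real_atlas t0 {t. \<gamma> (t + - t0) = \<Gamma> (t + - t0)}" for t0
    unfolding nhd_def using e(1) G(3)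
    by (auto intro!: exI[of _ "{t0 - e<..<t0 + e}"] simp: abs_less_iff)
  \<comment> \<open>Near \<open>t0\<close> the extension is \<open>\<Gamma> t0\<close> times a
    shifted copy of \<open>\<gamma>\<close>.\<close>
  have sm: "smooth_at real_atlas A \<Gamma> t0" for t0
  proof -
    have "smooth_at real_atlas A (\<lambda>t. \<gamma> (t + - t0)) t0"
      using velocity_affine(1)[OF atl, of \<gamma> 1 t0 "- t0"] s[of 0] d by simp
    from smooth_at_cong[OF proper_charts_real near this]
    have "smooth_at real_atlas A (\<lambda>t. \<Gamma> (t + - t0)) t0" .
    then have "smooth_at real_atlas A (\<lambda>t. \<Gamma> t0 \<otimes> \<Gamma> (t + - t0)) t0"
      by (intro smooth_mult smooth_constant proper_charts_real G) auto
    then show ?thesis by (simp add: G(2)[symmetric])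
  qed
  have "velocity A \<Gamma> 0 = velocity A \<gamma> 0"
    using tangent_map_cong[OF proper_charts_real _ near[of 0], where B=A] sm[of 0] s[of 0] d
    by (simp add: velocity_eq_tangent_map)
  also have "\<dots> = X" using g(2)[of 0] d g(1) lfield_one by (simp add: icurve_def)
  finally have "velocity A \<Gamma> 0 = X" .
  moreover have "one_parameter_subgroup G \<Gamma>"
    unfolding one_parameter_subgroup_def using sm G(2) by (auto intro!: smooth_mapI proper_charts_real)
  ultimately show ?thesis by blast
qed

end

text \<open>The curve \<open>r \<mapsto> \<gamma> (t * r)\<close> is the one-parameter subgroup with
  velocity \<open>t X\<close>, and its value at 1 is \<open>\<gamma> t\<close>.\<close>

lemma lie_exp_curve:
  assumes X: "X \<in> lie_algebra G"
  obtains \<gamma> where "smooth_at real_atlas A \<gamma> 0" "\<gamma> 0 = \<one>" "velocity A \<gamma> 0 = X"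
    "\<And>t. lie_exp G (\<lambda>c. t *\<^sub>R X c) = \<gamma> t"
proof -
  have X': "X \<in> tangent_space A \<one>" using X by (simp add: lie_algebra_def)
  obtain \<gamma> where g: "one_parameter_subgroup G \<gamma>" "velocity A \<gamma> 0 = X"
    using one_parameter_exists[OF X'] by blast
  have s: "smooth_at real_atlas A \<gamma> t" for t using one_parameter_icurve(1)[OF X' g] icurve_def[OF X'] by blast
  have "lie_exp G (\<lambda>c. t *\<^sub>R X c) = \<gamma> t" for t
  proof -
    let ?g = "\<lambda>r. \<gamma> (t * r)"
    have tX: "(\<lambda>c. t *\<^sub>R X c) \<in> tangent_space A \<one>" by (rule tangent_space_scale[OF atl _ X']) simp
    have sm: "smooth_at real_atlas A ?g r" for r using velocity_affine(1)[OF atl, of \<gamma> t r 0] s by simp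
    have "one_parameter_subgroup G ?g"
      unfolding one_parameter_subgroup_def using sm g(1)
      by (auto intro!: smooth_mapI proper_charts_real simp: one_parameter_subgroup_def distrib_left)
    moreover have "velocity A ?g 0 = (\<lambda>c. t *\<^sub>R X c)"
      using velocity_affine(2)[OF atl, of \<gamma> t 0 0] s[of 0] g(2) by simp
    ultimately have "(THE \<gamma>. one_parameter_subgroup G \<gamma> \<and> velocity A \<gamma> 0 = (\<lambda>c. t *\<^sub>R X c)) = ?g"
      using one_parameter_unique[OF tX] by (intro the_equality) auto
    then show ?thesis by (simp add: lie_exp_def)
  qed
  then show thesis using that[of \<gamma>] s g one_parameter_icurve(2)[OF X' g] by blast
qed

end

text \<open>Removes the exponential map: from here on a fundamental field is the tangent map of an
  orbit map.\<close>

lemma fundamental_field_eq: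
  assumes G: "lie_group G" and X: "X \<in> lie_algebra G"
    and s: "smooth_at (atlas G) (total P) (act P u) \<one>\<^bsub>G\<^esub>"
  shows "fundamental_field G P X u = tangent_map (atlas G) (total P) (act P u) \<one>\<^bsub>G\<^esub> X"
proof -
  interpret lie G by standard (rule G)
  obtain \<gamma> where g: "smooth_at real_atlas A \<gamma> 0" "\<gamma> 0 = \<one>\<^bsub>G\<^esub>" "velocity A \<gamma> 0 = X"
    "\<And>t. lie_exp G (\<lambda>c. t *\<^sub>R X c) = \<gamma> t" using lie_exp_curve[OF X] by metis
  show ?thesis
    unfolding fundamental_field_def g(4)
    using velocity_compose[OF atl, of "total P" "act P u" \<gamma> 0] s g by simp
qed


section \<open>Lie-algebra-valued forms\<close>

text \<open>Together with \<open>form_smooth_at\<close> this splits \<open>one_forms\<close> into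
  conditions at single points, so that forms meaningful over one trivialization only can be
  handled.\<close>

definition linear_form :: "('a, 'e::model_space) atlas \<Rightarrow> ('h, 'eh::model_space) lie_group_data \<Rightarrow>
    ('a \<Rightarrow> ('a, 'e) tvec \<Rightarrow> ('h, 'eh) tvec) \<Rightarrow> 'a \<Rightarrow> bool" where
  "linear_form A H \<alpha> p \<longleftrightarrow> (\<forall>v\<in>tangent_space A p. \<alpha> p v \<in> lie_algebra H) \<and>
     (\<forall>v\<in>tangent_space A p. \<forall>w\<in>tangent_space A p. \<forall>a b.
        \<alpha> p (\<lambda>c. a *\<^sub>R v c + b *\<^sub>R w c) = (\<lambda>d. a *\<^sub>R \<alpha> p v d + b *\<^sub>R \<alpha> p w d))"

text \<open>One neighbourhood serves all coordinate vectors \<open>w\<close>.\<close>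

definition form_smooth_at :: "('a, 'e::model_space) atlas \<Rightarrow> ('h, 'eh::model_space) lie_group_data \<Rightarrow>
    ('a \<Rightarrow> ('a, 'e) tvec \<Rightarrow> ('h, 'eh) tvec) \<Rightarrow> 'a \<Rightarrow> bool" where
  "form_smooth_at A H \<alpha> p \<longleftrightarrow> (\<forall>c\<in>charts_at A p. \<forall>d\<in>charts_at (atlas H) \<one>\<^bsub>H\<^esub>.
     \<exists>V. chart_nhd c p V \<and>
       (\<forall>w. smooth_on V (\<lambda>x. \<alpha> (cinv c x) (tangent_of A c (cinv c x) w) d)))"

lemma form_smooth_atD:
  assumes "form_smooth_at A H \<alpha> p" "c \<in> charts_at A p" "d \<in> charts_at (atlas H) \<one>\<^bsub>H\<^esub>"
  shows "\<exists>V. chart_nhd c p V \<and>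
    (\<forall>w. smooth_on V (\<lambda>x. \<alpha> (cinv c x) (tangent_of A c (cinv c x) w) d))"
  using bspec[OF bspec[OF assms(1)[unfolded form_smooth_at_def] assms(2)] assms(3)] .

lemma linear_formD:
  assumes "linear_form A H \<alpha> p"
  shows "v \<in> tangent_space A p \<Longrightarrow> \<alpha> p v \<in> lie_algebra H"
    and "v \<in> tangent_space A p \<Longrightarrow> w \<in> tangent_space A p \<Longrightarrow>
      \<alpha> p (\<lambda>c. a *\<^sub>R v c + b *\<^sub>R w c) = (\<lambda>d. a *\<^sub>R \<alpha> p v d + b *\<^sub>R \<alpha> p w d)"
  using assms unfolding linear_form_def by blast+

lemma linear_form_add:
  assumes "linear_form A H \<alpha> p" "v \<in> tangent_space A p" "w \<in> tangent_space A p"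
  shows "\<alpha> p (\<lambda>c. v c + w c) = (\<lambda>d. \<alpha> p v d + \<alpha> p w d)"
  using linear_formD(2)[OF assms, of 1 1] by simp

lemma linear_form_zero:
  assumes "smooth_atlas A" "p \<in> pts A" "linear_form A H \<alpha> p"
  shows "\<alpha> p (\<lambda>_. 0) = (\<lambda>_. 0)"
  using linear_formD(2)[OF assms(3) tangent_space_zero[OF assms(1,2)] tangent_space_zero[OF assms(1,2)], of 0 0] by simp

lemma one_forms_iff:
  assumes A: "smooth_atlas A"
  shows "\<alpha> \<in> one_forms A H \<longleftrightarrow> (\<forall>p\<in>pts A. linear_form A H \<alpha> p) \<and> (\<forall>p\<in>pts A. form_smooth_at A H \<alpha> p) \<and>
     (\<forall>p v. \<not> (p \<in> pts A \<and> v \<in> tangent_space A p) \<longrightarrow> \<alpha> p v = (\<lambda>_. 0))"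
proof -
  have "(\<forall>c\<in>A. \<forall>d\<in>charts_at (atlas H) \<one>\<^bsub>H\<^esub>. \<forall>w.
        smooth_on (snd c ` fst c) (\<lambda>x. let p = inv_into (fst c) (snd c) x in \<alpha> p (tangent_of A c p w) d)) \<longleftrightarrow>
      (\<forall>p\<in>pts A. form_smooth_at A H \<alpha> p)" (is "?L \<longleftrightarrow> ?R")
  proof
    assume L: ?L
    show ?R unfolding form_smooth_at_def
    proof (intro ballI)
      fix p c d assume c: "c \<in> charts_at A p" and d: "d \<in> charts_at (atlas H) \<one>\<^bsub>H\<^esub>"
      have "\<forall>w. smooth_on (cran c) (\<lambda>x. \<alpha> (cinv c x) (tangent_of A c (cinv c x) w) d)"
        using L c d by (auto simp: Let_def charts_at_iff)
      then show "\<exists>V. chart_nhd c p V \<and>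
          (\<forall>w. smooth_on V (\<lambda>x. \<alpha> (cinv c x) (tangent_of A c (cinv c x) w) d))"
        using c open_cran[OF smooth_atlas_proper[OF A] c]
        by (intro exI[of _ "cran c"]) (auto simp: charts_at_iff)
    qed
  next
    assume R: ?R
    show ?L unfolding Let_def
    proof (intro ballI allI)
      fix c d w assume c: "c \<in> A" and d: "d \<in> charts_at (atlas H) \<one>\<^bsub>H\<^esub>"
      show "smooth_on (cran c) (\<lambda>x. \<alpha> (cinv c x) (tangent_of A c (cinv c x) w) d)"
      proof (rule smooth_on_local)
        show "open (cran c)" using c smooth_atlas_proper[OF A] by (simp add: proper_charts_def)
        fix x assume x: "x \<in> cran c"
        have cx: "c \<in> charts_at A (cinv c x)" by (rule chart_cinv[OF c x])
        have fx: "form_smooth_at A H \<alpha> (cinv c x)" using R charts_at_pts[OF cx] by blast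
        obtain V where "open V" "snd c (cinv c x) \<in> V"
          "\<forall>w. smooth_on V (\<lambda>x. \<alpha> (cinv c x) (tangent_of A c (cinv c x) w) d)"
          using form_smooth_atD[OF fx cx d] by blast
        then show "\<exists>T. open T \<and> x \<in> T \<and> smooth_on T (\<lambda>x. \<alpha> (cinv c x) (tangent_of A c (cinv c x) w) d)"
          using snd_cinv[OF x] by auto
      qed
    qed
  qed
  then show ?thesis
    unfolding one_forms_def mem_Collect_eq linear_form_def ball_conj_distrib by (simp only: conj_assoc)
qed

lemma tangent_of_lin:
  assumes "smooth_atlas A" "c \<in> charts_at A p"
  shows "tangent_of A c p (a *\<^sub>R w + b *\<^sub>R w') = (\<lambda>d. a *\<^sub>R tangent_of A c p w d + b *\<^sub>R tangent_of A c p w' d)"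
  using assms
  by (intro tangent_eqI[OF tangent_of_in tangent_space_lin[OF _ charts_at_pts tangent_of_in tangent_of_in]])
    (auto simp: tangent_of_chart)

lemma linear_form_basis:
  assumes A: "smooth_atlas A" and l: "linear_form A H \<alpha> p" and c: "c \<in> charts_at A p" and v: "v \<in> tangent_space A p"
  shows "\<alpha> p v d = (\<Sum>b\<in>mbasis. (v c \<bullet> b) *\<^sub>R \<alpha> p (tangent_of A c p b) d)"
proof -
  have t: "tangent_of A c p w \<in> tangent_space A p" for w by (rule tangent_of_in[OF A c])
  have lin: "\<alpha> p (tangent_of A c p (a *\<^sub>R w + b *\<^sub>R w')) d =
      a *\<^sub>R \<alpha> p (tangent_of A c p w) d + b *\<^sub>R \<alpha> p (tangent_of A c p w') d" for a b w w'
    unfolding tangent_of_lin[OF A c] linear_formD(2)[OF l t t] by simp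
  have "linear (\<lambda>w. \<alpha> p (tangent_of A c p w) d)"
    using lin[of 1 _ 1] lin[of _ _ 0 0] by (intro linearI) auto
  from linear_mbasis[OF this, of "v c"] show ?thesis unfolding tangent_of_eq[OF v c] .
qed

text \<open>Expanding the vector along \<open>mbasis\<close> in the chart \<open>c\<close> leaves
  the coefficients of the form, composed with \<open>f\<close>, and the coordinates of the
  vector.\<close>

lemma form_smooth_on_vectors:
  assumes X: "proper_charts X" and A: "smooth_atlas A" and \<alpha>: "form_smooth_at A H \<alpha> (f p)"
    and l: "\<And>q. q \<in> pts A \<Longrightarrow> linear_form A H \<alpha> q" and f: "smooth_at X A f p"
    and k: "k \<in> charts_at X p" and c: "c \<in> charts_at A (f p)" and d: "d \<in> charts_at (atlas H) \<one>\<^bsub>H\<^esub>"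
  shows "\<exists>S. chart_nhd k p S \<and>
    (\<forall>T v. open T \<longrightarrow> T \<subseteq> S \<longrightarrow> (\<forall>x\<in>T. v x \<in> tangent_space A (f (cinv k x))) \<longrightarrow> smooth_on T (\<lambda>x. v x c) \<longrightarrow>
      smooth_on T (\<lambda>x. \<alpha> (f (cinv k x)) (v x) d))"
proof -
  note pA = smooth_atlas_proper[OF A]
  obtain V where V: "open V" "snd c (f p) \<in> V"
    and Vs: "\<forall>w. smooth_on V (\<lambda>x. \<alpha> (cinv c x) (tangent_of A c (cinv c x) w) d)"
    using form_smooth_atD[OF \<alpha> c d] by blast
  obtain U where U: "open U" "snd k p \<in> U" "U \<subseteq> cran k" "\<And>x. x \<in> U \<Longrightarrow> f (cinv k x) \<in> fst c"
    "smooth_on U (\<lambda>x. snd c (f (cinv k x)))" by (rule smooth_atD[OF f k c]) (rule that; blast)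
  let ?f = "\<lambda>x. snd c (f (cinv k x))"
  let ?S = "U \<inter> ?f -` V"
  show ?thesis
  proof (intro exI[of _ ?S] conjI allI impI)
    show "open ?S" by (rule continuous_open_preimage[OF smooth_on_continuous[OF U(5)] U(1) V(1)])
    show "snd k p \<in> ?S" using U(2) V(2) cinv_chart[OF X k] by simp
    show "?S \<subseteq> cran k" using U(3) by auto
    fix T v assume T: "open T" "T \<subseteq> ?S" and v: "\<forall>x\<in>T. v x \<in> tangent_space A (f (cinv k x))"
      and vc: "smooth_on T (\<lambda>x. v x c)"
    show "smooth_on T (\<lambda>x. \<alpha> (f (cinv k x)) (v x) d)"
    proof (rule smooth_on_cong[OF T(1)])
      have "smooth_on T (\<lambda>x. (\<lambda>y. \<alpha> (cinv c y) (tangent_of A c (cinv c y) b) d) (?f x))" for b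
        by (rule smooth_on_compose[OF T(1) V(1) _ smooth_on_subset[OF U(5)]]) (use T Vs in auto)
      then show "smooth_on T (\<lambda>x. \<Sum>b\<in>mbasis. (v x c \<bullet> b) *\<^sub>R
          \<alpha> (cinv c (?f x)) (tangent_of A c (cinv c (?f x)) b) d)"
        by (intro smooth_on_sum smooth_on_bilinear[OF bounded_bilinear_scaleR] T(1)
            smooth_on_bilinear[OF bounded_bilinear_inner] smooth_on_const vc) auto
      fix x assume x: "x \<in> T"
      have cx: "c \<in> charts_at A (f (cinv k x))" using U(4) x T c by (auto simp: charts_at_iff)
      show "(\<Sum>b\<in>mbasis. (v x c \<bullet> b) *\<^sub>R \<alpha> (cinv c (?f x)) (tangent_of A c (cinv c (?f x)) b) d) =
          \<alpha> (f (cinv k x)) (v x) d"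
        unfolding cinv_chart[OF pA cx]
        using linear_form_basis[OF A l[OF charts_at_pts[OF cx]] cx bspec[OF v x]] by simp
    qed
  qed
qed

lemma form_smooth_at_cong:
  assumes A: "smooth_atlas A" and near: "nhd A p {q. \<forall>v\<in>tangent_space A q. \<alpha> q v = \<beta> q v}" and \<alpha>: "form_smooth_at A H \<alpha> p"
  shows "form_smooth_at A H \<beta> p"
  unfolding form_smooth_at_def
proof (intro ballI)
  fix c d assume c: "c \<in> charts_at A p" and d: "d \<in> charts_at (atlas H) \<one>\<^bsub>H\<^esub>"
  obtain V where V: "open V" "snd c p \<in> V" "V \<subseteq> cran c"
    and Vs: "\<forall>w. smooth_on V (\<lambda>x. \<alpha> (cinv c x) (tangent_of A c (cinv c x) w) d)"
    using form_smooth_atD[OF \<alpha> c d] by blast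
  obtain W where W: "open W" "snd c p \<in> W" "\<forall>x\<in>W. \<forall>v\<in>tangent_space A (cinv c x). \<alpha> (cinv c x) v = \<beta> (cinv c x) v"
    using bspec[OF near[unfolded nhd_def] c] by auto
  have cx: "c \<in> charts_at A (cinv c x)" if "x \<in> V" for x
    using that V(3) c by (intro chart_cinv) (auto simp: charts_at_iff)
  have "smooth_on (V \<inter> W) (\<lambda>x. \<beta> (cinv c x) (tangent_of A c (cinv c x) w) d)" for w
  proof (rule smooth_on_cong[OF _ _ smooth_on_subset])
    show "open (V \<inter> W)" using V W by auto
    show "smooth_on V (\<lambda>x. \<alpha> (cinv c x) (tangent_of A c (cinv c x) w) d)" using Vs by blast
    show "\<alpha> (cinv c x) (tangent_of A c (cinv c x) w) d = \<beta> (cinv c x) (tangent_of A c (cinv c x) w) d"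
      if "x \<in> V \<inter> W" for x
      using W(3) tangent_of_in[OF A cx] that by auto
  qed auto
  then show "\<exists>V. chart_nhd c p V \<and>
      (\<forall>w. smooth_on V (\<lambda>x. \<beta> (cinv c x) (tangent_of A c (cinv c x) w) d))"
    using V W by (intro exI[of _ "V \<inter> W"]) auto
qed

text \<open>The coordinates of the tangent map on a coordinate field are a directional derivative of
  the local representative of \<open>f\<close>, hence smooth, and
  \<open>form_smooth_on_vectors\<close> applies.\<close>

lemma form_smooth_at_pullback:
  assumes A: "smooth_atlas A" and B: "smooth_atlas B" and \<alpha>: "form_smooth_at B H \<alpha> (f p)"
    and l: "\<And>q. q \<in> pts B \<Longrightarrow> linear_form B H \<alpha> q" and p: "p \<in> pts A" and f: "nhd A p {q. smooth_at A B f q}"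
  shows "form_smooth_at A H (\<lambda>q v. \<alpha> (f q) (tangent_map A B f q v)) p"
  unfolding form_smooth_at_def
proof (intro ballI)
  note pA = smooth_atlas_proper[OF A]
  have fp: "smooth_at A B f p" using nhd_memD[OF pA p f] by simp
  fix k d assume k: "k \<in> charts_at A p" and d: "d \<in> charts_at (atlas H) \<one>\<^bsub>H\<^esub>"
  obtain c where c: "c \<in> charts_at B (f p)" using smooth_at_pts[OF fp] by (auto simp: pts_iff)
  obtain S where S: "open S" "snd k p \<in> S" "S \<subseteq> cran k" and sm:
    "\<forall>T v. open T \<longrightarrow> T \<subseteq> S \<longrightarrow> (\<forall>x\<in>T. v x \<in> tangent_space B (f (cinv k x))) \<longrightarrow> smooth_on T (\<lambda>x. v x c) \<longrightarrow>
      smooth_on T (\<lambda>x. \<alpha> (f (cinv k x)) (v x) d)"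
    using form_smooth_on_vectors[OF pA B \<alpha> l fp k c d] by blast
  obtain W where W: "open W" "snd k p \<in> W" "\<forall>x\<in>W. smooth_at A B f (cinv k x)"
    using bspec[OF f[unfolded nhd_def] k] by auto
  obtain U where U: "open U" "snd k p \<in> U" "U \<subseteq> cran k" "\<And>x. x \<in> U \<Longrightarrow> f (cinv k x) \<in> fst c"
    "smooth_on U (\<lambda>x. snd c (f (cinv k x)))" by (rule smooth_atD[OF fp k c]) (rule that; blast)
  let ?T = "S \<inter> W \<inter> U"
  have T: "open ?T" using S W U by auto
  have kx: "k \<in> charts_at A (cinv k x)" if "x \<in> ?T" for x
    using that U(3) k by (intro chart_cinv) (auto simp: charts_at_iff)
  have cx: "c \<in> charts_at B (f (cinv k x))" if "x \<in> ?T" for x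
    using that U(4) c by (auto simp: charts_at_iff)
  have "smooth_on ?T (\<lambda>x. \<alpha> (f (cinv k x)) (tangent_map A B f (cinv k x) (tangent_of A k (cinv k x) w)) d)" for w
  proof (rule sm[rule_format, OF T])
    show "tangent_map A B f (cinv k x) (tangent_of A k (cinv k x) w) \<in> tangent_space B (f (cinv k x))" if "x \<in> ?T" for x
      using W(3) that by (intro tangent_map_in[OF A B _ tangent_of_in[OF A kx[OF that]]]) auto
    have "smooth_on ?T (\<lambda>x. frechet_derivative (\<lambda>x. snd c (f (cinv k x))) (at x) w)"
      by (rule smooth_on_frechet[OF smooth_on_subset[OF U(5)]]) auto
    moreover have "frechet_derivative (\<lambda>x. snd c (f (cinv k x))) (at x) w =
        tangent_map A B f (cinv k x) (tangent_of A k (cinv k x) w) c" if x: "x \<in> ?T" for x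
    proof -
      have xk: "x \<in> cran k" and fx: "smooth_at A B f (cinv k x)" using x U(3) W(3) by auto
      then show ?thesis
        using tangent_map_chart[OF A fx tangent_of_in[OF A kx[OF x]] kx[OF x] cx[OF x]]
          tangent_of_chart[OF A kx[OF x]] snd_cinv[of x k] by simp
    qed
    ultimately show "smooth_on ?T (\<lambda>x. tangent_map A B f (cinv k x) (tangent_of A k (cinv k x) w) c)"
      by (rule smooth_on_cong[OF T, rotated])
  qed auto
  then show "\<exists>V. chart_nhd k p V \<and>
      (\<forall>w. smooth_on V (\<lambda>x. \<alpha> (f (cinv k x)) (tangent_map A B f (cinv k x) (tangent_of A k (cinv k x) w)) d))"
    using T S W U by (intro exI[of _ ?T]) auto
qed

lemma linear_form_pullback:
  assumes A: "smooth_atlas A" and B: "smooth_atlas B" and l: "linear_form B H \<alpha> (f p)" and f: "smooth_at A B f p"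
  shows "linear_form A H (\<lambda>q v. \<alpha> (f q) (tangent_map A B f q v)) p"
  unfolding linear_form_def tangent_map_lin[OF f]
  using linear_formD[OF l] tangent_map_in[OF A B f] by simp

lemma form_smooth_at_add:
  assumes "form_smooth_at A H \<alpha> p" "form_smooth_at A H \<beta> p"
  shows "form_smooth_at A H (\<lambda>q v d. \<alpha> q v d + \<beta> q v d) p"
  unfolding form_smooth_at_def
proof (intro ballI)
  fix c d assume c: "c \<in> charts_at A p" and d: "d \<in> charts_at (atlas H) \<one>\<^bsub>H\<^esub>"
  obtain V where V: "open V" "snd c p \<in> V" "V \<subseteq> cran c"
    and Vs: "\<forall>w. smooth_on V (\<lambda>x. \<alpha> (cinv c x) (tangent_of A c (cinv c x) w) d)"
    using form_smooth_atD[OF assms(1) c d] by blast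
  obtain W where W: "open W" "snd c p \<in> W" "W \<subseteq> cran c"
    and Ws: "\<forall>w. smooth_on W (\<lambda>x. \<beta> (cinv c x) (tangent_of A c (cinv c x) w) d)"
    using form_smooth_atD[OF assms(2) c d] by blast
  have "smooth_on (V \<inter> W) (\<lambda>x. \<alpha> (cinv c x) (tangent_of A c (cinv c x) w) d + \<beta> (cinv c x) (tangent_of A c (cinv c x) w) d)" for w
    using V W by (intro smooth_on_add smooth_on_subset[OF spec[OF Vs]] smooth_on_subset[OF spec[OF Ws]]) auto
  then show "\<exists>V. chart_nhd c p V \<and> (\<forall>w. smooth_on V
      (\<lambda>x. \<alpha> (cinv c x) (tangent_of A c (cinv c x) w) d + \<beta> (cinv c x) (tangent_of A c (cinv c x) w) d))"
    using V W by (intro exI[of _ "V \<inter> W"]) auto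
qed


subsection \<open>The adjoint action and the Maurer-Cartan form\<close>

definition maurer_cartan :: "('h, 'e::model_space) lie_group_data \<Rightarrow> 'h \<Rightarrow> ('h, 'e) tvec \<Rightarrow> ('h, 'e) tvec" where
  "maurer_cartan H a = tangent_map (atlas H) (atlas H) (\<lambda>y. inv\<^bsub>H\<^esub> a \<otimes>\<^bsub>H\<^esub> y) a"

context lie
begin

lemma smooth_conj: "a \<in> carrier G \<Longrightarrow> b \<in> carrier G \<Longrightarrow> smooth_at A A (\<lambda>x. a \<otimes> x \<otimes> inv a) b"
  by (intro smooth_mult smooth_constant smooth_ident proper) auto

lemma smooth_right: "a \<in> carrier G \<Longrightarrow> b \<in> carrier G \<Longrightarrow> smooth_at A A (\<lambda>x. x \<otimes> a) b"
  by (intro smooth_mult smooth_constant smooth_ident proper) auto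

lemma lie_algebra_lin:
  "X \<in> lie_algebra G \<Longrightarrow> Y \<in> lie_algebra G \<Longrightarrow> (\<lambda>d. a *\<^sub>R X d + b *\<^sub>R Y d) \<in> lie_algebra G"
  unfolding lie_algebra_def by (intro tangent_space_lin atl) auto

lemma lie_algebra_add: "X \<in> lie_algebra G \<Longrightarrow> Y \<in> lie_algebra G \<Longrightarrow> (\<lambda>d. X d + Y d) \<in> lie_algebra G"
  using lie_algebra_lin[of X Y 1 1] by simp

lemma linear_form_sum:
  assumes "linear_form X G \<alpha> p" "linear_form X G \<beta> p"
  shows "linear_form X G (\<lambda>q v d. \<alpha> q v d + \<beta> q v d) p"
  unfolding linear_form_def
  using linear_formD[OF assms(1)] linear_formD[OF assms(2)]
  by (auto intro!: lie_algebra_add simp: algebra_simps)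

lemma Ad_in: "a \<in> carrier G \<Longrightarrow> X \<in> lie_algebra G \<Longrightarrow> Ad G a X \<in> lie_algebra G"
  using tangent_map_in[OF atl atl smooth_conj[of a \<one>], of X] by (simp add: Ad_def lie_algebra_def)

lemma Ad_lin: "a \<in> carrier G \<Longrightarrow> Ad G a (\<lambda>d. r *\<^sub>R X d + s *\<^sub>R Y d) = (\<lambda>d. r *\<^sub>R Ad G a X d + s *\<^sub>R Ad G a Y d)"
  unfolding Ad_def by (intro tangent_map_lin smooth_conj) auto

lemma Ad_add: "a \<in> carrier G \<Longrightarrow> Ad G a (\<lambda>d. X d + Y d) = (\<lambda>d. Ad G a X d + Ad G a Y d)"
  using Ad_lin[of a 1 X 1 Y] by simp

lemma Ad_zero: "a \<in> carrier G \<Longrightarrow> Ad G a (\<lambda>_. 0) = (\<lambda>_. 0)"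
  using Ad_lin[of a 0 "\<lambda>_. 0" 0 "\<lambda>_. 0"] by simp

lemma Ad_one: "X \<in> lie_algebra G \<Longrightarrow> Ad G \<one> X = X"
proof -
  assume X: "X \<in> lie_algebra G"
  have "tangent_map A A (\<lambda>x. \<one> \<otimes> x \<otimes> inv \<one>) \<one> = tangent_map A A (\<lambda>x. x) \<one>"
    by (rule tangent_map_cong_pts[OF proper]) auto
  then show ?thesis using tangent_map_ident[OF atl, of \<one> X] X by (simp add: Ad_def lie_algebra_def)
qed

lemma Ad_mult:
  assumes "a \<in> carrier G" "b \<in> carrier G" "X \<in> lie_algebra G"
  shows "Ad G (a \<otimes> b) X = Ad G a (Ad G b X)"
proof -
  have "tangent_map A A (\<lambda>x. a \<otimes> (b \<otimes> x \<otimes> inv b) \<otimes> inv a) \<one> X =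
      tangent_map A A (\<lambda>x. a \<otimes> x \<otimes> inv a) (b \<otimes> \<one> \<otimes> inv b) (Ad G b X)"
    unfolding Ad_def
    by (rule tangent_map_compose[OF atl atl smooth_conj smooth_conj]) (use assms in \<open>auto simp: lie_algebra_def\<close>)
  moreover have "tangent_map A A (\<lambda>x. a \<otimes> (b \<otimes> x \<otimes> inv b) \<otimes> inv a) \<one> = tangent_map A A (\<lambda>x. (a \<otimes> b) \<otimes> x \<otimes> inv (a \<otimes> b)) \<one>"
    by (rule tangent_map_cong_pts[OF proper]) (use assms in \<open>auto simp: m_assoc inv_mult_group\<close>)
  ultimately show ?thesis using assms by (simp add: Ad_def)
qed

lemma maurer_cartan_in: "a \<in> carrier G \<Longrightarrow> v \<in> tangent_space A a \<Longrightarrow> maurer_cartan G a v \<in> lie_algebra G"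
  using tangent_map_in[OF atl atl smooth_left[of "inv a" a], of v] by (simp add: maurer_cartan_def lie_algebra_def)

lemma maurer_cartan_linear: "a \<in> carrier G \<Longrightarrow> linear_form A G (maurer_cartan G) a"
  unfolding linear_form_def
  by (auto simp: maurer_cartan_in) (simp add: maurer_cartan_def tangent_map_lin[OF smooth_left])

lemma maurer_cartan_left:
  assumes "a \<in> carrier G" "Y \<in> lie_algebra G"
  shows "maurer_cartan G a (tangent_map A A (\<lambda>y. a \<otimes> y) \<one> Y) = Y"
proof -
  have Y: "Y \<in> tangent_space A \<one>" using assms(2) by (simp add: lie_algebra_def)
  have "tangent_map A A (\<lambda>y. inv a \<otimes> (a \<otimes> y)) \<one> Y =
      tangent_map A A (\<lambda>y. inv a \<otimes> y) (a \<otimes> \<one>) (tangent_map A A (\<lambda>y. a \<otimes> y) \<one> Y)"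
    by (rule tangent_map_compose[OF atl atl smooth_left smooth_left Y]) (use assms in auto)
  moreover have "tangent_map A A (\<lambda>y. inv a \<otimes> (a \<otimes> y)) \<one> = tangent_map A A (\<lambda>y. y) \<one>"
    by (rule tangent_map_cong_pts[OF proper]) (use assms in \<open>auto simp: m_assoc[symmetric]\<close>)
  ultimately show ?thesis
    using assms(1) tangent_map_ident[OF atl _ Y] by (simp add: maurer_cartan_def)
qed

text \<open>Differentiates \<open>(a b)^-1 (y b) = b^-1 (a^-1 y) b\<close> at
  \<open>y = a\<close>.\<close>

lemma maurer_cartan_right:
  assumes a: "a \<in> carrier G" and b: "b \<in> carrier G" and v: "v \<in> tangent_space A a"
  shows "maurer_cartan G (a \<otimes> b) (tangent_map A A (\<lambda>y. y \<otimes> b) a v) = Ad G (inv b) (maurer_cartan G a v)"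
proof -
  have "tangent_map A A (\<lambda>y. inv (a \<otimes> b) \<otimes> (y \<otimes> b)) a v =
      tangent_map A A (\<lambda>y. inv (a \<otimes> b) \<otimes> y) (a \<otimes> b) (tangent_map A A (\<lambda>y. y \<otimes> b) a v)"
    by (rule tangent_map_compose[OF atl atl smooth_left smooth_right v]) (use a b in auto)
  moreover have "tangent_map A A (\<lambda>y. inv b \<otimes> (inv a \<otimes> y) \<otimes> inv (inv b)) a v =
      tangent_map A A (\<lambda>y. inv b \<otimes> y \<otimes> inv (inv b)) (inv a \<otimes> a) (tangent_map A A (\<lambda>y. inv a \<otimes> y) a v)"
    by (rule tangent_map_compose[OF atl atl smooth_conj smooth_left v]) (use a b in auto)
  moreover have "tangent_map A A (\<lambda>y. inv (a \<otimes> b) \<otimes> (y \<otimes> b)) a =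
      tangent_map A A (\<lambda>y. inv b \<otimes> (inv a \<otimes> y) \<otimes> inv (inv b)) a"
    by (rule tangent_map_cong_pts[OF proper]) (use a b in \<open>auto simp: m_assoc inv_mult_group\<close>)
  ultimately show ?thesis using a b by (simp add: maurer_cartan_def Ad_def)
qed

text \<open>The form is the partial tangent map of \<open>(x, y) \<mapsto> x^-1 y\<close> in
  \<open>y\<close> along the diagonal.\<close>

lemma maurer_cartan_smooth:
  assumes a: "a \<in> carrier G"
  shows "form_smooth_at A G (maurer_cartan G) a"
  unfolding form_smooth_at_def
proof (intro ballI)
  fix c d assume c: "c \<in> charts_at A a" and d: "d \<in> charts_at A \<one>"
  let ?m = "\<lambda>z. inv (fst z) \<otimes> snd z"
  note P = proper_charts_prod[OF proper proper]
  have m: "smooth_at (prod_atlas A A) A ?m (x, y)" if "x \<in> pts A" "y \<in> pts A" for x y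
    using that by (intro smooth_mult smooth_inv P smooth_at_fst smooth_at_snd atl proper) auto
  have d': "d \<in> charts_at A (?m (a, a))" using d a by simp
  obtain S where S: "open S" "snd c a \<in> S" "S \<subseteq> cran c"
    and sm: "\<forall>T v. open T \<longrightarrow> T \<subseteq> S \<longrightarrow> (\<forall>x\<in>T. v x \<in> tangent_space A (cinv c x)) \<longrightarrow> smooth_on T (\<lambda>x. v x c) \<longrightarrow>
      smooth_on T (\<lambda>x. tangent_map A A (\<lambda>y. ?m (cinv c x, y)) (cinv c x) (v x) d)"
    using smooth_on_partial_tangent_map[OF atl atl proper m smooth_ident[OF a] smooth_ident[OF a] c c d'] by blast
  have cx: "c \<in> charts_at A (cinv c x)" if "x \<in> S" for x
    using that S(3) c by (intro chart_cinv) (auto simp: charts_at_iff)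
  have "smooth_on S (\<lambda>x. tangent_map A A (\<lambda>y. ?m (cinv c x, y)) (cinv c x) (tangent_of A c (cinv c x) w) d)" for w
  proof (rule sm[rule_format, OF S(1) subset_refl])
    show "tangent_of A c (cinv c x) w \<in> tangent_space A (cinv c x)" if "x \<in> S" for x
      by (rule tangent_of_in[OF atl cx[OF that]])
    show "smooth_on S (\<lambda>x. tangent_of A c (cinv c x) w c)"
      by (rule smooth_on_cong[OF S(1) _ smooth_on_const]) (simp add: tangent_of_chart[OF atl cx])
  qed
  then show "\<exists>V. chart_nhd c a V \<and>
      (\<forall>w. smooth_on V (\<lambda>x. maurer_cartan G (cinv c x) (tangent_of A c (cinv c x) w) d))"
    using S by (intro exI[of _ S]) (auto simp: maurer_cartan_def)
qed

lemma linear_form_Ad: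
  assumes "a p \<in> carrier G" "linear_form X G \<alpha> p"
  shows "linear_form X G (\<lambda>q v. Ad G (a q) (\<alpha> q v)) p"
  unfolding linear_form_def using linear_formD[OF assms(2)] assms(1) by (simp add: Ad_in Ad_lin)

text \<open>\<open>Ad\<close> is the partial tangent map of \<open>(x, y) \<mapsto> x y x^-1\<close>
  in \<open>y\<close> at the unit, here with \<open>x = a q\<close> and applied to the values of
  \<open>\<alpha>\<close>. Linearity of \<open>\<alpha>\<close> nearby provides that these values
  lie in the Lie algebra.\<close>

lemma form_smooth_at_Ad:
  assumes X: "smooth_atlas X" and a: "smooth_at X A a p" and \<alpha>: "form_smooth_at X G \<alpha> p"
    and l: "nhd X p {q. linear_form X G \<alpha> q}"
  shows "form_smooth_at X G (\<lambda>q v. Ad G (a q) (\<alpha> q v)) p"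
  unfolding form_smooth_at_def
proof (intro ballI)
  fix c d assume c: "c \<in> charts_at X p" and d: "d \<in> charts_at A \<one>"
  let ?m = "\<lambda>z. fst z \<otimes> snd z \<otimes> inv (fst z)"
  note P = proper_charts_prod[OF proper proper] and pX = smooth_atlas_proper[OF X]
  have p: "p \<in> pts X" and ap: "a p \<in> carrier G" using smooth_at_pts[OF a] by auto
  have m: "smooth_at (prod_atlas A A) A ?m (x, y)" if "x \<in> pts A" "y \<in> pts A" for x y
    using that by (intro smooth_mult smooth_inv P smooth_at_fst smooth_at_snd atl proper) auto
  have d': "d \<in> charts_at A (?m (a p, \<one>))" using d ap by simp
  obtain S where S: "open S" "snd c p \<in> S" "S \<subseteq> cran c"
    and sm: "\<forall>T v. open T \<longrightarrow> T \<subseteq> S \<longrightarrow> (\<forall>x\<in>T. v x \<in> tangent_space A \<one>) \<longrightarrow> smooth_on T (\<lambda>x. v x d) \<longrightarrow>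
      smooth_on T (\<lambda>x. tangent_map A A (\<lambda>y. ?m (a (cinv c x), y)) \<one> (v x) d)"
    using smooth_on_partial_tangent_map[OF atl atl pX m a smooth_constant[OF pX p one_closed] c d d'] by blast
  obtain V where V: "open V" "snd c p \<in> V" "V \<subseteq> cran c"
    and Vs: "\<forall>w. smooth_on V (\<lambda>x. \<alpha> (cinv c x) (tangent_of X c (cinv c x) w) d)"
    using form_smooth_atD[OF \<alpha> c d] by blast
  obtain W where W: "open W" "snd c p \<in> W" "\<forall>x\<in>W. linear_form X G \<alpha> (cinv c x)"
    using bspec[OF l[unfolded nhd_def] c] by auto
  let ?T = "S \<inter> V \<inter> W"
  have T: "open ?T" using S V W by auto
  have cx: "c \<in> charts_at X (cinv c x)" if "x \<in> ?T" for x
    using that S(3) c by (intro chart_cinv) (auto simp: charts_at_iff)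
  have "smooth_on ?T (\<lambda>x. tangent_map A A (\<lambda>y. ?m (a (cinv c x), y)) \<one>
      (\<alpha> (cinv c x) (tangent_of X c (cinv c x) w)) d)" for w
  proof (rule sm[rule_format, OF T])
    show "\<alpha> (cinv c x) (tangent_of X c (cinv c x) w) \<in> tangent_space A \<one>" if "x \<in> ?T" for x
      using linear_formD(1)[OF bspec[OF W(3)] tangent_of_in[OF X cx]] that by (auto simp: lie_algebra_def)
    show "smooth_on ?T (\<lambda>x. \<alpha> (cinv c x) (tangent_of X c (cinv c x) w) d)"
      by (rule smooth_on_subset[OF spec[OF Vs]]) auto
  qed auto
  then show "\<exists>V. chart_nhd c p V \<and>
      (\<forall>w. smooth_on V (\<lambda>x. Ad G (a (cinv c x)) (\<alpha> (cinv c x) (tangent_of X c (cinv c x) w)) d))"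
    using T S V W by (intro exI[of _ ?T]) (auto simp: Ad_def)
qed

end


section \<open>The associated bundle\<close>

locale principal_extension =
  fixes G :: "('h, 'eg::model_space) lie_group_data"
    and H :: "('h, 'eh::model_space) lie_group_data"
    and P :: "('p, 'ep::model_space, 'm, 'em::model_space, 'h) bundle_data"
  assumes principal: "principal_bundle G P" and sub: "lie_subgroup G H"
begin

sublocale gl: lie G
  using principal by unfold_locales (simp add: principal_bundle_def)

sublocale hl: lie H
  using sub by unfold_locales (simp add: lie_subgroup_def)

abbreviation "T \<equiv> total P"
abbreviation "M \<equiv> base P"
abbreviation "L \<equiv> atlas G"
abbreviation "K \<equiv> atlas H"
abbreviation "Q \<equiv> assoc_atlas G H P"
abbreviation "MK \<equiv> prod_atlas M K"
abbreviation "PH \<equiv> assoc_space G H P"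
abbreviation mulH :: "'h \<Rightarrow> 'h \<Rightarrow> 'h" (infixl "\<cdot>" 70) where "a \<cdot> b \<equiv> a \<otimes>\<^bsub>H\<^esub> b"
abbreviation oneH :: 'h ("\<ee>") where "\<ee> \<equiv> \<one>\<^bsub>H\<^esub>"
abbreviation "invH \<equiv> \<lambda>a. inv\<^bsub>H\<^esub> a"
abbreviation "pr \<equiv> proj P"
abbreviation "bp \<equiv> assoc_base_point P"
abbreviation trv :: "('p \<Rightarrow> 'h) \<Rightarrow> ('p \<times> 'h) set \<Rightarrow> 'm \<times> 'h" where "trv \<equiv> assoc_triv H P"
abbreviation triv :: "('m set \<times> ('p \<Rightarrow> 'h)) set" where "triv \<equiv> local_trivializations G P"

lemma sub_carrier: "g \<in> carrier G \<Longrightarrow> g \<in> carrier H"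
  using sub subgroup.subset unfolding lie_subgroup_def by blast

lemma mult_eq: "a \<in> carrier G \<Longrightarrow> b \<in> carrier G \<Longrightarrow> a \<otimes>\<^bsub>G\<^esub> b = a \<cdot> b"
  using sub by (simp add: lie_subgroup_def)

lemma one_eq: "\<one>\<^bsub>G\<^esub> = \<ee>"
proof -
  have "\<one>\<^bsub>G\<^esub> \<cdot> \<one>\<^bsub>G\<^esub> = \<one>\<^bsub>G\<^esub>" by (simp add: mult_eq[symmetric])
  then show ?thesis using hl.l_cancel_one'[of "\<one>\<^bsub>G\<^esub>" "\<one>\<^bsub>G\<^esub>"] sub_carrier by simp
qed

lemma inv_eq: "a \<in> carrier G \<Longrightarrow> inv\<^bsub>G\<^esub> a = invH a"
  using hl.inv_equality[of "inv\<^bsub>G\<^esub> a" a] mult_eq[of "inv\<^bsub>G\<^esub> a" a] one_eq by (simp add: sub_carrier)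

lemma incl_smooth: "g \<in> carrier G \<Longrightarrow> smooth_at L K (\<lambda>x. x) g"
  using sub by (intro smooth_map_smooth_at gl.proper) (auto simp: lie_subgroup_def)

lemma atlT: "smooth_atlas T" and atlM: "smooth_atlas M"
  using principal by (auto simp: principal_bundle_def smooth_manifold_atlas)

lemma properT: "proper_charts T" and properM: "proper_charts M"
  using atlT atlM by (auto simp: smooth_atlas_proper)

lemma atlMK: "smooth_atlas MK"
  by (rule smooth_atlas_prod[OF atlM hl.atl])

lemma properMK: "proper_charts MK"
  using atlMK by (rule smooth_atlas_proper)

lemma proj_smooth: "u \<in> pts T \<Longrightarrow> smooth_at T M pr u"
  using principal by (intro smooth_map_smooth_at properT) (auto simp: principal_bundle_def)

lemma act_smooth2:
  assumes "u \<in> pts T" "g \<in> carrier G"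
  shows "smooth_at (prod_atlas T L) T (\<lambda>x. act P (fst x) (snd x)) (u, g)"
  using principal assms
  by (intro smooth_map_smooth_at proper_charts_prod properT gl.proper) (auto simp: principal_bundle_def split_beta')

lemma act_smooth:
  assumes X: "proper_charts X" and f: "smooth_at X T f p" and g: "smooth_at X L g p"
  shows "smooth_at X T (\<lambda>x. act P (f x) (g x)) p"
proof -
  have "f p \<in> pts T" "g p \<in> carrier G" using smooth_at_pts(2)[OF f] smooth_at_pts(2)[OF g] by auto
  from smooth_at_compose[OF X proper_charts_prod[OF properT gl.proper] act_smooth2[OF this] smooth_at_Pair[OF f g]]
  show ?thesis by simp
qed

lemma act_in: "u \<in> pts T \<Longrightarrow> g \<in> carrier G \<Longrightarrow> act P u g \<in> pts T"
  using smooth_at_pts(2)[OF act_smooth2] by simp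

lemma act_one: "u \<in> pts T \<Longrightarrow> act P u \<one>\<^bsub>G\<^esub> = u"
  using principal by (simp add: principal_bundle_def)

lemma act_act: "u \<in> pts T \<Longrightarrow> a \<in> carrier G \<Longrightarrow> b \<in> carrier G \<Longrightarrow> act P (act P u a) b = act P u (a \<otimes>\<^bsub>G\<^esub> b)"
  using principal by (simp add: principal_bundle_def)

lemma proj_in: "u \<in> pts T \<Longrightarrow> pr u \<in> pts M"
  using smooth_at_pts(2)[OF proj_smooth] .

lemma triv_exists:
  assumes "x \<in> pts M"
  obtains U \<tau> where "(U, \<tau>) \<in> triv" "x \<in> U"
  using principal assms unfolding principal_bundle_def by blast


subsection \<open>Local sections\<close>

definition sec :: "'m set \<Rightarrow> ('p \<Rightarrow> 'h) \<Rightarrow> 'm \<Rightarrow> 'p" where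
  "sec U \<tau> x = inv_into (pts T \<inter> pr -` U) (\<lambda>u. (pr u, \<tau> u)) (x, \<one>\<^bsub>G\<^esub>)"

context
  fixes U \<tau> assumes t: "(U, \<tau>) \<in> triv"
begin

lemma triv_open: "mopen M U"
  using t by (simp add: local_trivializations_def)

lemma triv_sub: "x \<in> U \<Longrightarrow> x \<in> pts M"
  using triv_open by (auto simp: mopen_def)

lemma triv_nhd: "x \<in> U \<Longrightarrow> nhd M x U"
  using mopen_nhd[OF properM triv_open] .

lemma triv_diffeo: "diffeomorphism (restrict_atlas T (pr -` U)) (prod_atlas (restrict_atlas M U) L) (\<lambda>u. (pr u, \<tau> u))"
  using t by (simp add: local_trivializations_def)

lemma triv_bij: "bij_betw (\<lambda>u. (pr u, \<tau> u)) (pts T \<inter> pr -` U) (U \<times> carrier G)"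
proof -
  have "pts M \<inter> U = U" using triv_sub by auto
  then show ?thesis using triv_diffeo by (simp add: diffeomorphism_def)
qed

lemma tau_in: "u \<in> pts T \<Longrightarrow> pr u \<in> U \<Longrightarrow> \<tau> u \<in> carrier G"
  using bij_betwE[OF triv_bij] by auto

lemma tau_act: "u \<in> pts T \<Longrightarrow> pr u \<in> U \<Longrightarrow> g \<in> carrier G \<Longrightarrow> \<tau> (act P u g) = \<tau> u \<otimes>\<^bsub>G\<^esub> g"
  and proj_act_triv: "u \<in> pts T \<Longrightarrow> pr u \<in> U \<Longrightarrow> g \<in> carrier G \<Longrightarrow> pr (act P u g) = pr u"
  using t by (auto simp: local_trivializations_def)

lemma triv_inj:
  assumes "u \<in> pts T" "v \<in> pts T" "pr u \<in> U" "pr u = pr v" "\<tau> u = \<tau> v"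
  shows "u = v"
  using bij_betw_imp_inj_on[OF triv_bij] assms by (auto simp: inj_on_def)

lemma sec_props:
  assumes "x \<in> U"
  shows "sec U \<tau> x \<in> pts T" "pr (sec U \<tau> x) = x" "\<tau> (sec U \<tau> x) = \<one>\<^bsub>G\<^esub>"
proof -
  have x: "(x, \<one>\<^bsub>G\<^esub>) \<in> (\<lambda>u. (pr u, \<tau> u)) ` (pts T \<inter> pr -` U)"
    using bij_betw_imp_surj_on[OF triv_bij] assms by simp
  show "sec U \<tau> x \<in> pts T" "pr (sec U \<tau> x) = x" "\<tau> (sec U \<tau> x) = \<one>\<^bsub>G\<^esub>"
    using inv_into_into[OF x] f_inv_into_f[OF x] by (auto simp: sec_def)
qed

text \<open>Both sides have the same projection and the same fibre coordinate. This factorization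
  later splits a tangent vector of P into a part along the section and a part along the
  orbit.\<close>

lemma sec_act:
  assumes "u \<in> pts T" "pr u \<in> U"
  shows "act P (sec U \<tau> (pr u)) (\<tau> u) = u"
  using assms sec_props[OF assms(2)] tau_in[OF assms]
  by (intro triv_inj) (auto simp: act_in proj_act_triv tau_act)

lemma smooth_at_triv_target:
  assumes "smooth_at X (prod_atlas (restrict_atlas M U) L) f p"
  shows "smooth_at X (prod_atlas M L) f p"
  using smooth_at_into_restrict[OF assms[unfolded prod_atlas_restrict]] .

lemma triv_nhd_total: "u \<in> pts T \<Longrightarrow> pr u \<in> U \<Longrightarrow> nhd T u (pr -` U)"
  by (intro nhd_vimage[OF properT properM] proj_smooth triv_nhd) auto

text \<open>The trivialization is given between restricted atlases; the restrictions are removed on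
  both sides before projecting to the fibre coordinate.\<close>

lemma tau_smooth:
  assumes u: "u \<in> pts T" "pr u \<in> U"
  shows "smooth_at T L \<tau> u"
proof -
  have "smooth_at (restrict_atlas T (pr -` U)) (prod_atlas (restrict_atlas M U) L) (\<lambda>u. (pr u, \<tau> u)) u"
    using triv_diffeo u triv_nhd_total
    by (intro smooth_map_smooth_at proper_charts_restrict properT) (auto simp: diffeomorphism_def)
  from smooth_at_from_restrict[OF properT smooth_at_triv_target[OF this]]
  have s: "smooth_at T (prod_atlas M L) (\<lambda>u. (pr u, \<tau> u)) u" .
  have "smooth_at (prod_atlas M L) L snd (pr u, \<tau> u)"
    using u tau_in triv_sub by (intro smooth_at_snd properM gl.atl) auto
  from smooth_at_compose[where f="\<lambda>u. (pr u, \<tau> u)", OF properT proper_charts_prod[OF properM gl.proper] this s]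
  show ?thesis by simp
qed

lemma sec_smooth:
  assumes x: "x \<in> U"
  shows "smooth_at M T (sec U \<tau>) x"
proof -
  let ?inv = "inv_into (pts T \<inter> pr -` U) (\<lambda>u. (pr u, \<tau> u))"
  have pm: "proper_charts (prod_atlas (restrict_atlas M U) L)"
    by (intro proper_charts_prod gl.proper proper_charts_restrict properM triv_nhd)
  have "smooth_at (prod_atlas (restrict_atlas M U) L) (restrict_atlas T (pr -` U)) ?inv (x, \<one>\<^bsub>G\<^esub>)"
    using triv_diffeo x triv_sub by (intro smooth_map_smooth_at pm) (auto simp: diffeomorphism_def)
  from smooth_at_into_restrict[OF this]
  have "smooth_at (restrict_atlas (prod_atlas M L) (U \<times> UNIV)) T ?inv (x, \<one>\<^bsub>G\<^esub>)"
    unfolding prod_atlas_restrict .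
  from smooth_at_from_restrict[OF proper_charts_prod[OF properM gl.proper] this]
  have i: "smooth_at (prod_atlas M L) T ?inv (x, \<one>\<^bsub>G\<^esub>)" .
  have "smooth_at M (prod_atlas M L) (\<lambda>y. (y, \<one>\<^bsub>G\<^esub>)) x"
    using x triv_sub by (intro smooth_at_Pair smooth_at_ident atlM gl.smooth_constant properM) auto
  from smooth_at_compose[where f="\<lambda>y. (y, \<one>\<^bsub>G\<^esub>)", OF properM proper_charts_prod[OF properM gl.proper] i this]
  show ?thesis by (simp add: sec_def[abs_def])
qed

end

lemma proj_act: "u \<in> pts T \<Longrightarrow> g \<in> carrier G \<Longrightarrow> pr (act P u g) = pr u"
  using triv_exists[OF proj_in] proj_act_triv by metis


subsection \<open>The smooth structure\<close>

definition q :: "'p \<Rightarrow> 'h \<Rightarrow> ('p \<times> 'h) set" where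
  "q u h = assoc_proj G H P (u, h)"

lemma q_mem:
  "u \<in> pts T \<Longrightarrow> h \<in> carrier H \<Longrightarrow>
    (v, k) \<in> q u h \<longleftrightarrow> v \<in> pts T \<and> (\<exists>g\<in>carrier G. act P v g = u \<and> k = g \<cdot> h)"
  by (auto simp: q_def assoc_proj_def assoc_rel_def)

lemma q_self: "u \<in> pts T \<Longrightarrow> h \<in> carrier H \<Longrightarrow> (u, h) \<in> q u h"
  unfolding q_mem using act_one by (auto simp: one_eq intro!: bexI[of _ "\<one>\<^bsub>G\<^esub>"])

text \<open>\<open>assoc_rel\<close> relates representatives in one direction; multiplying by
  \<open>g\<close> or by its inverse shows that related representatives have the same image.\<close>

lemma q_act:
  assumes u: "u \<in> pts T" and g: "g \<in> carrier G" and h: "h \<in> carrier H"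
  shows "q (act P u g) h = q u (g \<cdot> h)"
proof -
  have gH: "g \<in> carrier H" using g by (rule sub_carrier)
  have "(v, k) \<in> q (act P u g) h \<longleftrightarrow> (v, k) \<in> q u (g \<cdot> h)" for v k
  proof
    assume "(v, k) \<in> q (act P u g) h"
    then obtain a where a: "v \<in> pts T" "a \<in> carrier G" "act P v a = act P u g" "k = a \<cdot> h"
      using q_mem[OF act_in[OF u g] h] by auto
    have "act P v (a \<otimes>\<^bsub>G\<^esub> inv\<^bsub>G\<^esub> g) = act P (act P v a) (inv\<^bsub>G\<^esub> g)"
      by (rule act_act[OF a(1,2) gl.inv_closed[OF g], symmetric])
    also have "\<dots> = u" using a u g by (simp add: act_act act_one)
    finally have "act P v (a \<otimes>\<^bsub>G\<^esub> inv\<^bsub>G\<^esub> g) = u" .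
    moreover have "k = (a \<otimes>\<^bsub>G\<^esub> inv\<^bsub>G\<^esub> g) \<cdot> (g \<cdot> h)"
    proof -
      have aH: "a \<in> carrier H" using a by (intro sub_carrier)
      have "invH g \<cdot> (g \<cdot> h) = h" using gH h by (simp add: hl.m_assoc[symmetric])
      moreover have "a \<otimes>\<^bsub>G\<^esub> inv\<^bsub>G\<^esub> g = a \<cdot> invH g"
        using mult_eq[OF a(2) gl.inv_closed[OF g]] inv_eq[OF g] by simp
      ultimately show ?thesis using a(4) aH gH h by (simp add: hl.m_assoc)
    qed
    ultimately show "(v, k) \<in> q u (g \<cdot> h)" using a g gH h q_mem[OF u] by auto
  next
    assume "(v, k) \<in> q u (g \<cdot> h)"
    then obtain a where a: "v \<in> pts T" "a \<in> carrier G" "act P v a = u" "k = a \<cdot> (g \<cdot> h)"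
      using q_mem[OF u] gH h by auto
    have "act P v (a \<otimes>\<^bsub>G\<^esub> g) = act P u g" using a g by (simp add: act_act[symmetric])
    moreover have "k = (a \<otimes>\<^bsub>G\<^esub> g) \<cdot> h"
      using a g gH h sub_carrier[of a] by (simp add: mult_eq hl.m_assoc)
    ultimately show "(v, k) \<in> q (act P u g) h" using a g h q_mem[OF act_in[OF u g] h] by auto
  qed
  then show ?thesis by auto
qed

lemma assoc_space_iff: "z \<in> PH \<longleftrightarrow> (\<exists>u\<in>pts T. \<exists>h\<in>carrier H. z = q u h)"
  by (auto simp: assoc_space_def quotient_def q_def assoc_proj_def)

text \<open>Serves the functions on P[H] that are defined as \<open>the_elem\<close> of the image of
  a class.\<close>

lemma the_elem_image:
  assumes "a \<in> S" "\<And>x. x \<in> S \<Longrightarrow> f x = f a"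
  shows "the_elem (f ` S) = f a"
proof -
  have "f ` S = {f a}" using assms by blast
  then show ?thesis by simp
qed

lemma bp_q:
  assumes u: "u \<in> pts T" and h: "h \<in> carrier H"
  shows "bp (q u h) = pr u"
proof -
  have "the_elem ((\<lambda>x. pr (fst x)) ` q u h) = pr (fst (u, h))"
  proof (rule the_elem_image[OF q_self[OF u h]])
    fix x assume x: "x \<in> q u h"
    obtain v k where "x = (v, k)" by fastforce
    with x have "x = (v, k)" "v \<in> pts T" "\<exists>g\<in>carrier G. act P v g = u"
      using q_mem[OF u h] by auto
    then show "pr (fst x) = pr (fst (u, h))" using proj_act by auto
  qed
  then show ?thesis by (simp add: assoc_base_point_def split_beta')
qed

lemma trv_q:
  assumes t: "(U, \<tau>) \<in> triv" and u: "u \<in> pts T" "pr u \<in> U" and h: "h \<in> carrier H"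
  shows "trv \<tau> (q u h) = (pr u, \<tau> u \<cdot> h)"
proof -
  have "the_elem ((\<lambda>x. (pr (fst x), \<tau> (fst x) \<cdot> snd x)) ` q u h) =
      (\<lambda>x. (pr (fst x), \<tau> (fst x) \<cdot> snd x)) (u, h)"
  proof (rule the_elem_image[OF q_self[OF u(1) h]])
    fix x assume xq: "x \<in> q u h"
    obtain v k where "x = (v, k)" by fastforce
    with xq have x: "x = (v, k)" "v \<in> pts T" "\<exists>g\<in>carrier G. act P v g = u \<and> k = g \<cdot> h"
      using q_mem[OF u(1) h] by auto
    then obtain g where g: "g \<in> carrier G" "act P v g = u" "k = g \<cdot> h" by blast
    have pv: "pr v = pr u" using proj_act[OF x(2) g(1)] g(2) by simp
    have tv: "\<tau> v \<in> carrier G" using tau_in[OF t x(2)] pv u by simp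
    have "\<tau> u = \<tau> v \<cdot> g"
      using tau_act[OF t x(2) _ g(1)] pv u g(2) mult_eq[OF tv g(1)] by simp
    then have "\<tau> v \<cdot> k = \<tau> u \<cdot> h"
      using g tv h sub_carrier by (simp add: hl.m_assoc)
    then show "(pr (fst x), \<tau> (fst x) \<cdot> snd x) = (pr (fst (u, h)), \<tau> (fst (u, h)) \<cdot> snd (u, h))"
      using pv x by simp
  qed
  then show ?thesis by (simp add: assoc_triv_def split_beta')
qed

text \<open>The inverse of \<open>trv \<tau>\<close> over \<open>U\<close>, given by the
  section.\<close>

definition psi :: "'m set \<Rightarrow> ('p \<Rightarrow> 'h) \<Rightarrow> 'm \<times> 'h \<Rightarrow> ('p \<times> 'h) set" where
  "psi U \<tau> y = q (sec U \<tau> (fst y)) (snd y)"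

lemma q_eq_psi:
  assumes t: "(U, \<tau>) \<in> triv" and u: "u \<in> pts T" "pr u \<in> U" and h: "h \<in> carrier H"
  shows "q u h = psi U \<tau> (pr u, \<tau> u \<cdot> h)"
  using q_act[OF sec_props(1)[OF t u(2)] tau_in[OF t u] h] sec_act[OF t u] by (simp add: psi_def)

lemma psi_props:
  assumes t: "(U, \<tau>) \<in> triv" and x: "x \<in> U" and h: "h \<in> carrier H"
  shows "psi U \<tau> (x, h) \<in> PH" "bp (psi U \<tau> (x, h)) = x"
    and "(U', \<tau>') \<in> triv \<Longrightarrow> x \<in> U' \<Longrightarrow> trv \<tau>' (psi U \<tau> (x, h)) = (x, \<tau>' (sec U \<tau> x) \<cdot> h)"
    and "trv \<tau> (psi U \<tau> (x, h)) = (x, h)"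
proof -
  note s = sec_props[OF t x]
  show "psi U \<tau> (x, h) \<in> PH" using s h by (auto simp: psi_def assoc_space_iff)
  show "bp (psi U \<tau> (x, h)) = x" using s h by (simp add: psi_def bp_q)
  show "(U', \<tau>') \<in> triv \<Longrightarrow> x \<in> U' \<Longrightarrow> trv \<tau>' (psi U \<tau> (x, h)) = (x, \<tau>' (sec U \<tau> x) \<cdot> h)"
    using s h by (simp add: psi_def trv_q)
  show "trv \<tau> (psi U \<tau> (x, h)) = (x, h)" using t x s h by (simp add: psi_def trv_q one_eq)
qed

lemma psi_trv:
  assumes t: "(U, \<tau>) \<in> triv" and z: "z \<in> PH" "bp z \<in> U"
  shows "psi U \<tau> (trv \<tau> z) = z" "fst (trv \<tau> z) = bp z" "snd (trv \<tau> z) \<in> carrier H"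
proof -
  obtain u h where u: "u \<in> pts T" "h \<in> carrier H" "z = q u h" using z(1) assoc_space_iff by auto
  have pu: "pr u \<in> U" using bp_q u z by simp
  show "psi U \<tau> (trv \<tau> z) = z" using q_eq_psi[OF t u(1) pu u(2)] trv_q[OF t u(1) pu u(2)] u by simp
  show "fst (trv \<tau> z) = bp z" "snd (trv \<tau> z) \<in> carrier H"
    using trv_q[OF t u(1) pu u(2)] bp_q u tau_in[OF t u(1) pu] sub_carrier by auto
qed

text \<open>A name for the members of \<open>assoc_atlas\<close>, see \<open>Q_eq\<close>; the base
  chart is cut down to \<open>U\<close> in the domain only.\<close>

definition qchart :: "'m set \<Rightarrow> ('p \<Rightarrow> 'h) \<Rightarrow> ('m, 'em) chart \<Rightarrow> ('h, 'eh) chart \<Rightarrow>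
    (('p \<times> 'h) set, 'em \<times> 'eh) chart" where
  "qchart U \<tau> c d = ({z \<in> PH. bp z \<in> U \<and> trv \<tau> z \<in> (fst c \<inter> U) \<times> fst d},
    map_prod (snd c) (snd d) \<circ> trv \<tau>)"

lemma Q_eq: "Q = {qchart U \<tau> c d | U \<tau> c d. (U, \<tau>) \<in> triv \<and> c \<in> M \<and> d \<in> K}"
proof -
  have r: "(D, \<phi>) \<in> prod_atlas (restrict_atlas M U) K \<longleftrightarrow>
      (\<exists>c d. c \<in> M \<and> d \<in> K \<and> D = (fst c \<inter> U) \<times> fst d \<and> \<phi> = map_prod (snd c) (snd d))" for D \<phi> U
  proof -
    have rU: "restrict_atlas M U = {(fst c \<inter> U, snd c) | c. c \<in> M}"
      unfolding restrict_atlas_def by (auto simp: split_beta')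
    show ?thesis
    proof
      assume "(D, \<phi>) \<in> prod_atlas (restrict_atlas M U) K"
      then obtain c' d where "(D, \<phi>) = pchart c' d" "c' \<in> restrict_atlas M U" "d \<in> K"
        unfolding prod_atlas_eq by blast
      moreover from this obtain c where "c \<in> M" "c' = (fst c \<inter> U, snd c)" unfolding rU by blast
      ultimately show "\<exists>c d. c \<in> M \<and> d \<in> K \<and> D = (fst c \<inter> U) \<times> fst d \<and> \<phi> = map_prod (snd c) (snd d)"
        by (intro exI[of _ c] exI[of _ d]) simp
    next
      assume "\<exists>c d. c \<in> M \<and> d \<in> K \<and> D = (fst c \<inter> U) \<times> fst d \<and> \<phi> = map_prod (snd c) (snd d)"
      then obtain c d where cd: "c \<in> M" "d \<in> K" "(D, \<phi>) = pchart (fst c \<inter> U, snd c) d" by auto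
      have "(fst c \<inter> U, snd c) \<in> restrict_atlas M U" unfolding rU using cd(1) by blast
      then show "(D, \<phi>) \<in> prod_atlas (restrict_atlas M U) K"
        unfolding prod_atlas_eq mem_Collect_eq using cd(2,3)
        by (intro exI[of _ "(fst c \<inter> U, snd c)"] exI[of _ d] conjI)
    qed
  qed
  show ?thesis unfolding assoc_atlas_def qchart_def r by blast
qed

lemma qchart_mem: "z \<in> fst (qchart U \<tau> c d) \<longleftrightarrow>
    z \<in> PH \<and> bp z \<in> U \<and> trv \<tau> z \<in> (fst c \<inter> U) \<times> fst d"
  by (simp add: qchart_def)

lemma qchart_snd: "snd (qchart U \<tau> c d) z = snd (pchart c d) (trv \<tau> z)"
  by (simp add: qchart_def)

lemma charts_at_Q:
  assumes "k \<in> charts_at Q z"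
  obtains U \<tau> c d where "(U, \<tau>) \<in> triv" "k = qchart U \<tau> c d" "z \<in> PH" "bp z \<in> U"
    "c \<in> charts_at M (bp z)" "d \<in> charts_at K (snd (trv \<tau> z))"
    "pchart c d \<in> charts_at MK (trv \<tau> z)"
proof -
  obtain U \<tau> c d where k: "(U, \<tau>) \<in> triv" "k = qchart U \<tau> c d" "c \<in> M" "d \<in> K" "z \<in> fst k"
    using assms unfolding charts_at_iff Q_eq by blast
  have z: "z \<in> PH" "bp z \<in> U" "trv \<tau> z \<in> (fst c \<inter> U) \<times> fst d"
    using k qchart_mem by auto
  note f = psi_trv(2)[OF k(1) z(1,2)]
  have cd: "c \<in> charts_at M (bp z)" "d \<in> charts_at K (snd (trv \<tau> z))" using z(3) k f by (auto simp: charts_at_iff mem_Times_iff)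
  moreover have "pchart c d \<in> charts_at MK (fst (trv \<tau> z), snd (trv \<tau> z))"
    unfolding charts_at_prod using cd f by auto
  ultimately show thesis using that k z by simp
qed

lemma charts_at_Q_exists:
  assumes z: "z \<in> PH"
  shows "z \<in> pts Q"
proof -
  obtain u h where u: "u \<in> pts T" "h \<in> carrier H" "z = q u h" using z assoc_space_iff by auto
  obtain U \<tau> where t: "(U, \<tau>) \<in> triv" "pr u \<in> U" using triv_exists[OF proj_in[OF u(1)]] by blast
  have bz: "bp z \<in> U" using bp_q u t by simp
  note pz = psi_trv[OF t(1) z bz]
  have "bp z \<in> pts M" "snd (trv \<tau> z) \<in> pts K" using triv_sub[OF t(1) bz] pz by auto
  then obtain c d where cd: "c \<in> charts_at M (bp z)" "d \<in> charts_at K (snd (trv \<tau> z))" unfolding pts_iff by blast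
  have "trv \<tau> z \<in> (fst c \<inter> U) \<times> fst d" using cd bz pz(2) by (auto simp: charts_at_iff mem_Times_iff)
  then have "qchart U \<tau> c d \<in> charts_at Q z"
    unfolding charts_at_iff qchart_mem Q_eq using cd t z bz by (auto simp: charts_at_iff)
  then show ?thesis by (rule charts_at_pts)
qed

lemma pts_Q [simp]: "pts Q = PH"
proof
  show "PH \<subseteq> pts Q" using charts_at_Q_exists by blast
  show "pts Q \<subseteq> PH" using charts_at_Q unfolding pts_iff by (metis pts_iff subsetI)
qed

lemma pchart_cinv:
  assumes "c \<in> M" "d \<in> K" "x \<in> cran c" "y \<in> cran d"
  shows "cinv (pchart c d) (x, y) = (cinv c x, cinv d y)"
  using assms properM hl.proper by (intro cinv_pchart) (auto simp: proper_charts_def)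

text \<open>Since \<open>psi\<close> inverts \<open>trv\<close>, a chart of P[H] is a product chart
  transported by these two maps, and its inverse is \<open>psi\<close> after the inverse of the
  product chart.\<close>

lemma cran_qchart:
  assumes t: "(U, \<tau>) \<in> triv" and c: "c \<in> M" and d: "d \<in> K"
  shows "cran (qchart U \<tau> c d) = (snd c ` (fst c \<inter> U)) \<times> cran d"
    and "inj_on (snd (qchart U \<tau> c d)) (fst (qchart U \<tau> c d))"
    and "y \<in> (snd c ` (fst c \<inter> U)) \<times> cran d \<Longrightarrow> cinv (qchart U \<tau> c d) y = psi U \<tau> (cinv (pchart c d) y)"
    and "open ((snd c ` (fst c \<inter> U)) \<times> cran d)"
proof -
  let ?k = "qchart U \<tau> c d"
  have dH: "h \<in> carrier H" if "h \<in> fst d" for h using that d hl.ptsA by (auto simp: pts_def)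
  have cinj: "inj_on (snd c) (fst c)" and dinj: "inj_on (snd d) (fst d)"
    using properM hl.proper c d by (auto simp: proper_charts_def)
  show inj: "inj_on (snd ?k) (fst ?k)"
  proof (rule inj_onI)
    fix z w assume z: "z \<in> fst ?k" "w \<in> fst ?k" and eq: "snd ?k z = snd ?k w"
    have "trv \<tau> z = trv \<tau> w"
      using map_prod_inj_on[OF cinj dinj] z eq unfolding qchart_mem qchart_snd snd_conv
      by (auto dest!: inj_onD)
    then show "z = w" using psi_trv(1)[OF t] z unfolding qchart_mem by metis
  qed
  have in_k: "psi U \<tau> (x, h) \<in> fst ?k" and snd_k: "snd ?k (psi U \<tau> (x, h)) = (snd c x, snd d h)"
    if "x \<in> fst c \<inter> U" "h \<in> fst d" for x h
    using that psi_props[OF t, of x h] dH by (auto simp: qchart_mem qchart_snd)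
  show "cran ?k = (snd c ` (fst c \<inter> U)) \<times> cran d"
  proof
    show "cran ?k \<subseteq> (snd c ` (fst c \<inter> U)) \<times> cran d"
    proof (rule image_subsetI)
      fix z assume "z \<in> fst ?k"
      then have "trv \<tau> z \<in> (fst c \<inter> U) \<times> fst d" by (simp add: qchart_mem)
      then show "snd ?k z \<in> (snd c ` (fst c \<inter> U)) \<times> cran d" unfolding qchart_snd by auto
    qed
    show "(snd c ` (fst c \<inter> U)) \<times> cran d \<subseteq> cran ?k"
    proof
      fix y assume "y \<in> (snd c ` (fst c \<inter> U)) \<times> cran d"
      then obtain x h where x: "x \<in> fst c \<inter> U" "h \<in> fst d" "y = (snd c x, snd d h)" by auto
      show "y \<in> cran ?k" by (rule image_eqI[OF _ in_k[OF x(1,2)]]) (simp add: snd_k[OF x(1,2)] x(3))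
    qed
  qed
  show "cinv ?k y = psi U \<tau> (cinv (pchart c d) y)" if y: "y \<in> (snd c ` (fst c \<inter> U)) \<times> cran d"
  proof -
    obtain x h where x: "x \<in> fst c \<inter> U" "h \<in> fst d" "y = (snd c x, snd d h)" using y by auto
    have "cinv (pchart c d) y = (x, h)"
      using pchart_cinv[OF c d, of "snd c x" "snd d h"] x cinj dinj by auto
    moreover have "cinv ?k y = psi U \<tau> (x, h)"
      using inv_into_f_f[OF inj in_k[OF x(1,2)]] snd_k[OF x(1,2)] x by simp
    ultimately show ?thesis by simp
  qed
  show "open ((snd c ` (fst c \<inter> U)) \<times> cran d)"
    using triv_open[OF t] c d hl.proper
    by (intro open_Times) (auto simp: mopen_def proper_charts_def split: prod.splits)
qed

section \<open>Smooth maps into and out of P[H]\<close>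

lemma properQ: "proper_charts Q"
  unfolding proper_charts_def Q_eq using cran_qchart by auto

text \<open>All trivializations around \<open>F p\<close> occur because \<open>smooth_at\<close>
  tests every chart, and a change of trivialization is under control only after
  \<open>transition_smooth\<close>.\<close>

lemma smooth_at_into_Q:
  assumes X: "proper_charts X" and Fp: "p \<in> pts X" "F p \<in> PH"
    and near: "\<And>U \<tau>. (U, \<tau>) \<in> triv \<Longrightarrow> bp (F p) \<in> U \<Longrightarrow> nhd X p {x. F x \<in> PH \<and> bp (F x) \<in> U}"
    and s: "\<And>U \<tau>. (U, \<tau>) \<in> triv \<Longrightarrow> bp (F p) \<in> U \<Longrightarrow> smooth_at X MK (\<lambda>x. trv \<tau> (F x)) p"
  shows "smooth_at X Q F p"
  unfolding smooth_at_def
proof (intro conjI ballI)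
  show "p \<in> pts X" "F p \<in> pts Q" using Fp by auto
  fix k e assume k: "k \<in> charts_at X p" and "e \<in> charts_at Q (F p)"
  then obtain U \<tau> c d where e: "(U, \<tau>) \<in> triv" "e = qchart U \<tau> c d" "bp (F p) \<in> U"
    "pchart c d \<in> charts_at MK (trv \<tau> (F p))" by (elim charts_at_Q)
  obtain V where V: "open V" "snd k p \<in> V" "V \<subseteq> cran k" "\<And>x. x \<in> V \<Longrightarrow> trv \<tau> (F (cinv k x)) \<in> fst (pchart c d)"
    "smooth_on V (\<lambda>x. snd (pchart c d) (trv \<tau> (F (cinv k x))))"
    by (rule smooth_atD[OF s[OF e(1,3)] k e(4)]) (rule that; blast)
  obtain W where W: "open W" "snd k p \<in> W" "\<forall>x\<in>W. F (cinv k x) \<in> PH \<and> bp (F (cinv k x)) \<in> U"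
    using bspec[OF near[OF e(1,3), unfolded nhd_def] k] by auto
  have "F (cinv k x) \<in> fst e" if "x \<in> V \<inter> W" for x
  proof -
    have z: "F (cinv k x) \<in> PH" "bp (F (cinv k x)) \<in> U" using W(3) that by auto
    then show ?thesis
      unfolding e(2) qchart_mem using V(4)[of x] that psi_trv(2)[OF e(1) z] by (auto simp: mem_Times_iff)
  qed
  moreover have "smooth_on (V \<inter> W) (\<lambda>x. snd e (F (cinv k x)))"
    unfolding e(2) qchart_snd by (rule smooth_on_subset[OF V(5)]) auto
  ultimately show "\<exists>V. chart_nhd k p V \<and> (\<forall>x\<in>V. F (cinv k x) \<in> fst e) \<and>
      smooth_on V (\<lambda>x. snd e (F (cinv k x)))"
    using V W by (intro exI[of _ "V \<inter> W"]) auto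
qed

text \<open>The counterpart of \<open>smooth_at_into_Q\<close>: maps out of P[H] are tested after
  composition with the inverse trivializations.\<close>

lemma smooth_at_from_Q:
  assumes z: "z \<in> PH" and Fz: "F z \<in> pts X"
    and s: "\<And>U \<tau>. (U, \<tau>) \<in> triv \<Longrightarrow> bp z \<in> U \<Longrightarrow> smooth_at MK X (\<lambda>y. F (psi U \<tau> y)) (trv \<tau> z)"
  shows "smooth_at Q X F z"
  unfolding smooth_at_def
proof (intro conjI ballI)
  show "z \<in> pts Q" "F z \<in> pts X" using z Fz by auto
  fix k e assume "k \<in> charts_at Q z" and e: "e \<in> charts_at X (F z)"
  then obtain U \<tau> c d where k: "(U, \<tau>) \<in> triv" "k = qchart U \<tau> c d" "bp z \<in> U" "c \<in> charts_at M (bp z)"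
    "d \<in> charts_at K (snd (trv \<tau> z))" "pchart c d \<in> charts_at MK (trv \<tau> z)"
    by (elim charts_at_Q)
  note pz = psi_trv[OF k(1) z k(3)]
  have cd: "c \<in> M" "d \<in> K" using k by (auto simp: charts_at_iff)
  have e': "e \<in> charts_at X (F (psi U \<tau> (trv \<tau> z)))" using e pz by simp
  obtain V where V: "open V" "snd (pchart c d) (trv \<tau> z) \<in> V" "V \<subseteq> cran (pchart c d)"
    "\<And>x. x \<in> V \<Longrightarrow> F (psi U \<tau> (cinv (pchart c d) x)) \<in> fst e"
    "smooth_on V (\<lambda>x. snd e (F (psi U \<tau> (cinv (pchart c d) x))))"
    by (rule smooth_atD[OF s[OF k(1,3)] k(6) e']) (rule that; blast)
  let ?N = "(snd c ` (fst c \<inter> U)) \<times> cran d"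
  note cq = cran_qchart[OF k(1) cd]
  have o: "open (V \<inter> ?N)" using V(1) cq(4) by auto
  have "snd k z \<in> V \<inter> ?N"
    using V(2) k pz(2) unfolding k(2) qchart_snd by (auto simp: charts_at_iff split: prod.splits)
  moreover have "V \<inter> ?N \<subseteq> cran k" unfolding k(2) cq(1) by auto
  moreover have "\<forall>x\<in>V \<inter> ?N. F (cinv k x) \<in> fst e" using V(4) cq(3) unfolding k(2) by auto
  moreover have "smooth_on (V \<inter> ?N) (\<lambda>x. snd e (F (cinv k x)))"
  proof (rule smooth_on_cong[OF o _ smooth_on_subset[OF V(5)]])
    show "snd e (F (psi U \<tau> (cinv (pchart c d) x))) = snd e (F (cinv k x))" if "x \<in> V \<inter> ?N" for x
      using cq(3)[of x] that unfolding k(2) by simp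
  qed auto
  ultimately show "\<exists>V. chart_nhd k z V \<and> (\<forall>x\<in>V. F (cinv k x) \<in> fst e) \<and>
      smooth_on V (\<lambda>x. snd e (F (cinv k x)))"
    using o by (intro exI[of _ "V \<inter> ?N"]) blast
qed

lemma nhd_fst_in:
  assumes t: "(U, \<tau>) \<in> triv" and x: "x \<in> U" and h: "h \<in> carrier H"
  shows "nhd MK (x, h) {y. fst y \<in> U \<and> snd y \<in> carrier H}"
proof -
  have p: "(x, h) \<in> pts MK" using triv_sub[OF t x] h by simp
  have "nhd MK (x, h) (fst -` U)"
    using triv_nhd[OF t x] by (intro nhd_vimage[OF properMK properM smooth_at_fst[OF atlM hl.proper p]]) simp
  from nhd_Int[OF this nhd_pts[OF properMK]] show ?thesis by (rule nhd_mono) auto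
qed

text \<open>A change of trivialization multiplies the fibre coordinate from the left by the value of
  \<open>\<tau>'\<close> on the section, a smooth function into \<open>G\<close>, which
  \<open>incl_smooth\<close> makes smooth as a function into \<open>H\<close>.\<close>

lemma transition_smooth:
  assumes t: "(U, \<tau>) \<in> triv" and t': "(U', \<tau>') \<in> triv" and x: "x \<in> U" "x \<in> U'" and h: "h \<in> carrier H"
  shows "smooth_at MK MK (\<lambda>y. trv \<tau>' (psi U \<tau> y)) (x, h)"
proof -
  have p: "(x, h) \<in> pts MK" using triv_sub[OF t x(1)] h by simp
  have fs: "smooth_at MK M fst (x, h)" by (rule smooth_at_fst[OF atlM hl.proper p])
  have ss: "smooth_at MK K snd (x, h)" by (rule smooth_at_snd[OF properM hl.atl p])
  note sp = sec_props[OF t x(1)]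
  have "smooth_at M L (\<lambda>y. \<tau>' (sec U \<tau> y)) x"
    by (rule smooth_at_compose[where f="sec U \<tau>" and g=\<tau>', OF properM properT tau_smooth[OF t'] sec_smooth[OF t x(1)]])
      (use sp x in auto)
  then have "smooth_at M K (\<lambda>y. \<tau>' (sec U \<tau> y)) x"
    by (rule smooth_at_compose[where f="\<lambda>y. \<tau>' (sec U \<tau> y)" and g="\<lambda>x. x", OF properM gl.proper incl_smooth, rotated])
      (use sp x tau_in[OF t'] in auto)
  then have "smooth_at MK K (\<lambda>y. \<tau>' (sec U \<tau> (fst y))) (x, h)"
    by (intro smooth_at_compose[where f=fst and g="\<lambda>y. \<tau>' (sec U \<tau> y)", OF properMK properM _ fs]) simp
  from smooth_at_Pair[OF fs hl.smooth_mult[OF properMK this ss]]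
  have s: "smooth_at MK MK (\<lambda>y. (fst y, \<tau>' (sec U \<tau> (fst y)) \<cdot> snd y)) (x, h)" .
  show ?thesis
  proof (rule smooth_at_cong[OF properMK _ s])
    show "nhd MK (x, h) {y. (fst y, \<tau>' (sec U \<tau> (fst y)) \<cdot> snd y) = trv \<tau>' (psi U \<tau> y)}"
      using psi_props(3)[OF t _ _ t']
      by (intro nhd_mono[OF nhd_Int[OF nhd_fst_in[OF t x(1) h] nhd_fst_in[OF t' x(2) h]]]) (auto simp: prod_eq_iff)
  qed
qed

lemma psi_smooth:
  assumes t: "(U, \<tau>) \<in> triv" and x: "x \<in> U" and h: "h \<in> carrier H"
  shows "smooth_at MK Q (psi U \<tau>) (x, h)"
proof (rule smooth_at_into_Q[OF properMK])
  show "(x, h) \<in> pts MK" using triv_sub[OF t x] h by simp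
  note pp = psi_props[OF t x h]
  show "psi U \<tau> (x, h) \<in> PH" by (rule pp)
  fix U' \<tau>' assume t': "(U', \<tau>') \<in> triv" and "bp (psi U \<tau> (x, h)) \<in> U'"
  then have x': "x \<in> U'" using pp by simp
  show "smooth_at MK MK (\<lambda>y. trv \<tau>' (psi U \<tau> y)) (x, h)"
    by (rule transition_smooth[OF t t' x x' h])
  show "nhd MK (x, h) {y. psi U \<tau> y \<in> PH \<and> bp (psi U \<tau> y) \<in> U'}"
    using psi_props(1,2)[OF t]
    by (intro nhd_mono[OF nhd_Int[OF nhd_fst_in[OF t x h] nhd_fst_in[OF t' x' h]]]) auto
qed

lemma trv_smooth:
  assumes t: "(U, \<tau>) \<in> triv" and z: "z \<in> PH" "bp z \<in> U"
  shows "smooth_at Q MK (trv \<tau>) z"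
proof (rule smooth_at_from_Q[OF z(1)])
  show "trv \<tau> z \<in> pts MK"
    using psi_trv[OF t z] triv_sub[OF t z(2)] by (simp add: mem_Times_iff)
  fix U' \<tau>' assume t': "(U', \<tau>') \<in> triv" and z': "bp z \<in> U'"
  show "smooth_at MK MK (\<lambda>y. trv \<tau> (psi U' \<tau>' y)) (trv \<tau>' z)"
    using transition_smooth[OF t' t z' z(2) psi_trv(3)[OF t' z(1) z']] psi_trv(2)[OF t' z(1) z'] by (metis prod.collapse)
qed

lemma bp_smooth:
  assumes z: "z \<in> PH"
  shows "smooth_at Q M bp z"
proof (rule smooth_at_from_Q[OF z])
  obtain u h where "u \<in> pts T" "h \<in> carrier H" "z = q u h" using z assoc_space_iff by auto
  then show "bp z \<in> pts M" using bp_q proj_in by simp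
  fix U \<tau> assume t: "(U, \<tau>) \<in> triv" and bz: "bp z \<in> U"
  note pz = psi_trv[OF t z bz]
  have e: "trv \<tau> z = (bp z, snd (trv \<tau> z))" using pz(2) by (simp add: prod_eq_iff)
  have "trv \<tau> z \<in> pts MK" using pz triv_sub[OF t bz] by (simp add: mem_Times_iff)
  from smooth_at_fst[OF atlM hl.proper this]
  show "smooth_at MK M (\<lambda>y. bp (psi U \<tau> y)) (trv \<tau> z)"
  proof (rule smooth_at_cong[OF properMK, rotated])
    show "nhd MK (trv \<tau> z) {y. fst y = bp (psi U \<tau> y)}"
      using nhd_fst_in[OF t bz pz(3)] psi_props(2)[OF t] unfolding e[symmetric]
      by (elim nhd_mono) auto
  qed
qed

lemma nhd_bp:
  assumes t: "(U, \<tau>) \<in> triv" and z: "z \<in> PH" "bp z \<in> U"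
  shows "nhd Q z {w. w \<in> PH \<and> bp w \<in> U}"
  using nhd_Int[OF nhd_vimage[OF properQ properM bp_smooth[OF z(1)] triv_nhd[OF t z(2)]] nhd_pts[OF properQ]]
  by (elim nhd_mono) auto

text \<open>Read through a trivialization, the identity is \<open>psi\<close>, so
  \<open>psi_smooth\<close> settles the claim.\<close>

lemma atlQ: "smooth_atlas Q"
  unfolding smooth_atlas_def
proof (intro conjI ballI properQ)
  fix z assume z': "z \<in> pts Q"
  then have z: "z \<in> PH" by simp
  show "smooth_at Q Q (\<lambda>x. x) z"
  proof (rule smooth_at_from_Q[where F="\<lambda>x. x", OF z z'])
    fix U \<tau> assume t: "(U, \<tau>) \<in> triv" and bz: "bp z \<in> U"
    have "smooth_at MK Q (psi U \<tau>) (bp z, snd (trv \<tau> z))"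
      by (rule psi_smooth[OF t bz psi_trv(3)[OF t z bz]])
    then show "smooth_at MK Q (\<lambda>y. psi U \<tau> y) (trv \<tau> z)"
      using psi_trv(2)[OF t z bz] by (metis prod.collapse)
  qed
qed

definition hc :: "('p \<Rightarrow> 'h) \<Rightarrow> ('p \<times> 'h) set \<Rightarrow> 'h" where
  "hc \<tau> z = snd (trv \<tau> z)"

lemma hc_q: "(U, \<tau>) \<in> triv \<Longrightarrow> u \<in> pts T \<Longrightarrow> pr u \<in> U \<Longrightarrow> h \<in> carrier H \<Longrightarrow> hc \<tau> (q u h) = \<tau> u \<cdot> h"
  by (simp add: hc_def trv_q)

lemma hc_in: "(U, \<tau>) \<in> triv \<Longrightarrow> z \<in> PH \<Longrightarrow> bp z \<in> U \<Longrightarrow> hc \<tau> z \<in> carrier H"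
  unfolding hc_def by (rule psi_trv)

lemma q_sec_hc:
  assumes "(U, \<tau>) \<in> triv" "z \<in> PH" "bp z \<in> U"
  shows "q (sec U \<tau> (bp z)) (hc \<tau> z) = z"
  using psi_trv[OF assms] by (simp add: psi_def hc_def)

lemma hc_smooth:
  assumes t: "(U, \<tau>) \<in> triv" and z: "z \<in> PH" "bp z \<in> U"
  shows "smooth_at Q K (hc \<tau>) z"
proof -
  have "trv \<tau> z \<in> pts MK" using psi_trv[OF t z] triv_sub[OF t z(2)] by (simp add: mem_Times_iff)
  from smooth_at_compose[OF properQ properMK smooth_at_snd[OF properM hl.atl this] trv_smooth[OF t z]]
  show ?thesis by (simp add: hc_def[abs_def])
qed

lemma sec_bp_smooth:
  assumes t: "(U, \<tau>) \<in> triv" and z: "z \<in> PH" "bp z \<in> U"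
  shows "smooth_at Q T (\<lambda>w. sec U \<tau> (bp w)) z"
  by (rule smooth_at_compose[where f=bp, OF properQ properM sec_smooth[OF t z(2)] bp_smooth[OF z(1)]])

lemma q_in: "u \<in> pts T \<Longrightarrow> h \<in> carrier H \<Longrightarrow> q u h \<in> PH"
  by (auto simp: assoc_space_iff)

text \<open>Near \<open>p\<close> the class is \<open>psi\<close> applied to the smooth pair
  \<open>(pr (f x), \<tau> (f x) \<cdot> k x)\<close>.\<close>

lemma q_smooth:
  assumes X: "proper_charts X" and f: "smooth_at X T f p" and k: "smooth_at X K k p"
  shows "smooth_at X Q (\<lambda>x. q (f x) (k x)) p"
proof -
  have fp: "f p \<in> pts T" and kp: "k p \<in> carrier H" using smooth_at_pts(2)[OF f] smooth_at_pts(2)[OF k] by auto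
  obtain U \<tau> where t: "(U, \<tau>) \<in> triv" and x: "pr (f p) \<in> U" using triv_exists[OF proj_in[OF fp]] by blast
  have s1: "smooth_at X M (\<lambda>x. pr (f x)) p" by (rule smooth_at_compose[where f=f, OF X properT proj_smooth[OF fp] f])
  have "smooth_at X L (\<lambda>x. \<tau> (f x)) p" by (rule smooth_at_compose[where f=f, OF X properT tau_smooth[OF t fp x] f])
  then have "smooth_at X K (\<lambda>x. \<tau> (f x)) p"
    by (rule smooth_at_compose[where f="\<lambda>x. \<tau> (f x)" and g="\<lambda>x. x", OF X gl.proper incl_smooth[OF tau_in[OF t fp x]]])
  from smooth_at_Pair[OF s1 hl.smooth_mult[OF X this k]]
  have s2: "smooth_at X MK (\<lambda>x. (pr (f x), \<tau> (f x) \<cdot> k x)) p" .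
  have "\<tau> (f p) \<cdot> k p \<in> carrier H" using tau_in[OF t fp x] kp sub_carrier by auto
  from smooth_at_compose[where f="\<lambda>x. (pr (f x), \<tau> (f x) \<cdot> k x)", OF X properMK psi_smooth[OF t x this] s2]
  have s: "smooth_at X Q (\<lambda>x. psi U \<tau> (pr (f x), \<tau> (f x) \<cdot> k x)) p" .
  have n: "nhd X p (f -` (pr -` U \<inter> pts T) \<inter> k -` carrier H)"
    using nhd_Int[OF nhd_vimage[OF X properT f nhd_Int[OF triv_nhd_total[OF t fp x] nhd_pts[OF properT]]]
        nhd_vimage[OF X hl.proper k nhd_pts[OF hl.proper]]] by simp
  show ?thesis
    by (rule smooth_at_cong[OF X nhd_mono[OF n] s]) (auto simp: q_eq_psi[OF t])
qed

end


section \<open>Cartan connections and principal connections\<close>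

context principal_extension
begin

abbreviation "B \<equiv> assoc_bundle G H P"

lemma B_simps [simp]: "total B = Q"
  by (simp add: assoc_bundle_def)

text \<open>The action is a union over representatives, each of which contributes the same
  class.\<close>

lemma act_B:
  assumes u: "u \<in> pts T" and h: "h \<in> carrier H" and a: "a \<in> carrier H"
  shows "act B (q u h) a = q u (h \<cdot> a)"
proof -
  have *: "assoc_proj G H P (v, k \<cdot> a) = q u (h \<cdot> a)" if vk: "(v, k) \<in> q u h" for v k
  proof -
    obtain g where v: "v \<in> pts T" and g: "g \<in> carrier G" "act P v g = u" "k = g \<cdot> h"
      using q_mem[OF u h] vk by auto
    show ?thesis
      using q_act[OF v g(1), of "h \<cdot> a"] g h a sub_carrier[OF g(1)] by (simp add: q_def hl.m_assoc)
  qed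
  have "act B (q u h) a = (\<Union>x\<in>q u h. assoc_proj G H P (fst x, snd x \<cdot> a))"
    by (simp add: assoc_bundle_def split_beta')
  also have "\<dots> = q u (h \<cdot> a)"
    using * q_self[OF u h] by auto
  finally show ?thesis .
qed

lemma iota_eq: "assoc_incl G H P = (\<lambda>u. q u \<ee>)"
  by (simp add: assoc_incl_def[abs_def] q_def)

section \<open>Tangent vectors of P[H]\<close>

lemma q_fst_smooth: "u \<in> pts T \<Longrightarrow> h \<in> carrier H \<Longrightarrow> smooth_at T Q (\<lambda>v. q v h) u"
  by (rule q_smooth[OF properT smooth_at_ident[OF atlT] hl.smooth_constant[OF properT]])

lemma q_orbit_smooth:
  "u \<in> pts T \<Longrightarrow> h \<in> carrier H \<Longrightarrow> y \<in> carrier H \<Longrightarrow> smooth_at K Q (\<lambda>y. q u (h \<cdot> y)) y"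
  using q_smooth[OF hl.proper smooth_at_const[OF hl.proper, of y u T] hl.smooth_left[of h y]] by simp

text \<open>The images of \<open>hor\<close> and \<open>ver\<close> together span the tangent space
  but are in general not complementary: by \<open>hor_fundamental\<close> they share the directions
  of the G-orbits.\<close>

abbreviation hor :: "'p \<Rightarrow> 'h \<Rightarrow> ('p, 'ep) tvec \<Rightarrow> (('p \<times> 'h) set, 'em \<times> 'eh) tvec" where
  "hor u h \<equiv> tangent_map T Q (\<lambda>v. q v h) u"

abbreviation ver :: "'p \<Rightarrow> 'h \<Rightarrow> ('h, 'eh) tvec \<Rightarrow> (('p \<times> 'h) set, 'em \<times> 'eh) tvec" where
  "ver u h \<equiv> tangent_map K Q (\<lambda>y. q u (h \<cdot> y)) \<ee>"

lemma hor_in: "u \<in> pts T \<Longrightarrow> h \<in> carrier H \<Longrightarrow> \<xi> \<in> tangent_space T u \<Longrightarrow> hor u h \<xi> \<in> tangent_space Q (q u h)"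
  by (rule tangent_map_in[OF atlT atlQ q_fst_smooth])

lemma ver_in: "u \<in> pts T \<Longrightarrow> h \<in> carrier H \<Longrightarrow> Y \<in> lie_algebra H \<Longrightarrow> ver u h Y \<in> tangent_space Q (q u h)"
  using tangent_map_in[OF hl.atl atlQ q_orbit_smooth[of u h "\<ee>"], of Y] by (simp add: lie_algebra_def)

text \<open>Writing \<open>y = h (h^-1 y)\<close> moves the vector to the unit; this is the origin
  of the Maurer-Cartan term.\<close>

lemma q_snd_tangent:
  assumes u: "u \<in> pts T" and h: "h \<in> carrier H" and w: "w \<in> tangent_space K h"
  shows "tangent_map K Q (q u) h w = ver u h (maurer_cartan H h w)"
proof -
  let ?i = "invH h"
  have ih: "?i \<cdot> h = \<ee>" using h by simp
  have "tangent_map K Q (\<lambda>y. q u (h \<cdot> (?i \<cdot> y))) h w =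
      tangent_map K Q (\<lambda>y. q u (h \<cdot> y)) (?i \<cdot> h) (tangent_map K K (\<lambda>y. ?i \<cdot> y) h w)"
    by (rule tangent_map_compose[OF hl.atl hl.atl q_orbit_smooth hl.smooth_left w]) (use u h in auto)
  moreover have "tangent_map K Q (\<lambda>y. q u (h \<cdot> (?i \<cdot> y))) h = tangent_map K Q (q u) h"
    by (rule tangent_map_cong_pts[OF hl.proper]) (use h in \<open>auto simp: hl.m_assoc[symmetric]\<close>)
  ultimately show ?thesis by (simp add: maurer_cartan_def ih)
qed

text \<open>Near \<open>q u h\<close> every class is \<open>q (f w) (k w)\<close> with smooth
  \<open>f\<close> and \<open>k\<close> that take the values \<open>u\<close> and \<open>h\<close>
  at the given point; the Leibniz rule differentiates this identity.\<close>

lemma tangent_decomposition: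
  assumes u: "u \<in> pts T" and h: "h \<in> carrier H" and v: "v \<in> tangent_space Q (q u h)"
  obtains \<xi> Y where "\<xi> \<in> tangent_space T u" "Y \<in> lie_algebra H" "v = (\<lambda>d. hor u h \<xi> d + ver u h Y d)"
proof -
  let ?z = "q u h"
  obtain U \<tau> where t: "(U, \<tau>) \<in> triv" and pu: "pr u \<in> U" using triv_exists[OF proj_in[OF u]] by blast
  have z: "?z \<in> PH" "bp ?z = pr u" "bp ?z \<in> U" using q_in[OF u h] bp_q[OF u h] pu by auto
  \<comment> \<open>The section value over \<open>pr u\<close> need not be \<open>u\<close>; acting
    with \<open>g\<close> repairs this, and the inverse of \<open>g\<close> in \<open>k\<close>
    compensates.\<close>
  define g where "g = \<tau> u"
  have g: "g \<in> carrier G" "g \<in> carrier H" using tau_in[OF t u pu] sub_carrier by (auto simp: g_def)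
  define f where "f = (\<lambda>w. act P (sec U \<tau> (bp w)) g)"
  define k where "k = (\<lambda>w. invH g \<cdot> hc \<tau> w)"
  have zp: "?z \<in> pts Q" using z by simp
  have f: "smooth_at Q T f ?z" unfolding f_def
    by (rule act_smooth[OF properQ sec_bp_smooth[OF t z(1,3)] gl.smooth_constant[OF properQ zp g(1)]])
  have k: "smooth_at Q K k ?z" unfolding k_def
    by (rule hl.smooth_mult[OF properQ hl.smooth_constant[OF properQ zp] hc_smooth[OF t z(1,3)]]) (use g in simp)
  have fz: "f ?z = u" using sec_act[OF t u pu] by (simp add: f_def z(2) g_def)
  have kz: "k ?z = h" using g h by (simp add: k_def hc_q[OF t u pu h] hl.m_assoc[symmetric] flip: g_def)
  let ?m = "\<lambda>y. q (fst y) (snd y)"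
  have p: "(f ?z, k ?z) \<in> pts (prod_atlas T K)" using u h by (simp add: fz kz)
  have m: "smooth_at (prod_atlas T K) Q ?m (f ?z, k ?z)"
    by (rule q_smooth[OF proper_charts_prod[OF properT hl.proper] smooth_at_fst[OF atlT hl.proper p]
          smooth_at_snd[OF properT hl.atl p]])
  have near: "nhd Q ?z {w. w = ?m (f w, k w)}"
  proof (rule nhd_mono[OF nhd_bp[OF t z(1,3)]], clarsimp)
    fix w assume w: "w \<in> PH" "bp w \<in> U"
    have "q (f w) (k w) = q (sec U \<tau> (bp w)) (g \<cdot> (invH g \<cdot> hc \<tau> w))"
      unfolding f_def k_def using g hc_in[OF t w] by (intro q_act[OF sec_props(1)[OF t w(2)]]) auto
    also have "\<dots> = w" using g hc_in[OF t w] q_sec_hc[OF t w] by (simp add: hl.m_assoc[symmetric])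
    finally show "w = q (f w) (k w)" by simp
  qed
  define \<xi> where "\<xi> = tangent_map Q T f ?z v"
  have \<xi>: "\<xi> \<in> tangent_space T u" unfolding \<xi>_def using tangent_map_in[OF atlQ atlT f v] fz by simp
  have kv: "tangent_map Q K k ?z v \<in> tangent_space K h" using tangent_map_in[OF atlQ hl.atl k v] kz by simp
  have "v = tangent_map Q Q (\<lambda>w. w) ?z v" using tangent_map_ident[OF atlQ zp v] by simp
  also have "tangent_map Q Q (\<lambda>w. w) ?z = tangent_map Q Q (\<lambda>w. ?m (f w, k w)) ?z"
    by (rule tangent_map_cong[OF properQ zp near])
  also have "\<dots> v = (\<lambda>e. tangent_map T Q (\<lambda>x. ?m (x, k ?z)) (f ?z) \<xi> e +
      tangent_map K Q (\<lambda>y. ?m (f ?z, y)) (k ?z) (tangent_map Q K k ?z v) e)"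
    unfolding \<xi>_def by (rule tangent_map_product[OF atlT hl.atl atlQ m f k v])
  also have "\<dots> = (\<lambda>d. hor u h \<xi> d + ver u h (maurer_cartan H h (tangent_map Q K k ?z v)) d)"
    using q_snd_tangent[OF u h kv] by (simp add: fz kz)
  finally show thesis using that \<xi> hl.maurer_cartan_in[OF h kv] by blast
qed

text \<open>In a trivialization the right action multiplies the fibre coordinate from the right,
  which gives its smoothness; the formula differentiates \<open>q(v, h) a = q(v, h a)\<close> in
  \<open>v\<close>.\<close>

lemma right_hor:
  assumes u: "u \<in> pts T" and h: "h \<in> carrier H" and a: "a \<in> carrier H" and \<xi>: "\<xi> \<in> tangent_space T u"
  shows "tangent_map Q Q (\<lambda>z. act B z a) (q u h) (hor u h \<xi>) = hor u (h \<cdot> a) \<xi>"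
    and "smooth_at Q Q (\<lambda>z. act B z a) (q u h)"
proof -
  obtain U \<tau> where t: "(U, \<tau>) \<in> triv" and pu: "pr u \<in> U" using triv_exists[OF proj_in[OF u]] by blast
  let ?z = "q u h"
  have z: "?z \<in> PH" "bp ?z \<in> U" using q_in[OF u h] bp_q[OF u h] pu by auto
  have "smooth_at Q Q (\<lambda>w. q (sec U \<tau> (bp w)) (hc \<tau> w \<cdot> a)) ?z"
    by (rule q_smooth[OF properQ sec_bp_smooth[OF t z] hl.smooth_mult[OF properQ hc_smooth[OF t z] hl.smooth_constant[OF properQ _ a]]])
      (use z in simp)
  moreover have "nhd Q ?z {w. q (sec U \<tau> (bp w)) (hc \<tau> w \<cdot> a) = act B w a}"
  proof (rule nhd_mono[OF nhd_bp[OF t z]], intro subsetI CollectI)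
    fix w assume "w \<in> {w. w \<in> PH \<and> bp w \<in> U}"
    then have w: "w \<in> PH" "bp w \<in> U" by auto
    show "q (sec U \<tau> (bp w)) (hc \<tau> w \<cdot> a) = act B w a"
      using act_B[OF sec_props(1)[OF t w(2)] hc_in[OF t w] a] q_sec_hc[OF t w] by simp
  qed
  ultimately show s: "smooth_at Q Q (\<lambda>z. act B z a) ?z" by (rule smooth_at_cong[OF properQ, rotated])
  have "tangent_map T Q (\<lambda>v. act B (q v h) a) u \<xi> = tangent_map Q Q (\<lambda>z. act B z a) ?z (hor u h \<xi>)"
    by (rule tangent_map_compose[where f="\<lambda>v. q v h" and g="\<lambda>z. act B z a", OF atlT atlQ s q_fst_smooth[OF u h] \<xi>])
  moreover have "tangent_map T Q (\<lambda>v. act B (q v h) a) u = hor u (h \<cdot> a)"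
    by (rule tangent_map_cong_pts[OF properT u]) (simp add: act_B h a)
  ultimately show "tangent_map Q Q (\<lambda>z. act B z a) (q u h) (hor u h \<xi>) = hor u (h \<cdot> a) \<xi>" by simp
qed

text \<open>Differentiates \<open>h y a = (h a) (a^-1 y a)\<close> in \<open>y\<close> at the
  unit.\<close>

lemma right_ver:
  assumes u: "u \<in> pts T" and h: "h \<in> carrier H" and a: "a \<in> carrier H" and Y: "Y \<in> lie_algebra H"
  shows "tangent_map Q Q (\<lambda>z. act B z a) (q u h) (ver u h Y) = ver u (h \<cdot> a) (Ad H (invH a) Y)"
proof -
  let ?i = "invH a"
  have Y': "Y \<in> tangent_space K \<ee>" using Y by (simp add: lie_algebra_def)
  have s: "smooth_at Q Q (\<lambda>z. act B z a) (q u (h \<cdot> \<ee>))"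
    using right_hor(2)[OF u h a tangent_space_zero[OF atlT u]] h by simp
  have "tangent_map K Q (\<lambda>y. act B (q u (h \<cdot> y)) a) \<ee> Y =
      tangent_map Q Q (\<lambda>z. act B z a) (q u (h \<cdot> \<ee>)) (ver u h Y)"
    by (rule tangent_map_compose[where f="\<lambda>y. q u (h \<cdot> y)" and g="\<lambda>z. act B z a",
          OF hl.atl atlQ s q_orbit_smooth[OF u h hl.one_closed] Y'])
  moreover have "tangent_map K Q (\<lambda>y. q u ((h \<cdot> a) \<cdot> (?i \<cdot> y \<cdot> invH ?i))) \<ee> Y =
      tangent_map K Q (\<lambda>y. q u ((h \<cdot> a) \<cdot> y)) (?i \<cdot> \<ee> \<cdot> invH ?i) (Ad H ?i Y)"
    unfolding Ad_def
    by (rule tangent_map_compose[OF hl.atl hl.atl q_orbit_smooth hl.smooth_conj Y']) (use u h a in auto)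
  moreover have "tangent_map K Q (\<lambda>y. act B (q u (h \<cdot> y)) a) \<ee> =
      tangent_map K Q (\<lambda>y. q u ((h \<cdot> a) \<cdot> (?i \<cdot> y \<cdot> invH ?i))) \<ee>"
  proof (rule tangent_map_cong_pts[OF hl.proper])
    fix y assume "y \<in> pts K"
    then have y: "y \<in> carrier H" by simp
    have "a \<cdot> (?i \<cdot> (y \<cdot> a)) = y \<cdot> a"
      using a y by (simp add: hl.m_assoc[symmetric])
    then have "(h \<cdot> a) \<cdot> (?i \<cdot> y \<cdot> invH ?i) = h \<cdot> y \<cdot> a"
      using h a y by (simp add: hl.m_assoc)
    then show "act B (q u (h \<cdot> y)) a = q u ((h \<cdot> a) \<cdot> (?i \<cdot> y \<cdot> invH ?i))"
      using h a y u by (simp add: act_B)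
  qed simp
  ultimately show ?thesis using h a by simp
qed

lemma fundamental_B:
  assumes u: "u \<in> pts T" and h: "h \<in> carrier H" and Y: "Y \<in> lie_algebra H"
  shows "fundamental_field H B Y (q u h) = ver u h Y"
proof -
  have s: "smooth_at K Q (act B (q u h)) \<ee>"
    by (rule smooth_at_cong_pts[OF hl.proper _ q_orbit_smooth[OF u h hl.one_closed]]) (simp add: act_B u h)
  have "fundamental_field H B Y (q u h) = tangent_map K Q (act B (q u h)) \<ee> Y"
    using fundamental_field_eq[OF hl.lie_group Y, of B "q u h"] s by simp
  also have "tangent_map K Q (act B (q u h)) \<ee> = ver u h"
    by (rule tangent_map_cong_pts[OF hl.proper]) (simp_all add: act_B u h)
  finally show ?thesis .
qed

lemma act_orbit_smooth: "u \<in> pts T \<Longrightarrow> g \<in> carrier G \<Longrightarrow> smooth_at L T (act P u) g"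
  using act_smooth[OF gl.proper smooth_at_const[OF gl.proper, of g u T] gl.smooth_ident[of g]] by simp

lemma act_right_smooth: "u \<in> pts T \<Longrightarrow> g \<in> carrier G \<Longrightarrow> smooth_at T T (\<lambda>v. act P v g) u"
  by (rule act_smooth[OF properT smooth_at_ident[OF atlT] gl.smooth_constant[OF properT]])

lemma fundamental_P:
  assumes u: "u \<in> pts T" and X: "X \<in> lie_algebra G"
  shows "fundamental_field G P X u = tangent_map L T (act P u) \<one>\<^bsub>G\<^esub> X"
  by (rule fundamental_field_eq[OF gl.lie_group X act_orbit_smooth[OF u gl.one_closed]])

lemma principal_connection_decomposed:
  assumes \<omega>: "\<omega> \<in> principal_connections H B" and u: "u \<in> pts T" and h: "h \<in> carrier H"
    and \<xi>: "\<xi> \<in> tangent_space T u" and Y: "Y \<in> lie_algebra H"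
  shows "\<omega> (q u h) (\<lambda>d. hor u h \<xi> d + ver u h Y d) =
    (\<lambda>d. Ad H (invH h) (\<omega> (q u \<ee>) (hor u \<ee> \<xi>)) d + Y d)"
proof -
  have of: "\<omega> \<in> one_forms Q H" and eq: "\<And>g z v. g \<in> carrier H \<Longrightarrow> z \<in> pts Q \<Longrightarrow> v \<in> tangent_space Q z \<Longrightarrow>
      \<omega> (act B z g) (tangent_map Q Q (\<lambda>u. act B u g) z v) = Ad H (invH g) (\<omega> z v)"
    and fu: "\<And>Y z. Y \<in> lie_algebra H \<Longrightarrow> z \<in> pts Q \<Longrightarrow> \<omega> z (fundamental_field H B Y z) = Y"
    using \<omega> by (auto simp: principal_connections_def equivariant_forms_def)
  have l: "linear_form Q H \<omega> (q u h)" using of q_in[OF u h] by (simp add: one_forms_iff[OF atlQ])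
  have "\<omega> (q u h) (hor u h \<xi>) = Ad H (invH h) (\<omega> (q u \<ee>) (hor u \<ee> \<xi>))"
    using eq[OF h _ hor_in[OF u hl.one_closed \<xi>]] right_hor(1)[OF u hl.one_closed h \<xi>] act_B[OF u hl.one_closed h]
      q_in[OF u hl.one_closed] h by simp
  moreover have "\<omega> (q u h) (ver u h Y) = Y"
    using fu[OF Y, of "q u h"] fundamental_B[OF u h Y] q_in[OF u h] by simp
  ultimately show ?thesis
    using linear_form_add[OF l hor_in[OF u h \<xi>] ver_in[OF u h Y]] by simp
qed

section \<open>The pullback to P\<close>

abbreviation pull :: "(('p \<times> 'h) set \<Rightarrow> (('p \<times> 'h) set, 'em \<times> 'eh) tvec \<Rightarrow> ('h, 'eh) tvec) \<Rightarrow>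
    'p \<Rightarrow> ('p, 'ep) tvec \<Rightarrow> ('h, 'eh) tvec" where
  "pull \<equiv> pullback_form T Q (assoc_incl G H P)"

lemma pull_eq: "u \<in> pts T \<Longrightarrow> \<xi> \<in> tangent_space T u \<Longrightarrow> pull \<omega> u \<xi> = \<omega> (q u \<ee>) (hor u \<ee> \<xi>)"
  by (simp add: pullback_form_def iota_eq)

lemma pull_inj:
  assumes 1: "\<omega> \<in> principal_connections H B" and 2: "\<omega>' \<in> principal_connections H B" and eq: "pull \<omega> = pull \<omega>'"
  shows "\<omega> = \<omega>'"
proof (intro ext)
  fix z v d
  have of: "\<omega> \<in> one_forms Q H" "\<omega>' \<in> one_forms Q H"
    using 1 2 by (auto simp: principal_connections_def equivariant_forms_def)
  show "\<omega> z v d = \<omega>' z v d"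
  proof (cases "z \<in> pts Q \<and> v \<in> tangent_space Q z")
    case True
    then obtain u h where u: "u \<in> pts T" and h: "h \<in> carrier H" and z: "z = q u h" using assoc_space_iff by auto
    obtain \<xi> Y where d: "\<xi> \<in> tangent_space T u" "Y \<in> lie_algebra H" "v = (\<lambda>d. hor u h \<xi> d + ver u h Y d)"
      using tangent_decomposition[OF u h] True z by blast
    have "\<omega> (q u \<ee>) (hor u \<ee> \<xi>) = \<omega>' (q u \<ee>) (hor u \<ee> \<xi>)"
      using pull_eq[OF u d(1), of \<omega>] pull_eq[OF u d(1), of \<omega>'] eq by simp
    then show ?thesis
      unfolding z d(3) principal_connection_decomposed[OF 1 u h d(1,2)] principal_connection_decomposed[OF 2 u h d(1,2)]
      by simp
  next
    case False
    then show ?thesis using of by (simp add: one_forms_iff[OF atlQ])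
  qed
qed

lemma incl_in: "X \<in> lie_algebra G \<Longrightarrow> lie_algebra_incl G H X \<in> lie_algebra H"
  using tangent_map_in[OF gl.atl hl.atl incl_smooth[OF gl.one_closed], of X] one_eq
  by (simp add: lie_algebra_def lie_algebra_incl_def)

text \<open>By \<open>q(u g, e) = q(u, g)\<close>, the G-orbit of \<open>u\<close> is carried into
  the H-orbit of \<open>q(u, e)\<close> by the inclusion of G into H; both sides differentiate this
  map at the unit.\<close>

lemma hor_fundamental:
  assumes u: "u \<in> pts T" and X: "X \<in> lie_algebra G"
  shows "hor u \<ee> (fundamental_field G P X u) = ver u \<ee> (lie_algebra_incl G H X)"
proof -
  have X': "X \<in> tangent_space L \<one>\<^bsub>G\<^esub>" using X by (simp add: lie_algebra_def)
  have s: "smooth_at T Q (\<lambda>v. q v \<ee>) (act P u \<one>\<^bsub>G\<^esub>)" using q_fst_smooth[OF u] act_one[OF u] by simp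
  have s': "smooth_at K Q (\<lambda>y. q u (\<ee> \<cdot> y)) \<one>\<^bsub>G\<^esub>" using q_orbit_smooth[OF u] one_eq by simp
  have "tangent_map L Q (\<lambda>g. q (act P u g) \<ee>) \<one>\<^bsub>G\<^esub> X =
      tangent_map T Q (\<lambda>v. q v \<ee>) (act P u \<one>\<^bsub>G\<^esub>) (tangent_map L T (act P u) \<one>\<^bsub>G\<^esub> X)"
    by (rule tangent_map_compose[where f="act P u" and g="\<lambda>v. q v \<ee>",
          OF gl.atl atlT s act_orbit_smooth[OF u gl.one_closed] X'])
  moreover have "tangent_map L Q (\<lambda>g. q u (\<ee> \<cdot> g)) \<one>\<^bsub>G\<^esub> X =
      tangent_map K Q (\<lambda>y. q u (\<ee> \<cdot> y)) \<one>\<^bsub>G\<^esub> (tangent_map L K (\<lambda>x. x) \<one>\<^bsub>G\<^esub> X)"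
    by (rule tangent_map_compose[where f="\<lambda>x. x" and g="\<lambda>y. q u (\<ee> \<cdot> y)",
          OF gl.atl hl.atl s' incl_smooth[OF gl.one_closed] X'])
  moreover have "tangent_map L Q (\<lambda>g. q (act P u g) \<ee>) \<one>\<^bsub>G\<^esub> = tangent_map L Q (\<lambda>g. q u (\<ee> \<cdot> g)) \<one>\<^bsub>G\<^esub>"
    by (rule tangent_map_cong_pts[OF gl.proper]) (auto simp: q_act u sub_carrier)
  ultimately show ?thesis using act_one[OF u] by (simp add: fundamental_P[OF u X] lie_algebra_incl_def one_eq)
qed

lemma pull_in:
  assumes \<omega>: "\<omega> \<in> principal_connections H B"
  shows "pull \<omega> \<in> generalized_cartan_connections G H P"
proof -
  have of: "\<omega> \<in> one_forms Q H" using \<omega> by (auto simp: principal_connections_def equivariant_forms_def)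
  note ofQ = of[unfolded one_forms_iff[OF atlQ]]
  have lq: "\<And>z. z \<in> pts Q \<Longrightarrow> linear_form Q H \<omega> z" using ofQ by blast
  have one: "\<And>u. u \<in> pts T \<Longrightarrow> q u \<ee> \<in> pts Q" using q_in by simp
  let ?\<kappa> = "\<lambda>u \<xi>. \<omega> (q u \<ee>) (hor u \<ee> \<xi>)"
  have lin: "linear_form T H ?\<kappa> u" if u: "u \<in> pts T" for u
    using linear_form_pullback[where f="\<lambda>v. q v \<ee>", OF atlT atlQ lq[OF one[OF u]] q_fst_smooth[OF u hl.one_closed]] .
  have sm: "form_smooth_at T H ?\<kappa> u" if u: "u \<in> pts T" for u
  proof (rule form_smooth_at_pullback[where f="\<lambda>v. q v \<ee>", OF atlT atlQ _ lq u])
    show "form_smooth_at Q H \<omega> (q u \<ee>)" using ofQ one[OF u] by blast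
    show "nhd T u {v. smooth_at T Q (\<lambda>v. q v \<ee>) v}"
      using q_fst_smooth by (intro nhd_mono[OF nhd_pts[OF properT]]) auto
  qed
  have "pull \<omega> \<in> one_forms T H"
    unfolding one_forms_iff[OF atlT]
  proof (intro conjI ballI allI impI)
    fix u assume u: "u \<in> pts T"
    show "linear_form T H (pull \<omega>) u"
      using lin[OF u] tangent_space_lin[OF atlT u] unfolding linear_form_def by (simp add: pull_eq u)
    have pt: "\<forall>v\<in>tangent_space T w. \<omega> (q w \<ee>) (hor w \<ee> v) = pull \<omega> w v" if "w \<in> pts T" for w
      using pull_eq[OF that] by simp
    show "form_smooth_at T H (pull \<omega>) u"
      by (rule form_smooth_at_cong[OF atlT nhd_mono[OF nhd_pts[OF properT]] sm[OF u]]) (use pt in blast)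
  next
    fix p v assume "\<not> (p \<in> pts T \<and> v \<in> tangent_space T p)"
    then show "pull \<omega> p v = (\<lambda>_. 0)" unfolding pullback_form_def by (rule if_not_P)
  qed
  moreover have "pull \<omega> (act P u g) (tangent_map T T (\<lambda>u. act P u g) u \<xi>) = Ad H (invH g) (pull \<omega> u \<xi>)"
    if g: "g \<in> carrier G" and u: "u \<in> pts T" and \<xi>: "\<xi> \<in> tangent_space T u" for g u \<xi>
  proof -
    have gH: "g \<in> carrier H" using g by (rule sub_carrier)
    have ug: "act P u g \<in> pts T" by (rule act_in[OF u g])
    \<comment> \<open>Since \<open>q(v g, e) = q(v, g)\<close>, translating by \<open>g\<close> in P
      before the inclusion amounts to moving from \<open>q(u, e)\<close> to \<open>q(u, g)\<close>,
      where the H-equivariance of \<open>\<omega>\<close> is available.\<close>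
    have "tangent_map T Q (\<lambda>v. q (act P v g) \<ee>) u \<xi> = hor (act P u g) \<ee> (tangent_map T T (\<lambda>u. act P u g) u \<xi>)"
      by (rule tangent_map_compose[where f="\<lambda>v. act P v g" and g="\<lambda>v. q v \<ee>",
            OF atlT atlT q_fst_smooth[OF ug hl.one_closed] act_right_smooth[OF u g] \<xi>])
    moreover have "tangent_map T Q (\<lambda>v. q (act P v g) \<ee>) u = hor u g"
      by (rule tangent_map_cong_pts[OF properT u]) (use g gH in \<open>simp add: q_act\<close>)
    ultimately have "hor (act P u g) \<ee> (tangent_map T T (\<lambda>u. act P u g) u \<xi>) = hor u g \<xi>" by simp
    moreover have "q (act P u g) \<ee> = q u g" using q_act[OF u g hl.one_closed] gH by simp
    moreover have "\<omega> (q u g) (hor u g \<xi>) = Ad H (invH g) (\<omega> (q u \<ee>) (hor u \<ee> \<xi>))"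
    proof -
      \<comment> \<open>The zero vector as second component specializes
        \<open>principal_connection_decomposed\<close> to vectors in the image of
        \<open>hor\<close>.\<close>
      have z: "(\<lambda>_. 0) \<in> lie_algebra H" unfolding lie_algebra_def by (rule tangent_space_zero[OF hl.atl]) simp
      have "ver u g (\<lambda>_. 0) = (\<lambda>_. 0)" by (rule tangent_map_zero[OF q_orbit_smooth[OF u gH hl.one_closed]])
      then show ?thesis using principal_connection_decomposed[OF \<omega> u gH \<xi> z] by simp
    qed
    ultimately show ?thesis
      using pull_eq[OF ug tangent_map_in[OF atlT atlT act_right_smooth[OF u g] \<xi>]] pull_eq[OF u \<xi>] by simp
  qed
  moreover have "pull \<omega> u (fundamental_field G P X u) = lie_algebra_incl G H X"
    if X: "X \<in> lie_algebra G" and u: "u \<in> pts T" for X u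
  proof -
    have X': "X \<in> tangent_space L \<one>\<^bsub>G\<^esub>" using X by (simp add: lie_algebra_def)
    have ff: "fundamental_field G P X u \<in> tangent_space T u"
      using tangent_map_in[OF gl.atl atlT act_orbit_smooth[OF u gl.one_closed] X'] act_one[OF u] by (simp add: fundamental_P[OF u X])
    have "\<omega> (q u \<ee>) (fundamental_field H B (lie_algebra_incl G H X) (q u \<ee>)) = lie_algebra_incl G H X"
      using \<omega> incl_in[OF X] one[OF u] by (simp add: principal_connections_def)
    then show ?thesis
      using pull_eq[OF u ff] hor_fundamental[OF u X] fundamental_B[OF u hl.one_closed incl_in[OF X]] by simp
  qed
  ultimately show ?thesis
    by (simp add: generalized_cartan_connections_def equivariant_forms_def)
qed


subsection \<open>Extending a Cartan connection\<close>

text \<open>The form \<open>Ad(h\<^sup>-\<^sup>1) (s\<^sup>* \<kappa>) + \<theta>\<close> in the trivialization \<open>z \<mapsto> (bp z, h = hc \<tau> z)\<close>.\<close>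

definition local_ext :: "('p \<Rightarrow> ('p, 'ep) tvec \<Rightarrow> ('h, 'eh) tvec) \<Rightarrow> 'm set \<Rightarrow> ('p \<Rightarrow> 'h) \<Rightarrow>
    ('p \<times> 'h) set \<Rightarrow> (('p \<times> 'h) set, 'em \<times> 'eh) tvec \<Rightarrow> ('h, 'eh) tvec" where
  "local_ext \<kappa> U \<tau> z v = (\<lambda>d. Ad H (invH (hc \<tau> z)) (\<kappa> (sec U \<tau> (bp z)) (tangent_map Q T (\<lambda>w. sec U \<tau> (bp w)) z v)) d +
     maurer_cartan H (hc \<tau> z) (tangent_map Q K (hc \<tau>) z v) d)"

text \<open>Some trivialization around the base point is picked;
  \<open>extension_eq_local_ext\<close> shows that all of them give the same value on tangent
  vectors.\<close>

definition extension :: "('p \<Rightarrow> ('p, 'ep) tvec \<Rightarrow> ('h, 'eh) tvec) \<Rightarrow>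
    ('p \<times> 'h) set \<Rightarrow> (('p \<times> 'h) set, 'em \<times> 'eh) tvec \<Rightarrow> ('h, 'eh) tvec" where
  "extension \<kappa> z v = (if z \<in> pts Q \<and> v \<in> tangent_space Q z
     then (let (U, \<tau>) = (SOME (U, \<tau>). (U, \<tau>) \<in> triv \<and> bp z \<in> U) in local_ext \<kappa> U \<tau> z v) else (\<lambda>_. 0))"

context
  fixes \<kappa> assumes \<kappa>: "\<kappa> \<in> generalized_cartan_connections G H P"
begin

lemma kappa_form: "\<kappa> \<in> one_forms T H"
  using \<kappa> by (simp add: generalized_cartan_connections_def equivariant_forms_def)

lemma kappa_linear: "u \<in> pts T \<Longrightarrow> linear_form T H \<kappa> u"
  and kappa_smooth: "u \<in> pts T \<Longrightarrow> form_smooth_at T H \<kappa> u"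
  using kappa_form by (simp_all add: one_forms_iff[OF atlT])

lemma kappa_equivariant: "g \<in> carrier G \<Longrightarrow> u \<in> pts T \<Longrightarrow> \<xi> \<in> tangent_space T u \<Longrightarrow>
    \<kappa> (act P u g) (tangent_map T T (\<lambda>u. act P u g) u \<xi>) = Ad H (invH g) (\<kappa> u \<xi>)"
  using \<kappa> by (simp add: generalized_cartan_connections_def equivariant_forms_def)

text \<open>The orbit map of \<open>s\<close> near \<open>g\<close> is the orbit map of
  \<open>s g\<close> near the unit after a left translation. So the vector becomes a fundamental
  vector, on which the value of \<open>\<kappa>\<close> is prescribed: along G-orbits
  \<open>\<kappa>\<close> is the Maurer-Cartan form.\<close>

lemma kappa_orbit:
  assumes s: "s \<in> pts T" and g: "g \<in> carrier G" and \<eta>: "\<eta> \<in> tangent_space L g"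
  shows "\<kappa> (act P s g) (tangent_map L T (act P s) g \<eta>) = maurer_cartan H g (tangent_map L K (\<lambda>x. x) g \<eta>)"
proof -
  let ?u = "act P s g" and ?i = "inv\<^bsub>G\<^esub> g" and ?X = "maurer_cartan G g \<eta>"
  have u: "?u \<in> pts T" by (rule act_in[OF s g])
  have ig: "?i \<otimes>\<^bsub>G\<^esub> g = \<one>\<^bsub>G\<^esub>" using g by simp
  have X: "?X \<in> lie_algebra G" by (rule gl.maurer_cartan_in[OF g \<eta>])
  have "tangent_map L T (\<lambda>y. act P ?u (?i \<otimes>\<^bsub>G\<^esub> y)) g \<eta> =
      tangent_map L T (act P ?u) (?i \<otimes>\<^bsub>G\<^esub> g) (tangent_map L L (\<lambda>y. ?i \<otimes>\<^bsub>G\<^esub> y) g \<eta>)"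
    by (rule tangent_map_compose[OF gl.atl gl.atl act_orbit_smooth gl.smooth_left \<eta>]) (use u g in auto)
  moreover have "tangent_map L T (\<lambda>y. act P ?u (?i \<otimes>\<^bsub>G\<^esub> y)) g = tangent_map L T (act P s) g"
    by (rule tangent_map_cong_pts[OF gl.proper]) (use s g in \<open>auto simp: act_act gl.m_assoc[symmetric]\<close>)
  ultimately have "tangent_map L T (act P s) g \<eta> = fundamental_field G P ?X ?u"
    using fundamental_P[OF u X] ig by (simp add: maurer_cartan_def)
  then have "\<kappa> ?u (tangent_map L T (act P s) g \<eta>) = lie_algebra_incl G H ?X"
    using \<kappa> X u by (simp add: generalized_cartan_connections_def)
  \<comment> \<open>The inclusion of G into H intertwines the left translations, so it carries one
    Maurer-Cartan form to the other.\<close>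
  also have "\<dots> = tangent_map L K (\<lambda>y. ?i \<otimes>\<^bsub>G\<^esub> y) g \<eta>"
    using tangent_map_compose[where f="\<lambda>y. ?i \<otimes>\<^bsub>G\<^esub> y" and g="\<lambda>x. x",
        OF gl.atl gl.atl incl_smooth gl.smooth_left \<eta>] g ig
    by (simp add: lie_algebra_incl_def maurer_cartan_def)
  also have "tangent_map L K (\<lambda>y. ?i \<otimes>\<^bsub>G\<^esub> y) g = tangent_map L K (\<lambda>y. invH g \<cdot> y) g"
  proof (rule tangent_map_cong_pts[OF gl.proper])
    show "?i \<otimes>\<^bsub>G\<^esub> y = invH g \<cdot> y" if "y \<in> pts L" for y
      using that mult_eq[OF gl.inv_closed[OF g], of y] inv_eq[OF g] by simp
  qed (use g in simp)
  also have "\<dots> \<eta> = tangent_map K K (\<lambda>y. invH g \<cdot> y) g (tangent_map L K (\<lambda>x. x) g \<eta>)"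
    by (rule tangent_map_compose[where f="\<lambda>x. x" and g="\<lambda>y. invH g \<cdot> y",
          OF gl.atl hl.atl hl.smooth_left incl_smooth \<eta>]) (use g sub_carrier in auto)
  finally show ?thesis by (simp add: maurer_cartan_def)
qed

lemma local_ext_linear:
  assumes t: "(U, \<tau>) \<in> triv" and z: "z \<in> PH" "bp z \<in> U"
  shows "linear_form Q H (local_ext \<kappa> U \<tau>) z"
proof -
  have s: "sec U \<tau> (bp z) \<in> pts T" by (rule sec_props(1)[OF t z(2)])
  have h: "hc \<tau> z \<in> carrier H" by (rule hc_in[OF t z])
  show ?thesis
    unfolding local_ext_def[abs_def]
    by (intro hl.linear_form_sum hl.linear_form_Ad[where a="\<lambda>z. invH (hc \<tau> z)"]
        linear_form_pullback[OF atlQ atlT kappa_linear[OF s] sec_bp_smooth[OF t z]]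
        linear_form_pullback[OF atlQ hl.atl hl.maurer_cartan_linear[OF h] hc_smooth[OF t z]])
      (use h in simp)
qed

lemma local_ext_smooth:
  assumes t: "(U, \<tau>) \<in> triv" and z: "z \<in> PH" "bp z \<in> U"
  shows "form_smooth_at Q H (local_ext \<kappa> U \<tau>) z"
proof -
  have s: "sec U \<tau> (bp z) \<in> pts T" by (rule sec_props(1)[OF t z(2)])
  have h: "hc \<tau> z \<in> carrier H" by (rule hc_in[OF t z])
  have zQ: "z \<in> pts Q" using z by simp
  note n = nhd_bp[OF t z]
  let ?\<alpha> = "\<lambda>z v. \<kappa> (sec U \<tau> (bp z)) (tangent_map Q T (\<lambda>w. sec U \<tau> (bp w)) z v)"
  have a: "form_smooth_at Q H ?\<alpha> z"
    by (rule form_smooth_at_pullback[where f="\<lambda>w. sec U \<tau> (bp w)", OF atlQ atlT kappa_smooth[OF s] kappa_linear zQ])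
      (auto intro!: nhd_mono[OF n] sec_bp_smooth[OF t])
  have la: "nhd Q z {w. linear_form Q H ?\<alpha> w}"
  proof (rule nhd_mono[OF n], clarsimp)
    fix w assume w: "w \<in> PH" "bp w \<in> U"
    show "linear_form Q H ?\<alpha> w"
      by (rule linear_form_pullback[OF atlQ atlT kappa_linear[OF sec_props(1)[OF t w(2)]] sec_bp_smooth[OF t w]])
  qed
  have b: "form_smooth_at Q H (\<lambda>z v. maurer_cartan H (hc \<tau> z) (tangent_map Q K (hc \<tau>) z v)) z"
    by (rule form_smooth_at_pullback[where f="hc \<tau>", OF atlQ hl.atl hl.maurer_cartan_smooth[OF h] hl.maurer_cartan_linear zQ])
      (auto intro!: nhd_mono[OF n] hc_smooth[OF t])
  show ?thesis
    unfolding local_ext_def[abs_def]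
    by (rule form_smooth_at_add[OF hl.form_smooth_at_Ad[OF atlQ hl.smooth_inv[OF properQ hc_smooth[OF t z]] a la] b])
qed

text \<open>The base point is constant along an H-orbit, so the term with \<open>\<kappa>\<close>
  vanishes; the fibre coordinate there is \<open>(\<tau> u) h y\<close>, and its Maurer-Cartan value
  is \<open>Y\<close>.\<close>

lemma local_ext_ver:
  assumes t: "(U, \<tau>) \<in> triv" and u: "u \<in> pts T" "pr u \<in> U" and h: "h \<in> carrier H" and Y: "Y \<in> lie_algebra H"
  shows "local_ext \<kappa> U \<tau> (q u h) (ver u h Y) = Y"
proof -
  let ?z = "q u h"
  have z: "?z \<in> PH" "bp ?z \<in> U" using q_in[OF u(1) h] bp_q[OF u(1) h] u by auto
  have Y': "Y \<in> tangent_space K \<ee>" using Y by (simp add: lie_algebra_def)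
  have z1: "q u (h \<cdot> \<ee>) = ?z" using h by simp
  note o = q_orbit_smooth[OF u(1) h hl.one_closed]
  have tau: "\<tau> u \<in> carrier H" using tau_in[OF t u] by (rule sub_carrier)
  have hz: "hc \<tau> ?z = \<tau> u \<cdot> h" by (rule hc_q[OF t u h])
  have "tangent_map K T (\<lambda>y. sec U \<tau> (bp (q u (h \<cdot> y)))) \<ee> Y =
      tangent_map Q T (\<lambda>w. sec U \<tau> (bp w)) ?z (ver u h Y)"
    using tangent_map_compose[where f="\<lambda>y. q u (h \<cdot> y)" and g="\<lambda>w. sec U \<tau> (bp w)", OF hl.atl atlQ _ o Y', of T]
      sec_bp_smooth[OF t z] z1 by simp
  moreover have "tangent_map K T (\<lambda>y. sec U \<tau> (bp (q u (h \<cdot> y)))) \<ee> = tangent_map K T (\<lambda>y. sec U \<tau> (pr u)) \<ee>"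
    by (rule tangent_map_cong_pts[OF hl.proper]) (auto simp: bp_q u h)
  ultimately have 1: "tangent_map Q T (\<lambda>w. sec U \<tau> (bp w)) ?z (ver u h Y) = (\<lambda>_. 0)"
    by (simp add: tangent_map_const)
  have "tangent_map K K (\<lambda>y. hc \<tau> (q u (h \<cdot> y))) \<ee> Y = tangent_map Q K (hc \<tau>) ?z (ver u h Y)"
    using tangent_map_compose[where f="\<lambda>y. q u (h \<cdot> y)" and g="hc \<tau>", OF hl.atl atlQ _ o Y', of K]
      hc_smooth[OF t z] z1 by simp
  moreover have "tangent_map K K (\<lambda>y. hc \<tau> (q u (h \<cdot> y))) \<ee> = tangent_map K K (\<lambda>y. (\<tau> u \<cdot> h) \<cdot> y) \<ee>"
    by (rule tangent_map_cong_pts[OF hl.proper]) (auto simp: hc_q[OF t u] h tau hl.m_assoc)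
  ultimately have 2: "maurer_cartan H (hc \<tau> ?z) (tangent_map Q K (hc \<tau>) ?z (ver u h Y)) = Y"
    using hl.maurer_cartan_left[of "\<tau> u \<cdot> h" Y] tau h Y by (simp add: hz)
  have s: "sec U \<tau> (bp ?z) \<in> pts T" by (rule sec_props(1)[OF t z(2)])
  show ?thesis
    unfolding local_ext_def 1 2 linear_form_zero[OF atlT s kappa_linear[OF s]]
    using hl.Ad_zero[of "invH (hc \<tau> ?z)"] hc_in[OF t z] by simp
qed

text \<open>Here the dependence on the section disappears. Put \<open>g = \<tau> u\<close> and let s
  be the section value over \<open>pr u\<close>. Splitting \<open>\<xi>\<close> along the
  factorization of \<open>sec_act\<close> gives \<open>\<kappa> u \<xi>\<close> as
  \<open>Ad(g^-1) (\<kappa> s \<xi>1)\<close> plus the Maurer-Cartan form on \<open>\<eta>'\<close>.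
  The fibre coordinate of \<open>q u h\<close> is \<open>g h\<close>, so the local form is exactly
  \<open>Ad(h^-1)\<close> of this sum.\<close>

lemma local_ext_hor:
  assumes t: "(U, \<tau>) \<in> triv" and u: "u \<in> pts T" "pr u \<in> U" and h: "h \<in> carrier H" and \<xi>: "\<xi> \<in> tangent_space T u"
  shows "local_ext \<kappa> U \<tau> (q u h) (hor u h \<xi>) = Ad H (invH h) (\<kappa> u \<xi>)"
proof -
  let ?z = "q u h" and ?s = "sec U \<tau> (pr u)"
  define g where "g = \<tau> u"
  have z: "?z \<in> PH" "bp ?z \<in> U" and bz: "bp ?z = pr u" using q_in[OF u(1) h] bp_q[OF u(1) h] u by auto
  note o = q_fst_smooth[OF u(1) h]
  have g: "g \<in> carrier G" "g \<in> carrier H" using tau_in[OF t u] sub_carrier by (auto simp: g_def)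
  have hz: "hc \<tau> ?z = g \<cdot> h" unfolding g_def by (rule hc_q[OF t u h])
  have s: "?s \<in> pts T" by (rule sec_props(1)[OF t u(2)])
  have su: "act P ?s g = u" unfolding g_def by (rule sec_act[OF t u])
  have secpr: "smooth_at T T (\<lambda>v. sec U \<tau> (pr v)) u"
    by (rule smooth_at_compose[where f=pr, OF properT properM sec_smooth[OF t u(2)] proj_smooth[OF u(1)]])
  have tau: "smooth_at T L \<tau> u" by (rule tau_smooth[OF t u])
  \<comment> \<open>\<open>\<xi>1\<close> is the component along the section, \<open>\<eta>\<close>
    the change of the fibre coordinate in G, and \<open>\<eta>'\<close> the same vector regarded in
    H.\<close>
  define \<xi>1 where "\<xi>1 = tangent_map T T (\<lambda>v. sec U \<tau> (pr v)) u \<xi>"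
  define \<eta> where "\<eta> = tangent_map T L \<tau> u \<xi>"
  define \<eta>' where "\<eta>' = tangent_map L K (\<lambda>x. x) g \<eta>"
  have \<xi>1: "\<xi>1 \<in> tangent_space T ?s" unfolding \<xi>1_def by (rule tangent_map_in[OF atlT atlT secpr \<xi>])
  have \<eta>: "\<eta> \<in> tangent_space L g" unfolding \<eta>_def g_def by (rule tangent_map_in[OF atlT gl.atl tau \<xi>])
  have \<eta>': "\<eta>' \<in> tangent_space K g" unfolding \<eta>'_def by (rule tangent_map_in[OF gl.atl hl.atl incl_smooth[OF g(1)] \<eta>])
  have tauK: "smooth_at T K \<tau> u"
    using smooth_at_compose[where f=\<tau> and g="\<lambda>x. x", OF properT gl.proper incl_smooth tau] g by (simp add: g_def)
  have tauK_eq: "tangent_map T K \<tau> u \<xi> = \<eta>'"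
    using tangent_map_compose[where f=\<tau> and g="\<lambda>x. x", OF atlT gl.atl incl_smooth tau \<xi>] g
    by (simp add: \<eta>'_def \<eta>_def flip: g_def)
  have nu: "nhd T u (pr -` U \<inter> pts T)" by (rule nhd_Int[OF triv_nhd_total[OF t u] nhd_pts[OF properT]])

  have "tangent_map T T (\<lambda>v. sec U \<tau> (bp (q v h))) u \<xi> = tangent_map Q T (\<lambda>w. sec U \<tau> (bp w)) ?z (hor u h \<xi>)"
    by (rule tangent_map_compose[where f="\<lambda>v. q v h" and g="\<lambda>w. sec U \<tau> (bp w)", OF atlT atlQ sec_bp_smooth[OF t z] o \<xi>])
  moreover have "tangent_map T T (\<lambda>v. sec U \<tau> (bp (q v h))) u = tangent_map T T (\<lambda>v. sec U \<tau> (pr v)) u"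
    by (rule tangent_map_cong_pts[OF properT u(1)]) (simp add: bp_q h)
  ultimately have 1: "tangent_map Q T (\<lambda>w. sec U \<tau> (bp w)) ?z (hor u h \<xi>) = \<xi>1" by (simp add: \<xi>1_def)

  have "tangent_map T K (\<lambda>v. hc \<tau> (q v h)) u \<xi> = tangent_map Q K (hc \<tau>) ?z (hor u h \<xi>)"
    by (rule tangent_map_compose[where f="\<lambda>v. q v h" and g="hc \<tau>", OF atlT atlQ hc_smooth[OF t z] o \<xi>])
  moreover have "tangent_map T K (\<lambda>v. hc \<tau> (q v h)) u = tangent_map T K (\<lambda>v. \<tau> v \<cdot> h) u"
    by (rule tangent_map_cong[OF properT u(1) nhd_mono[OF nu]]) (auto simp: hc_q[OF t] h)
  moreover have "tangent_map T K (\<lambda>v. \<tau> v \<cdot> h) u \<xi> = tangent_map K K (\<lambda>y. y \<cdot> h) (\<tau> u) (tangent_map T K \<tau> u \<xi>)"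
    by (rule tangent_map_compose[where f=\<tau> and g="\<lambda>y. y \<cdot> h", OF atlT hl.atl hl.smooth_right tauK \<xi>])
      (use g h in \<open>auto simp: g_def\<close>)
  ultimately have 2: "maurer_cartan H (hc \<tau> ?z) (tangent_map Q K (hc \<tau>) ?z (hor u h \<xi>)) = Ad H (invH h) (maurer_cartan H g \<eta>')"
    using hl.maurer_cartan_right[OF g(2) h \<eta>'] by (simp add: hz tauK_eq flip: g_def)

  have m: "smooth_at (prod_atlas T L) T (\<lambda>x. act P (fst x) (snd x)) (?s, \<tau> u)"
    by (rule act_smooth2[OF s]) (use g in \<open>simp add: g_def\<close>)
  \<comment> \<open>The Leibniz rule is applied to the identity of P, factored as the section value
    acted on by the fibre coordinate.\<close>
  have "\<xi> = tangent_map T T (\<lambda>v. v) u \<xi>" using tangent_map_ident[OF atlT u(1) \<xi>] by simp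
  also have "tangent_map T T (\<lambda>v. v) u = tangent_map T T (\<lambda>v. act P (sec U \<tau> (pr v)) (\<tau> v)) u"
    by (rule tangent_map_cong[OF properT u(1) nhd_mono[OF nu]]) (auto simp: sec_act[OF t])
  also have "\<dots> \<xi> = (\<lambda>e. tangent_map T T (\<lambda>x. act P x g) ?s \<xi>1 e + tangent_map L T (act P ?s) g \<eta> e)"
    using tangent_map_product[OF atlT gl.atl atlT m secpr tau \<xi>] by (simp add: \<xi>1_def \<eta>_def flip: g_def)
  finally have split: "\<xi> = (\<lambda>e. tangent_map T T (\<lambda>x. act P x g) ?s \<xi>1 e + tangent_map L T (act P ?s) g \<eta> e)" .
  have "\<kappa> u \<xi> = (\<lambda>d. \<kappa> u (tangent_map T T (\<lambda>x. act P x g) ?s \<xi>1) d + \<kappa> u (tangent_map L T (act P ?s) g \<eta>) d)"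
    using tangent_map_in[OF atlT atlT act_right_smooth[OF s g(1)] \<xi>1] tangent_map_in[OF gl.atl atlT act_orbit_smooth[OF s g(1)] \<eta>]
    by (subst split, intro linear_form_add[OF kappa_linear[OF u(1)]]) (simp_all add: su)
  also have "\<dots> = (\<lambda>d. Ad H (invH g) (\<kappa> ?s \<xi>1) d + maurer_cartan H g \<eta>' d)"
    using kappa_equivariant[OF g(1) s \<xi>1] kappa_orbit[OF s g(1) \<eta>] by (simp add: su \<eta>'_def)
  finally have "Ad H (invH h) (\<kappa> u \<xi>) = (\<lambda>d. Ad H (invH h) (Ad H (invH g) (\<kappa> ?s \<xi>1)) d + Ad H (invH h) (maurer_cartan H g \<eta>') d)"
    using hl.Ad_add h by simp
  moreover have "Ad H (invH (hc \<tau> ?z)) (\<kappa> ?s \<xi>1) = Ad H (invH h) (Ad H (invH g) (\<kappa> ?s \<xi>1))"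
    using hl.Ad_mult[of "invH h" "invH g" "\<kappa> ?s \<xi>1"] linear_formD(1)[OF kappa_linear[OF s] \<xi>1] g h
    by (simp add: hz hl.inv_mult_group)
  ultimately show ?thesis unfolding local_ext_def 1 2 bz by simp
qed

lemma local_ext_decomposed:
  assumes t: "(U, \<tau>) \<in> triv" and u: "u \<in> pts T" "pr u \<in> U" and h: "h \<in> carrier H"
    and \<xi>: "\<xi> \<in> tangent_space T u" and Y: "Y \<in> lie_algebra H"
  shows "local_ext \<kappa> U \<tau> (q u h) (\<lambda>d. hor u h \<xi> d + ver u h Y d) = (\<lambda>d. Ad H (invH h) (\<kappa> u \<xi>) d + Y d)"
proof -
  have z: "q u h \<in> PH" "bp (q u h) \<in> U" using q_in[OF u(1) h] bp_q[OF u(1) h] u by auto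
  show ?thesis
    using linear_form_add[OF local_ext_linear[OF t z] hor_in[OF u(1) h \<xi>] ver_in[OF u(1) h Y]]
    by (simp add: local_ext_hor[OF t u h \<xi>] local_ext_ver[OF t u h Y])
qed

text \<open>Both trivializations are evaluated on the same decomposition of \<open>v\<close>, so its
  ambiguity does no harm.\<close>

lemma extension_eq_local_ext:
  assumes t: "(U, \<tau>) \<in> triv" and z: "z \<in> PH" "bp z \<in> U" and v: "v \<in> tangent_space Q z"
  shows "extension \<kappa> z v = local_ext \<kappa> U \<tau> z v"
proof -
  obtain U' \<tau>' where e: "(SOME (U, \<tau>). (U, \<tau>) \<in> triv \<and> bp z \<in> U) = (U', \<tau>')" by fastforce
  have "\<exists>x. case x of (U, \<tau>) \<Rightarrow> (U, \<tau>) \<in> triv \<and> bp z \<in> U" using t z by auto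
  from someI_ex[OF this] have t': "(U', \<tau>') \<in> triv" "bp z \<in> U'" unfolding e by auto
  obtain u h where u: "u \<in> pts T" and h: "h \<in> carrier H" and zq: "z = q u h" using z assoc_space_iff by auto
  have pu: "pr u \<in> U" "pr u \<in> U'" using bp_q[OF u h] zq z t' by auto
  obtain \<xi> Y where d: "\<xi> \<in> tangent_space T u" "Y \<in> lie_algebra H" "v = (\<lambda>d. hor u h \<xi> d + ver u h Y d)"
    using tangent_decomposition[OF u h] v zq by blast
  have "extension \<kappa> z v = local_ext \<kappa> U' \<tau>' z v" using z v by (simp add: extension_def e)
  then show ?thesis
    using local_ext_decomposed[OF t u pu(1) h d(1,2)] local_ext_decomposed[OF t'(1) u pu(2) h d(1,2)] by (simp add: zq d(3))
qed

lemma extension_decomposed: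
  assumes u: "u \<in> pts T" and h: "h \<in> carrier H" and \<xi>: "\<xi> \<in> tangent_space T u" and Y: "Y \<in> lie_algebra H"
  shows "extension \<kappa> (q u h) (\<lambda>d. hor u h \<xi> d + ver u h Y d) = (\<lambda>d. Ad H (invH h) (\<kappa> u \<xi>) d + Y d)"
proof -
  obtain U \<tau> where t: "(U, \<tau>) \<in> triv" and pu: "pr u \<in> U" using triv_exists[OF proj_in[OF u]] by blast
  have z: "q u h \<in> PH" "bp (q u h) \<in> U" using q_in[OF u h] bp_q[OF u h] pu by auto
  have "(\<lambda>d. hor u h \<xi> d + ver u h Y d) \<in> tangent_space Q (q u h)"
    using tangent_space_lin[OF atlQ _ hor_in[OF u h \<xi>] ver_in[OF u h Y], of 1 1] z by simp
  then show ?thesis using extension_eq_local_ext[OF t z] local_ext_decomposed[OF t u pu h \<xi> Y] by simp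
qed

text \<open>Linearity and smoothness are local and come from the local forms; equivariance and the
  values on fundamental fields are checked on decompositions.\<close>

lemma extension_in: "extension \<kappa> \<in> principal_connections H B"
proof -
  have lin: "linear_form Q H (extension \<kappa>) z" and sm: "form_smooth_at Q H (extension \<kappa>) z" if zQ: "z \<in> pts Q" for z
  proof -
    have z: "z \<in> PH" using zQ by simp
    have "bp z \<in> pts M" using smooth_at_pts(2)[OF bp_smooth[OF z]] .
    then obtain U \<tau> where t: "(U, \<tau>) \<in> triv" and bz: "bp z \<in> U" using triv_exists by blast
    note l = local_ext_linear[OF t z bz]
    show "linear_form Q H (extension \<kappa>) z"
      unfolding linear_form_def
      using linear_formD[OF l] tangent_space_lin[OF atlQ zQ] by (simp add: extension_eq_local_ext[OF t z bz])
    show "form_smooth_at Q H (extension \<kappa>) z"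
      by (rule form_smooth_at_cong[OF atlQ nhd_mono[OF nhd_bp[OF t z bz]] local_ext_smooth[OF t z bz]])
        (auto simp: extension_eq_local_ext[OF t])
  qed
  have "extension \<kappa> \<in> one_forms Q H"
    unfolding one_forms_iff[OF atlQ] using lin sm by (auto simp: extension_def)
  moreover have "extension \<kappa> (act B z a) (tangent_map Q Q (\<lambda>u. act B u a) z v) = Ad H (invH a) (extension \<kappa> z v)"
    if a: "a \<in> carrier H" and z: "z \<in> pts Q" and v: "v \<in> tangent_space Q z" for a z v
  proof -
    obtain u h where u: "u \<in> pts T" and h: "h \<in> carrier H" and zq: "z = q u h" using z assoc_space_iff by auto
    obtain \<xi> Y where d: "\<xi> \<in> tangent_space T u" "Y \<in> lie_algebra H" "v = (\<lambda>d. hor u h \<xi> d + ver u h Y d)"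
      using tangent_decomposition[OF u h] v zq by blast
    have ha: "h \<cdot> a \<in> carrier H" using h a by simp
    have AY: "Ad H (invH a) Y \<in> lie_algebra H" using hl.Ad_in[OF _ d(2)] a by simp
    have k: "\<kappa> u \<xi> \<in> lie_algebra H" by (rule linear_formD(1)[OF kappa_linear[OF u] d(1)])
    \<comment> \<open>Right translation carries a decomposition at \<open>h\<close> to one at
      \<open>h a\<close>, with \<open>Y\<close> replaced by \<open>Ad(a^-1) Y\<close>.\<close>
    have "tangent_map Q Q (\<lambda>u. act B u a) z v = (\<lambda>d. hor u (h \<cdot> a) \<xi> d + ver u (h \<cdot> a) (Ad H (invH a) Y) d)"
      using tangent_map_lin[OF right_hor(2)[OF u h a d(1)], of 1 "hor u h \<xi>" 1 "ver u h Y"]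
      by (simp add: zq d(3) right_hor(1)[OF u h a d(1)] right_ver[OF u h a d(2)])
    then have "extension \<kappa> (act B z a) (tangent_map Q Q (\<lambda>u. act B u a) z v) =
        (\<lambda>d. Ad H (invH (h \<cdot> a)) (\<kappa> u \<xi>) d + Ad H (invH a) Y d)"
      using extension_decomposed[OF u ha d(1) AY] act_B[OF u h a] by (simp add: zq)
    also have "Ad H (invH (h \<cdot> a)) (\<kappa> u \<xi>) = Ad H (invH a) (Ad H (invH h) (\<kappa> u \<xi>))"
      using hl.Ad_mult[of "invH a" "invH h"] h a k by (simp add: hl.inv_mult_group)
    also have "(\<lambda>d. Ad H (invH a) (Ad H (invH h) (\<kappa> u \<xi>)) d + Ad H (invH a) Y d) =
        Ad H (invH a) (\<lambda>d. Ad H (invH h) (\<kappa> u \<xi>) d + Y d)"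
      using hl.Ad_add a by simp
    also have "(\<lambda>d. Ad H (invH h) (\<kappa> u \<xi>) d + Y d) = extension \<kappa> z v"
      using extension_decomposed[OF u h d(1,2)] by (simp add: zq d(3))
    finally show ?thesis .
  qed
  moreover have "extension \<kappa> z (fundamental_field H B Y z) = Y" if Y: "Y \<in> lie_algebra H" and z: "z \<in> pts Q" for Y z
  proof -
    obtain u h where u: "u \<in> pts T" and h: "h \<in> carrier H" and zq: "z = q u h" using z assoc_space_iff by auto
    show ?thesis
      using extension_decomposed[OF u h tangent_space_zero[OF atlT u] Y] tangent_map_zero[OF q_fst_smooth[OF u h]]
        linear_form_zero[OF atlT u kappa_linear[OF u]] hl.Ad_zero[of "invH h"] h
      by (simp add: zq fundamental_B[OF u h Y])
  qed
  ultimately show ?thesis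
    by (simp add: principal_connections_def equivariant_forms_def)
qed

text \<open>On tangent vectors this is the case \<open>h = e\<close>, \<open>Y = 0\<close> of
  \<open>extension_decomposed\<close>; elsewhere both forms vanish by convention.\<close>

lemma pull_extension: "pull (extension \<kappa>) = \<kappa>"
proof (intro ext)
  fix u \<xi> d
  have z0: "(\<lambda>_. 0) \<in> lie_algebra H" unfolding lie_algebra_def by (rule tangent_space_zero[OF hl.atl]) simp
  show "pull (extension \<kappa>) u \<xi> d = \<kappa> u \<xi> d"
  proof (cases "u \<in> pts T \<and> \<xi> \<in> tangent_space T u")
    case True
    then have u: "u \<in> pts T" and \<xi>: "\<xi> \<in> tangent_space T u" by auto
    have k: "\<kappa> u \<xi> \<in> lie_algebra H" by (rule linear_formD(1)[OF kappa_linear[OF u] \<xi>])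
    have "ver u \<ee> (\<lambda>_. 0) = (\<lambda>_. 0)"
      by (rule tangent_map_zero[OF q_orbit_smooth[OF u hl.one_closed hl.one_closed]])
    then have "extension \<kappa> (q u \<ee>) (hor u \<ee> \<xi>) = \<kappa> u \<xi>"
      using extension_decomposed[OF u hl.one_closed \<xi> z0] hl.Ad_one[OF k] by simp
    then show ?thesis using pull_eq[OF u \<xi>] by simp
  next
    case False
    then have "\<kappa> u \<xi> = (\<lambda>_. 0)" using kappa_form by (simp add: one_forms_iff[OF atlT])
    moreover have "pull (extension \<kappa>) u \<xi> = (\<lambda>_. 0)" unfolding pullback_form_def using False by (rule if_not_P)
    ultimately show ?thesis by simp
  qed
qed

end

lemma pull_bij: "bij_betw pull (principal_connections H B) (generalized_cartan_connections G H P)"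
proof (rule bij_betw_byWitness[where f'=extension])
  show "\<forall>\<kappa>\<in>generalized_cartan_connections G H P. pull (extension \<kappa>) = \<kappa>" using pull_extension by blast
  \<comment> \<open>By \<open>pull_inj\<close> it suffices that both sides have the same pullback,
    and this is \<open>pull_extension\<close> for \<open>pull \<omega>\<close>.\<close>
  show "\<forall>\<omega>\<in>principal_connections H B. extension (pull \<omega>) = \<omega>"
    using pull_in extension_in pull_extension by (auto intro!: pull_inj)
  show "pull ` principal_connections H B \<subseteq> generalized_cartan_connections G H P" using pull_in by blast
  show "extension ` generalized_cartan_connections G H P \<subseteq> principal_connections H B" using extension_in by blast
qed

end

theorem lemma3p2:
  fixes G :: "('h, 'eg::model_space) lie_group_data"
    and H :: "('h, 'eh::model_space) lie_group_data"
    and P :: "('p, 'ep::model_space, 'm, 'em::model_space, 'h) bundle_data"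
  assumes "principal_bundle G P"
    and "lie_subgroup G H"
    and "dim (UNIV :: 'eh set) = dim (UNIV :: 'ep set)"
  shows "bij_betw (pullback_form (total P) (total (assoc_bundle G H P)) (assoc_incl G H P))
           (principal_connections H (assoc_bundle G H P))
           (generalized_cartan_connections G H P)"
proof -
  interpret principal_extension G H P by standard (rule assms)+
  show ?thesis using pull_bij by simp
qed

end
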